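(* The capacity region $\mathcal{C}^{f}_{gmac-ncsit-dms}$ of the two-user Gaussian multiple-access channel with noncausal state information at the transmitters, degraded message sets and noiseless feedback described in the context, with power constraints $P_1,P_2>0$, state variance $Q>0$ and noise variance $\sigma_1^2>0$, equals the capacity region of the same channel without feedback, and both equal \[ \bigcup_{0\le\rho\le1}\Big\{(R_1\ge0,R_2\ge0):\ R_2\le\tfrac12\log\Big(1+\tfrac{P_2(1-\rho^2)}{\sigma_1^2}\Big),\ R_1+R_2\le\tfrac12\log\Big(1+\tfrac{P_1+P_2+2\sqrt{P_1P_2}\rho}{\sigma_1^2}\Big)\Big\}. \]
   Context: All logarithms are base 2. Channel (GMAC-NCSIT-DMS): for $i=1,\dots,N$, $Y_i=X_{1,i}+X_{2,i}+S_i+\eta_{1,i}$, where $S_i\sim\mathcal N(0,Q)$ and $\eta_{1,i}\sim\mathcal N(0,\sigma_1^2)$ are i.i.d. over $i$, mutually independent, and independent of the messages. Messages $W_1,W_2$ are independent, $W_j$ uniform on $\{1,\dots,|\mathcal W_j|\}$. With feedback: $X_{1,i}$ is a function of $W_1$, the whole state sequence $S^N$ (known noncausally to both transmitters, not to the receiver) and the noiseless feedback $Y^{i-1}$; $X_{2,i}$ is a function of $W_1$, $W_2$, $S^N$ and $Y^{i-1}$. Without feedback: the same but with no dependence on $Y^{i-1}$. Power constraints: $\frac1N\sum_{i=1}^N E[X_{j,i}^2]\le P_j$. The receiver outputs $(\hat W_1,\hat W_2)=\psi(Y^N)$; $P_e$ is the average probability that $\psi(Y^N)\neq(W_1,W_2)$.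 A pair $(R_1,R_2)$ is achievable if for every $\epsilon>0$ and all sufficiently large $N$ there exist encoders and a decoder with $\frac{\log|\mathcal W_j|}{N}=R_j$ ($j=1,2$) and $P_e\le\epsilon$; the capacity region is the set of all achievable pairs.
   Formalization: The condition log|W_j|/N = R_j, which for all large N would force 2^{R_j} to be an integer and make the claimed equality false, is replaced by the standard convention |W_j| = ⌈2^{N R_j}⌉ with R_j ≥ 0. *)

theory Defs
  imports "HOL-Probability.Probability"
begin

definition gauss :: "real \<Rightarrow> real measure" where
  "gauss v = density lborel (normal_density 0 (sqrt v))"

text \<open>Sample space of one block of length N: state sequence S^N (i.i.d. N(0,Q))
  and noise sequence eta^N (i.i.d. N(0,v)), independent. Time indices are 0..N-1.\<close>
definition omega :: "real \<Rightarrow> real \<Rightarrow> nat \<Rightarrow> ((nat \<Rightarrow> real) \<times> (nat \<Rightarrow> real)) measure" where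
  "omega Q v N = (PiM {..<N} (\<lambda>_. gauss Q)) \<Otimes>\<^sub>M (PiM {..<N} (\<lambda>_. gauss v))"

text \<open>Encoder 1: time i, message w1, state sequence, past outputs (feedback).
  Encoder 2: time i, messages w1 w2, state sequence, past outputs.\<close>
type_synonym enc1 = "nat \<Rightarrow> nat \<Rightarrow> (nat \<Rightarrow> real) \<Rightarrow> (nat \<Rightarrow> real) \<Rightarrow> real"
type_synonym enc2 = "nat \<Rightarrow> nat \<Rightarrow> nat \<Rightarrow> (nat \<Rightarrow> real) \<Rightarrow> (nat \<Rightarrow> real) \<Rightarrow> real"

text \<open>yseq ... i = outputs Y_0..Y_{i-1} (zero at later positions): the feedback
  available before time i.  Y_i = X_{1,i} + X_{2,i} + S_i + eta_i.\<close>
fun yseq :: "enc1 \<Rightarrow> enc2 \<Rightarrow> nat \<Rightarrow> nat \<Rightarrow> (nat \<Rightarrow> real) \<Rightarrow> (nat \<Rightarrow> real) \<Rightarrow> nat \<Rightarrow> (nat \<Rightarrow> real)" where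
  "yseq f1 f2 w1 w2 s e 0 = (\<lambda>_. 0)"
| "yseq f1 f2 w1 w2 s e (Suc i) =
     (let y = yseq f1 f2 w1 w2 s e i
      in y(i := f1 i w1 s y + f2 i w1 w2 s y + s i + e i))"

definition good_code ::
  "real \<Rightarrow> real \<Rightarrow> real \<Rightarrow> real \<Rightarrow> nat \<Rightarrow> nat \<Rightarrow> nat \<Rightarrow> real
   \<Rightarrow> enc1 \<Rightarrow> enc2 \<Rightarrow> ((nat \<Rightarrow> real) \<Rightarrow> nat \<times> nat) \<Rightarrow> bool" where
  "good_code P1 P2 Q v N M1 M2 eps f1 f2 dec \<longleftrightarrow>
    (let \<Omega> = omega Q v N;
         X1 = (\<lambda>i w1 w2 \<omega>. f1 i w1 (fst \<omega>) (yseq f1 f2 w1 w2 (fst \<omega>) (snd \<omega>) i));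
         X2 = (\<lambda>i w1 w2 \<omega>. f2 i w1 w2 (fst \<omega>) (yseq f1 f2 w1 w2 (fst \<omega>) (snd \<omega>) i));
         Err = (\<lambda>w1 w2. {\<omega> \<in> space \<Omega>. dec (yseq f1 f2 w1 w2 (fst \<omega>) (snd \<omega>) N) \<noteq> (w1, w2)})
     in (\<forall>w1\<in>{1..M1}. \<forall>w2\<in>{1..M2}.
           (\<forall>i<N. X1 i w1 w2 \<in> borel_measurable \<Omega> \<and> X2 i w1 w2 \<in> borel_measurable \<Omega>)
           \<and> Err w1 w2 \<in> sets \<Omega>)
      \<and> (\<Sum>i<N. \<Sum>w1\<in>{1..M1}. \<Sum>w2\<in>{1..M2}. \<integral>\<^sup>+ \<omega>. ennreal ((X1 i w1 w2 \<omega>)\<^sup>2) \<partial>\<Omega>)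
          \<le> ennreal (real N * real M1 * real M2 * P1)
      \<and> (\<Sum>i<N. \<Sum>w1\<in>{1..M1}. \<Sum>w2\<in>{1..M2}. \<integral>\<^sup>+ \<omega>. ennreal ((X2 i w1 w2 \<omega>)\<^sup>2) \<partial>\<Omega>)
          \<le> ennreal (real N * real M1 * real M2 * P2)
      \<and> (\<Sum>w1\<in>{1..M1}. \<Sum>w2\<in>{1..M2}. measure \<Omega> (Err w1 w2)) / (real M1 * real M2) \<le> eps)"

definition msgs :: "nat \<Rightarrow> real \<Rightarrow> nat" where
  "msgs N R = nat \<lceil>2 powr (real N * R)\<rceil>"

definition achievable_fb :: "real \<Rightarrow> real \<Rightarrow> real \<Rightarrow> real \<Rightarrow> real \<times> real \<Rightarrow> bool" where
  "achievable_fb P1 P2 Q v r \<longleftrightarrow> fst r \<ge> 0 \<and> snd r \<ge> 0 \<and>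
     (\<forall>eps>0. \<exists>N0. \<forall>N\<ge>N0. \<exists>f1 f2 dec.
        good_code P1 P2 Q v N (msgs N (fst r)) (msgs N (snd r)) eps f1 f2 dec)"

definition achievable_nofb :: "real \<Rightarrow> real \<Rightarrow> real \<Rightarrow> real \<Rightarrow> real \<times> real \<Rightarrow> bool" where
  "achievable_nofb P1 P2 Q v r \<longleftrightarrow> fst r \<ge> 0 \<and> snd r \<ge> 0 \<and>
     (\<forall>eps>0. \<exists>N0. \<forall>N\<ge>N0.
        \<exists>(g1 :: nat \<Rightarrow> nat \<Rightarrow> (nat \<Rightarrow> real) \<Rightarrow> real)
         (g2 :: nat \<Rightarrow> nat \<Rightarrow> nat \<Rightarrow> (nat \<Rightarrow> real) \<Rightarrow> real) dec.
        good_code P1 P2 Q v N (msgs N (fst r)) (msgs N (snd r)) eps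
          (\<lambda>i w1 s y. g1 i w1 s) (\<lambda>i w1 w2 s y. g2 i w1 w2 s) dec)"

definition capacity_fb :: "real \<Rightarrow> real \<Rightarrow> real \<Rightarrow> real \<Rightarrow> (real \<times> real) set" where
  "capacity_fb P1 P2 Q v = {r. achievable_fb P1 P2 Q v r}"

definition capacity_nofb :: "real \<Rightarrow> real \<Rightarrow> real \<Rightarrow> real \<Rightarrow> (real \<times> real) set" where
  "capacity_nofb P1 P2 Q v = {r. achievable_nofb P1 P2 Q v r}"

definition region :: "real \<Rightarrow> real \<Rightarrow> real \<Rightarrow> (real \<times> real) set" where
  "region P1 P2 v = (\<Union>\<rho>\<in>{0..1}. {(R1, R2). R1 \<ge> 0 \<and> R2 \<ge> 0 \<and>
      R2 \<le> 1/2 * log 2 (1 + P2 * (1 - \<rho>\<^sup>2) / v) \<and>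
      R1 + R2 \<le> 1/2 * log 2 (1 + (P1 + P2 + 2 * sqrt (P1 * P2) * \<rho>) / v)})"

end

theory Submission
  imports Defs
begin

text \<open>
  Converse. Compare the true output law with a reference channel whose outputs are, given the state
  (and \<open>W\<^sub>1\<close>, for the bound on \<open>R\<^sub>2\<close>), independent of the message: at each time the mean
  is predicted from the past and the variance is inflated to \<open>v + B\<close>. Taking the expectation of
  \<open>ln t \<le> t / 2 - 1 + ln 2\<close> at the likelihood ratio \<open>t\<close>, weighted by the number of
  messages on correct decoding, gives \<open>(1 - P\<^sub>e) ln M \<le> N / 2 ln (1 + B / v) + ln 2\<close>.
  Predicting \<open>X\<^sub>2\<close> by the multiple of \<open>X\<^sub>1\<close> given by their overall correlation \<open>\<rho>\<close>
  makes \<open>B = P\<^sub>2 (1 - \<rho>\<^sup>2)\<close>; feedback does not matter because undoing it is a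
  volume-preserving triangular map.

  Achievability. Two dirty-paper codes are superposed: both encoders beam a common word \<open>x\<close> against
  the interference \<open>s\<close>, and encoder 2 adds a word \<open>z\<close> against the interference \<open>s + x\<close>.
  Code words are uniform in a huge cube, so an admissible offset is found in a bin, and a wrong bin is
  compatible with the output, with probabilities proportional to two volumes; only their ratio
  matters, and it does not depend on the law of the interference. The rate of the first code is split
  off \<open>W\<^sub>1\<close>, and the rest of \<open>W\<^sub>1\<close> travels with \<open>W\<^sub>2\<close>. Since power is only
  constrained on average, silencing both encoders on a rare state event leaves strictly more power
  elsewhere, which yields the boundary of the region.
\<close>

section \<open>Gaussian vectors\<close>


text \<open>The definition of achievability grants no slack in the rate, while random coding only
  reaches rates strictly inside the region; hence the detour through silence to gain power. In the
  converse, likelihoods are compared instead of entropies, so that only second moments of the inputs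
  enter. One prediction coefficient serves all times and messages: the averaging over them happens
  inside a single quadratic form and yields one \<open>\<rho>\<close> for both constraints. For
  achievability, concentration is Chebyshev's inequality only. It decays like 1/N, which is enough
  for the few events about the transmitted words, whereas the exponentially many wrong words are
  controlled by volumes alone. Power and near orthogonality of \<open>z\<close> to \<open>x\<close>
  are enforced by the encoders for every state and every codebook, so the codebook is selected for
  its error probability alone.\<close>

lemma prob_space_gauss: "v > 0 \<Longrightarrow> prob_space (gauss v)"
  unfolding gauss_def by (rule prob_space_normal_density) simp

lemma sets_gauss[simp, measurable_cong]: "sets (gauss v) = sets borel"
  by (simp add: gauss_def)

lemma space_gauss[simp]: "space (gauss v) = UNIV"
  by (simp add: gauss_def)

section \<open>Moments of Gaussian letters and Chebyshev bounds for vectors\<close>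

lemma has_bochner_integral_gauss:
  assumes "v > 0" "f \<in> borel_measurable borel"
    and "has_bochner_integral lborel (\<lambda>x. normal_density 0 (sqrt v) x * f x) I"
  shows "has_bochner_integral (gauss v) f I"
  unfolding gauss_def using assms
  by (intro has_bochner_integral_density) auto

lemma gauss_mean: "v > 0 \<Longrightarrow> has_bochner_integral (gauss v) (\<lambda>x. x) 0"
  using normal_moment_odd[of "sqrt v" 0 0]
  by (intro has_bochner_integral_gauss) auto

lemma gauss_variance: "v > 0 \<Longrightarrow> has_bochner_integral (gauss v) (\<lambda>x. x\<^sup>2) v"
  using normal_moment_even[of "sqrt v" 0 1]
  by (intro has_bochner_integral_gauss) (auto simp: power2_eq_square fact_numeral)

lemma gauss_fourth_moment: "v > 0 \<Longrightarrow> has_bochner_integral (gauss v) (\<lambda>x. x^4) (3 * v\<^sup>2)"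
  using normal_moment_even[of "sqrt v" 0 2]
  by (intro has_bochner_integral_gauss) (auto simp: fact_numeral power2_eq_square power_divide real_sqrt_power field_simps)

text \<open>The cross term has mean zero. The nonnegative integral is used because \<open>c\<close>
  will be a value of another variable whose square is not known to be integrable.\<close>

lemma nn_integral_shifted_square:
  assumes "prob_space M" "has_bochner_integral M h 0" "has_bochner_integral M (\<lambda>x. (h x)\<^sup>2) s"
  shows "(\<integral>\<^sup>+ x. ennreal ((c + h x)\<^sup>2) \<partial>M) = ennreal (c\<^sup>2 + s)"
proof -
  interpret prob_space M by fact
  have "has_bochner_integral M (\<lambda>x. c\<^sup>2 + (2 * c * h x + (h x)\<^sup>2)) (c\<^sup>2 + (2 * c * 0 + s))"
    using assms(2,3) by (intro has_bochner_integral_add has_bochner_integral_mult_right)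
      (auto simp: has_bochner_integral_iff prob_space)
  then have "has_bochner_integral M (\<lambda>x. (c + h x)\<^sup>2) (c\<^sup>2 + s)"
    by (simp add: power2_sum algebra_simps)
  then show ?thesis
    by (simp add: has_bochner_integral_iff nn_integral_eq_integral)
qed

lemma product_sigma_finite_const: "sigma_finite_measure M \<Longrightarrow> product_sigma_finite (\<lambda>_. M)"
  by (simp add: product_sigma_finite_def)

lemma prob_space_PiM_gauss: "v > 0 \<Longrightarrow> prob_space (PiM I (\<lambda>_. gauss v))"
  by (intro prob_space_PiM prob_space_gauss)

abbreviation gaussN :: "nat \<Rightarrow> real \<Rightarrow> (nat \<Rightarrow> real) measure" where
  "gaussN N v \<equiv> PiM {..<N} (\<lambda>_. gauss v)"

text \<open>Independence enters through Fubini alone: the last coordinate is integrated first, and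
  for it the sum of the others is a constant shift.\<close>

lemma nn_integral_PiM_sum_square:
  fixes N :: nat
  assumes M: "prob_space M"
    and h: "\<And>i. i < N \<Longrightarrow> has_bochner_integral M (h i) 0"
    and h2: "\<And>i. i < N \<Longrightarrow> has_bochner_integral M (\<lambda>x. (h i x)\<^sup>2) (s i)"
  shows "(\<integral>\<^sup>+ x. ennreal ((\<Sum>i<N. h i (x i))\<^sup>2) \<partial>PiM {..<N} (\<lambda>_. M)) = ennreal (\<Sum>i<N. s i)"
  using h h2
proof (induction N)
  case 0
  then show ?case by (simp add: PiM_empty nn_integral_count_space_finite)
next
  case (Suc N)
  interpret M: prob_space M by fact
  interpret product_sigma_finite "\<lambda>_::nat. M"
    by (intro product_sigma_finite_const M.sigma_finite_measure_axioms)
  interpret P: prob_space "PiM {..<N} (\<lambda>_. M)" by (intro prob_space_PiM M)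
  have meas: "h i \<in> borel_measurable M" if "i < Suc N" for i
    using Suc.prems(1)[OF that] by (auto simp: has_bochner_integral_iff)
  have [measurable]: "(\<lambda>x. \<Sum>i<n. h i (x i)) \<in> borel_measurable (PiM {..<n} (\<lambda>_. M))" if "n \<le> Suc N" for n
    by (intro borel_measurable_sum measurable_compose[OF measurable_component_singleton]) (use that meas in auto)
  have s0: "s i \<ge> 0" if "i < Suc N" for i
  proof -
    have "s i = (\<integral>x. (h i x)\<^sup>2 \<partial>M)"
      using Suc.prems(2)[OF that] by (auto simp: has_bochner_integral_iff)
    then show ?thesis by simp
  qed
  have "(\<integral>\<^sup>+ x. ennreal ((\<Sum>i<Suc N. h i (x i))\<^sup>2) \<partial>PiM {..<Suc N} (\<lambda>_. M))
      = (\<integral>\<^sup>+ x. (\<integral>\<^sup>+ y. ennreal ((\<Sum>i<Suc N. h i ((x(N := y)) i))\<^sup>2) \<partial>M) \<partial>PiM {..<N} (\<lambda>_. M))"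
    unfolding lessThan_Suc
    by (subst product_nn_integral_insert) (auto simp: lessThan_Suc[symmetric] simp del: sum.lessThan_Suc)
  also have "\<dots> = (\<integral>\<^sup>+ x. ennreal ((\<Sum>i<N. h i (x i))\<^sup>2 + s N) \<partial>PiM {..<N} (\<lambda>_. M))"
  proof (intro nn_integral_cong)
    fix x :: "nat \<Rightarrow> 'a"
    show "(\<integral>\<^sup>+ y. ennreal ((\<Sum>i<Suc N. h i ((x(N := y)) i))\<^sup>2) \<partial>M) = ennreal ((\<Sum>i<N. h i (x i))\<^sup>2 + s N)"
      using nn_integral_shifted_square[OF M Suc.prems(1)[of N] Suc.prems(2)[of N], of "\<Sum>i<N. h i (x i)"]
      by simp
  qed
  also have "\<dots> = (\<integral>\<^sup>+ x. ennreal ((\<Sum>i<N. h i (x i))\<^sup>2) \<partial>PiM {..<N} (\<lambda>_. M)) + ennreal (s N)"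
    using s0[of N] by (simp add: ennreal_plus nn_integral_add P.emeasure_space_1)
  also have "\<dots> = ennreal (\<Sum>i<Suc N. s i)"
    using Suc s0 sum_nonneg[of "{..<N}" s] by (simp add: ennreal_plus)
  finally show ?case .
qed

text \<open>Chebyshev's inequality. Both the squared norm and the inner product with a fixed vector
  are sums of this kind.\<close>

lemma emeasure_PiM_sum_ge:
  fixes N :: nat
  assumes M: "prob_space M" and t: "t > 0"
    and h: "\<And>i. i < N \<Longrightarrow> has_bochner_integral M (h i) 0"
    and h2: "\<And>i. i < N \<Longrightarrow> has_bochner_integral M (\<lambda>x. (h i x)\<^sup>2) (s i)"
  shows "emeasure (PiM {..<N} (\<lambda>_. M)) {x \<in> space (PiM {..<N} (\<lambda>_. M)). \<bar>\<Sum>i<N. h i (x i)\<bar> \<ge> t}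
    \<le> ennreal ((\<Sum>i<N. s i) / t\<^sup>2)"
proof -
  let ?P = "PiM {..<N} (\<lambda>_. M)"
  have [measurable]: "(\<lambda>x. \<Sum>i<N. h i (x i)) \<in> borel_measurable ?P"
    using h by (intro borel_measurable_sum measurable_compose[OF measurable_component_singleton])
      (auto simp: has_bochner_integral_iff)
  have "{x \<in> space ?P. \<bar>\<Sum>i<N. h i (x i)\<bar> \<ge> t}
    = {x \<in> space ?P. 1 \<le> ennreal (1 / t\<^sup>2) * ennreal ((\<Sum>i<N. h i (x i))\<^sup>2)}"
    using t abs_le_square_iff[of t] by (auto simp: ennreal_mult[symmetric] field_simps)
  also have "emeasure ?P \<dots> \<le> ennreal (1 / t\<^sup>2) * (\<integral>\<^sup>+ x. ennreal ((\<Sum>i<N. h i (x i))\<^sup>2) * indicator (space ?P) x \<partial>?P)"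
    using nn_integral_Markov_inequality[of "\<lambda>x. ennreal ((\<Sum>i<N. h i (x i))\<^sup>2)" "space ?P" ?P "ennreal (1 / t\<^sup>2)"] by simp
  also have "\<dots> = ennreal (1 / t\<^sup>2) * (\<integral>\<^sup>+ x. ennreal ((\<Sum>i<N. h i (x i))\<^sup>2) \<partial>?P)"
    by (intro arg_cong2[where f="(*)"] nn_integral_cong refl) auto
  also have "\<dots> = ennreal ((\<Sum>i<N. s i) / t\<^sup>2)"
    using t h2 by (subst nn_integral_PiM_sum_square[OF M h h2])
      (auto simp: ennreal_mult'[symmetric])
  finally show ?thesis .
qed

definition ip :: "nat \<Rightarrow> (nat \<Rightarrow> real) \<Rightarrow> (nat \<Rightarrow> real) \<Rightarrow> real" where
  "ip N x y = (\<Sum>i<N. x i * y i)"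

abbreviation sqn :: "nat \<Rightarrow> (nat \<Rightarrow> real) \<Rightarrow> real" where
  "sqn N x \<equiv> ip N x x"

lemma gauss_norm_concentration:
  assumes "v > 0" "t > 0"
  shows "emeasure (gaussN N v)
     {x \<in> space (gaussN N v). \<bar>sqn N x - real N * v\<bar> \<ge> t} \<le> ennreal (2 * real N * v\<^sup>2 / t\<^sup>2)"
proof -
  interpret prob_space "gauss v" using assms(1) by (rule prob_space_gauss)
  have prob_UNIV: "prob UNIV = 1" using prob_space by simp
  have 1: "has_bochner_integral (gauss v) (\<lambda>x. x\<^sup>2 - v) 0"
    using gauss_variance[OF assms(1)] by (simp add: has_bochner_integral_iff prob_UNIV)
  \<comment> \<open>The variance of the square of a Gaussian letter is 3 v^2 - v^2.\<close>
  have 2: "has_bochner_integral (gauss v) (\<lambda>x. (x\<^sup>2 - v)\<^sup>2) (2 * v\<^sup>2)"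
  proof -
    have "has_bochner_integral (gauss v) (\<lambda>x. (x^4 - 2 * v * x\<^sup>2) + v\<^sup>2) ((3 * v\<^sup>2 - 2 * v * v) + v\<^sup>2)"
      by (intro has_bochner_integral_add has_bochner_integral_diff gauss_fourth_moment
          has_bochner_integral_mult_right gauss_variance assms)
        (auto simp: has_bochner_integral_iff prob_UNIV)
    then show ?thesis
      by (simp add: power2_diff algebra_simps power2_eq_square power4_eq_xxxx)
  qed
  show ?thesis
    using emeasure_PiM_sum_ge[OF prob_space_axioms assms(2), where N=N and h="\<lambda>_ x. x\<^sup>2 - v" and s="\<lambda>_. 2 * v\<^sup>2", OF 1 2]
    by (simp add: sum_subtractf ip_def power2_eq_square mult_ac)
qed

lemma gauss_ip_concentration:
  assumes "v > 0" "t > 0"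
  shows "emeasure (gaussN N v)
     {x \<in> space (gaussN N v). \<bar>ip N a x\<bar> \<ge> t} \<le> ennreal (sqn N a * v / t\<^sup>2)"
proof -
  have 1: "has_bochner_integral (gauss v) (\<lambda>x. a i * x) 0" for i
    using has_bochner_integral_mult_right[OF gauss_mean[OF assms(1)], of "a i"] by simp
  have 2: "has_bochner_integral (gauss v) (\<lambda>x. (a i * x)\<^sup>2) ((a i)\<^sup>2 * v)" for i
    unfolding power_mult_distrib by (intro has_bochner_integral_mult_right gauss_variance assms)
  show ?thesis
    using emeasure_PiM_sum_ge[OF prob_space_gauss[OF assms(1)] assms(2), where N=N and h="\<lambda>i x. a i * x" and s="\<lambda>i. (a i)\<^sup>2 * v", OF 1 2]
    by (simp add: ip_def sum_distrib_left power2_eq_square mult_ac)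
qed

section \<open>Densities of Gaussian vectors and redrawing one coordinate\<close>

lemma PiM_density_prod:
  assumes M: "sigma_finite_measure M" and f[measurable]: "f \<in> borel_measurable M"
    and D: "sigma_finite_measure (density M f)" and fin: "finite I"
  shows "PiM I (\<lambda>_. density M f) = density (PiM I (\<lambda>_. M)) (\<lambda>x. \<Prod>i\<in>I. f (x i))"
proof -
  interpret M: product_sigma_finite "\<lambda>_. M" by (intro product_sigma_finite_const M)
  interpret D: product_sigma_finite "\<lambda>_. density M f" by (intro product_sigma_finite_const D)
  have [measurable]: "(\<lambda>x. \<Prod>i\<in>I. f (x i)) \<in> borel_measurable (PiM I (\<lambda>_. M))"
    by measurable
  show ?thesis
  proof (rule D.PiM_eqI[OF fin, symmetric])
    show "sets (density (PiM I (\<lambda>_. M)) (\<lambda>x. \<Prod>i\<in>I. f (x i))) = sets (PiM I (\<lambda>_. density M f))"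
      by (simp cong: sets_PiM_cong)
    fix A :: "'b \<Rightarrow> 'a set" assume A: "\<And>i. i \<in> I \<Longrightarrow> A i \<in> sets (density M f)"
    then have A': "\<And>i. i \<in> I \<Longrightarrow> A i \<in> sets M" by simp
    have "emeasure (density (PiM I (\<lambda>_. M)) (\<lambda>x. \<Prod>i\<in>I. f (x i))) (Pi\<^sub>E I A)
        = (\<integral>\<^sup>+ x. (\<Prod>i\<in>I. f (x i)) * indicator (Pi\<^sub>E I A) x \<partial>PiM I (\<lambda>_. M))"
      by (intro emeasure_density) (auto intro!: sets_PiM_I_finite fin A')
    also have "\<dots> = (\<integral>\<^sup>+ x. (\<Prod>i\<in>I. f (x i) * indicator (A i) (x i)) \<partial>PiM I (\<lambda>_. M))"
    proof (intro nn_integral_cong)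
      fix x assume "x \<in> space (PiM I (\<lambda>_. M))"
      then have x: "x \<in> extensional I" by (auto simp: space_PiM PiE_def)
      show "(\<Prod>i\<in>I. f (x i)) * indicator (Pi\<^sub>E I A) x = (\<Prod>i\<in>I. f (x i) * indicator (A i) (x i))"
      proof (cases "x \<in> Pi\<^sub>E I A")
        case True then show ?thesis by (auto intro!: prod.cong simp: indicator_def PiE_iff)
      next
        case False
        then obtain i where "i \<in> I" "x i \<notin> A i" using x by (auto simp: PiE_iff)
        then have "(\<Prod>i\<in>I. f (x i) * indicator (A i) (x i)) = 0"
          using fin by (auto intro!: prod_zero bexI[of _ i])
        then show ?thesis using False by simp
      qed
    qed
    also have "\<dots> = (\<Prod>i\<in>I. \<integral>\<^sup>+ x. f x * indicator (A i) x \<partial>M)"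
      by (intro M.product_nn_integral_prod fin) (use A' in auto)
    also have "\<dots> = (\<Prod>i\<in>I. emeasure (density M f) (A i))"
      by (intro prod.cong refl emeasure_density[symmetric]) (use A' in auto)
    finally show "emeasure (density (PiM I (\<lambda>_. M)) (\<lambda>x. \<Prod>i\<in>I. f (x i))) (Pi\<^sub>E I A) = (\<Prod>i\<in>I. emeasure (density M f) (A i))" .
  qed
qed

abbreviation leb :: "nat \<Rightarrow> (nat \<Rightarrow> real) measure" where
  "leb N \<equiv> PiM {..<N} (\<lambda>_. lborel)"

lemma PiM_gauss_density:
  assumes "v > 0"
  shows "gaussN N v = density (leb N) (\<lambda>x. \<Prod>i<N. ennreal (normal_density 0 (sqrt v) (x i)))"
  unfolding gauss_def
  by (intro PiM_density_prod sigma_finite_lborel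
     prob_space_imp_sigma_finite prob_space_gauss[OF assms, unfolded gauss_def]) auto

lemma normal_density_prod:
  assumes "v > 0"
  shows "(\<Prod>i<N. normal_density 0 (sqrt v) (x i)) = (2 * pi * v) powr (- real N / 2) * exp (- (sqn N x) / (2 * v))"
proof -
  have "(\<Prod>i<N. normal_density 0 (sqrt v) (x i)) = (\<Prod>i<N. (2 * pi * v) powr (- 1/2) * exp (- (x i)\<^sup>2 / (2 * v)))"
    using assms by (intro prod.cong refl) (simp add: normal_density_def powr_minus powr_half_sqrt inverse_eq_divide)
  also have "\<dots> = (2 * pi * v) powr (- real N / 2) * exp (\<Sum>i<N. - (x i)\<^sup>2 / (2 * v))"
    using assms by (simp add: prod.distrib exp_sum powr_realpow[symmetric] powr_powr powr_power del: powr_half_sqrt)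
  also have "(\<Sum>i<N. - (x i)\<^sup>2 / (2 * v)) = - (sqn N x) / (2 * v)"
    by (simp add: ip_def sum_negf sum_divide_distrib power2_eq_square)
  finally show ?thesis .
qed

text \<open>Stands in for conditioning on all coordinates but one. It is applied to a noise letter
  that the past does not involve, and to a code word that the transmission does not involve.\<close>

lemma nn_integral_PiM_resample:
  assumes M: "prob_space M" and I: "finite I" "i \<in> I" and f[measurable]: "f \<in> borel_measurable (PiM I (\<lambda>_. M))"
  shows "integral\<^sup>N (PiM I (\<lambda>_. M)) f = (\<integral>\<^sup>+ x. (\<integral>\<^sup>+ y. f (x(i := y)) \<partial>M) \<partial>PiM I (\<lambda>_. M))"
proof -
  interpret M: prob_space M by fact
  interpret product_sigma_finite "\<lambda>_. M"
    by (intro product_sigma_finite_const M.sigma_finite_measure_axioms)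
  let ?J = "I - {i}"
  have IJ: "I = insert i ?J" using I by auto
  have m: "(\<lambda>x. \<integral>\<^sup>+ y. f (x(i := y)) \<partial>M) \<in> borel_measurable (PiM I (\<lambda>_. M))"
  proof -
    have "(\<lambda>z. (fst z)(i := snd z)) \<in> measurable (PiM I (\<lambda>_. M) \<Otimes>\<^sub>M M) (PiM I (\<lambda>_. M))"
      by (rule measurable_fun_upd[of _ I]) (use I in auto)
    then show ?thesis by measurable
  qed
  have "(\<integral>\<^sup>+ x. (\<integral>\<^sup>+ y. f (x(i := y)) \<partial>M) \<partial>PiM I (\<lambda>_. M))
    = (\<integral>\<^sup>+ x. (\<integral>\<^sup>+ z. (\<integral>\<^sup>+ y. f ((x(i := z))(i := y)) \<partial>M) \<partial>M) \<partial>PiM ?J (\<lambda>_. M))"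
    using I m by (subst IJ, subst product_nn_integral_insert) (auto simp: insert_absorb)
  also have "\<dots> = (\<integral>\<^sup>+ x. (\<integral>\<^sup>+ y. f (x(i := y)) \<partial>M) \<partial>PiM ?J (\<lambda>_. M))"
    by (simp add: M.emeasure_space_1)
  also have "\<dots> = integral\<^sup>N (PiM I (\<lambda>_. M)) f"
    using I by (subst (2) IJ, subst product_nn_integral_insert) (auto simp: insert_absorb)
  finally show ?thesis ..
qed

section \<open>Undoing the feedback\<close>


text \<open>The recursion of \<open>yseq\<close> for a fixed message pair and state, with both
  inputs and the state fused into one drift \<open>m\<close>.\<close>

fun fseq :: "(nat \<Rightarrow> (nat \<Rightarrow> real) \<Rightarrow> real) \<Rightarrow> (nat \<Rightarrow> real) \<Rightarrow> nat \<Rightarrow> nat \<Rightarrow> real" where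
  "fseq m e 0 = (\<lambda>_. 0)"
| "fseq m e (Suc i) = (let y = fseq m e i in y(i := m i y + e i))"

text \<open>Reproduces the zero padding of \<open>yseq\<close>, so that the full output determines
  every earlier feedback argument.\<close>

definition trunc :: "nat \<Rightarrow> (nat \<Rightarrow> real) \<Rightarrow> nat \<Rightarrow> real" where
  "trunc n y = (\<lambda>j. if j < n then y j else 0)"

definition unfeed :: "nat \<Rightarrow> (nat \<Rightarrow> (nat \<Rightarrow> real) \<Rightarrow> real) \<Rightarrow> (nat \<Rightarrow> real) \<Rightarrow> nat \<Rightarrow> real" where
  "unfeed N m y = (\<lambda>i\<in>{..<N}. y i - m i (trunc i y))"

lemma yseq_eq_fseq:
  "yseq f1 f2 w1 w2 s e n = fseq (\<lambda>i y. f1 i w1 s y + f2 i w1 w2 s y + s i) e n"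
  by (induction n) simp_all

lemma fseq_beyond: "n \<le> j \<Longrightarrow> fseq m e n j = 0"
  by (induction n) (auto simp: Let_def)

lemma trunc_fseq: "n \<le> N \<Longrightarrow> trunc n (fseq m e N) = fseq m e n"
proof (induction N)
  case (Suc N)
  show ?case
  proof (cases "n = Suc N")
    case True
    then show ?thesis
      by (intro ext) (simp add: trunc_def fseq_beyond del: fseq.simps)
  next
    case False
    then have "trunc n (fseq m e (Suc N)) = trunc n (fseq m e N)"
      using Suc.prems by (auto simp: trunc_def Let_def)
    then show ?thesis using False Suc by simp
  qed
qed (auto simp: trunc_def)

lemma fseq_at: "i < N \<Longrightarrow> fseq m e N i = m i (fseq m e i) + e i"
proof -
  assume "i < N"
  then have "trunc (Suc i) (fseq m e N) i = fseq m e (Suc i) i"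
    by (subst trunc_fseq) auto
  then show ?thesis by (simp add: trunc_def Let_def)
qed

lemma fseq_cong: "(\<And>j. j < n \<Longrightarrow> e j = e' j) \<Longrightarrow> fseq m e n = fseq m e' n"
  by (induction n) (auto simp: Let_def)

lemma fseq_unfeed: "n \<le> N \<Longrightarrow> fseq m (unfeed N m y) n = trunc n y"
proof (induction n)
  case (Suc n)
  then have IH: "fseq m (unfeed N m y) n = trunc n y" by simp
  have "fseq m (unfeed N m y) (Suc n) = (trunc n y)(n := m n (trunc n y) + unfeed N m y n)"
    by (simp add: Let_def IH)
  also have "\<dots> = trunc (Suc n) y"
    using Suc.prems by (intro ext) (auto simp: unfeed_def trunc_def less_Suc_eq)
  finally show ?case .
qed (simp add: trunc_def)

lemma fseq_measurable:
  assumes "\<And>i. i < N \<Longrightarrow> (\<lambda>x. g x i) \<in> borel_measurable M"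
    and "\<And>i. i < N \<Longrightarrow> (\<lambda>x. m x i (fseq (m x) (g x) i)) \<in> borel_measurable M" and "n \<le> N"
  shows "(\<lambda>x. fseq (m x) (g x) n j) \<in> borel_measurable M"
  using \<open>n \<le> N\<close>
proof (induction n)
  case (Suc n)
  then have [measurable]: "(\<lambda>x. fseq (m x) (g x) n j) \<in> borel_measurable M"
    "(\<lambda>x. g x n) \<in> borel_measurable M" "(\<lambda>x. m x n (fseq (m x) (g x) n)) \<in> borel_measurable M"
    using assms by auto
  show ?case
    by (cases "j = n") (simp_all add: Let_def)
qed simp

text \<open>The encoders need not be measurable in the feedback argument; only their composition with
  the noise is.  Undoing the feedback one letter at a time recovers measurability in the outputs.\<close>
lemma measurable_of_feedback:
  fixes h :: "(nat \<Rightarrow> real) \<Rightarrow> real"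
  assumes H: "\<And>i. i < N \<Longrightarrow> (\<lambda>e. m i (fseq m e i)) \<in> borel_measurable (leb N)"
    and H': "(\<lambda>e. h (fseq m e i)) \<in> borel_measurable (leb N)" and "i \<le> N"
  shows "(\<lambda>y. h (trunc i y)) \<in> borel_measurable (leb N)"
  using H' \<open>i \<le> N\<close>
proof (induction i arbitrary: h rule: less_induct)
  case (less i)
  have [measurable]: "(\<lambda>y. m j (trunc j y)) \<in> borel_measurable (leb N)" if "j < i" for j
    using less.IH[of j "m j"] H[of j] that less.prems by simp
  \<comment> \<open>The noise recovered from the outputs, but only before time \<open>i\<close>: the
    induction hypothesis says nothing yet about later drifts, so later letters are set to zero. They
    do not influence \<open>fseq m e i\<close>.\<close>
  define E where "E y = (\<lambda>j\<in>{..<N}. if j < i then y j - m j (trunc j y) else 0)" for y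
  have E: "E \<in> measurable (leb N) (leb N)"
    unfolding E_def
  proof (intro measurable_restrict)
    fix j assume "j \<in> {..<N}"
    then show "(\<lambda>y. if j < i then y j - m j (trunc j y) else 0) \<in> leb N \<rightarrow>\<^sub>M lborel"
      by (cases "j < i") auto
  qed
  have "fseq m (E y) i = trunc i y" for y
  proof -
    have "fseq m (E y) i = fseq m (unfeed i m y) i"
      using less.prems by (intro fseq_cong) (auto simp: E_def unfeed_def)
    then show ?thesis by (simp add: fseq_unfeed)
  qed
  then show ?case
    using measurable_compose[OF E less.prems(1)] by simp
qed

lemma unfeed_measurable:
  assumes "\<And>i. i < N \<Longrightarrow> (\<lambda>y. m i (trunc i y)) \<in> borel_measurable (leb N)"
  shows "unfeed N m \<in> measurable (leb N) (leb N)"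
proof -
  have "(\<lambda>y. \<lambda>i\<in>{..<N}. y i - m i (trunc i y)) \<in> measurable (leb N) (leb N)"
    using assms by (intro measurable_restrict) auto
  then show ?thesis unfolding unfeed_def[abs_def] .
qed

interpretation lebP: product_sigma_finite "\<lambda>_::nat. lborel :: real measure"
  by (intro product_sigma_finite_const sigma_finite_lborel)

text \<open>The last output is shifted by an amount that depends on the earlier ones only, so
  translation invariance of \<open>lborel\<close> removes the shift in the inner integral, and
  induction treats the remaining coordinates.\<close>

lemma nn_integral_unfeed:
  assumes "\<And>i. i < N \<Longrightarrow> (\<lambda>y. m i (trunc i y)) \<in> borel_measurable (leb N)"
    and "f \<in> borel_measurable (leb N)"
  shows "(\<integral>\<^sup>+ y. f (unfeed N m y) \<partial>leb N) = integral\<^sup>N (leb N) f"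
  using assms
proof (induction N arbitrary: f)
  case 0
  then show ?case by (simp add: PiM_empty nn_integral_count_space_finite unfeed_def)
next
  case (Suc N)
  note [measurable] = Suc.prems(2)
  have m: "(\<lambda>y. m i (trunc i y)) \<in> borel_measurable (leb N)" if "i < Suc N" for i
  proof -
    have upd: "(\<lambda>y. y(N := 0)) \<in> measurable (leb N) (leb (Suc N))"
      by (rule measurable_fun_upd[of _ "{..<N}"]) auto
    have eq: "trunc i (y(N := 0)) = trunc i y" for y
      using that by (auto simp: trunc_def)
    show ?thesis
      using measurable_compose[OF upd Suc.prems(1)[OF that]] by (simp only: eq)
  qed
  have upd[measurable]: "(\<lambda>z. (fst z)(N := snd z)) \<in> measurable (leb N \<Otimes>\<^sub>M lborel) (leb (Suc N))"
    by (rule measurable_fun_upd[of _ "{..<N}"]) auto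
  have F[measurable]: "(\<lambda>x. \<integral>\<^sup>+ t. f (x(N := t)) \<partial>lborel) \<in> borel_measurable (leb N)"
    using lborel.borel_measurable_nn_integral_fst[OF measurable_compose[OF upd Suc.prems(2)]] by simp
  have fu: "(\<lambda>y. f (unfeed (Suc N) m y)) \<in> borel_measurable (leb (Suc N))"
    by (rule measurable_compose[OF unfeed_measurable Suc.prems(2)]) (use Suc.prems in auto)
  have "(\<integral>\<^sup>+ y. f (unfeed (Suc N) m y) \<partial>leb (Suc N))
     = (\<integral>\<^sup>+ y. (\<integral>\<^sup>+ t. f (unfeed (Suc N) m (y(N := t))) \<partial>lborel) \<partial>leb N)"
    unfolding lessThan_Suc
    by (subst lebP.product_nn_integral_insert) (use fu in \<open>auto simp: lessThan_Suc\<close>)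
  also have "\<dots> = (\<integral>\<^sup>+ y. (\<integral>\<^sup>+ t. f ((unfeed N m y)(N := t)) \<partial>lborel) \<partial>leb N)"
  proof (rule nn_integral_cong)
    fix y assume y: "y \<in> space (leb N)"
    \<comment> \<open>The factor \<open>1 *\<close> gives the shift the shape of the affine
      substitution rule.\<close>
    have eq: "unfeed (Suc N) m (y(N := t)) = (unfeed N m y)(N := - m N (trunc N y) + 1 * t)" for t
    proof
      fix i
      have "trunc i (y(N := t)) = trunc i y" if "i \<le> N" using that by (auto simp: trunc_def)
      then show "unfeed (Suc N) m (y(N := t)) i = ((unfeed N m y)(N := - m N (trunc N y) + 1 * t)) i"
        by (cases "i < N"; cases "i = N") (auto simp: unfeed_def)
    qed
    have "unfeed N m y \<in> space (leb N)"
      by (simp add: unfeed_def space_PiM)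
    then have "(\<lambda>t. f ((unfeed N m y)(N := t))) \<in> borel_measurable borel"
      using measurable_compose[OF measurable_Pair1' measurable_compose[OF upd Suc.prems(2)], of "unfeed N m y"]
      by (simp add: fun_upd_def)
    from nn_integral_real_affine[OF this, of 1 "- m N (trunc N y)"]
    show "(\<integral>\<^sup>+ t. f (unfeed (Suc N) m (y(N := t))) \<partial>lborel) = (\<integral>\<^sup>+ t. f ((unfeed N m y)(N := t)) \<partial>lborel)"
      by (simp add: eq)
  qed
  also have "\<dots> = (\<integral>\<^sup>+ y. (\<integral>\<^sup>+ t. f (y(N := t)) \<partial>lborel) \<partial>leb N)"
    by (intro Suc.IH F m) simp
  also have "\<dots> = integral\<^sup>N (leb (Suc N)) f"
    unfolding lessThan_Suc
    by (subst lebP.product_nn_integral_insert) (auto simp: lessThan_Suc[symmetric])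
  finally show ?case .
qed

lemma nn_integral_normal_density_prod:
  assumes "v > 0"
  shows "(\<integral>\<^sup>+ y. ennreal (\<Prod>i<N. normal_density 0 (sqrt v) (y i)) \<partial>leb N) = 1"
proof -
  interpret prob_space "gaussN N v" by (rule prob_space_PiM_gauss[OF assms])
  have "emeasure (gaussN N v) (space (leb N)) = 1"
    using emeasure_space_1 by (simp add: space_PiM)
  then show ?thesis
    unfolding PiM_gauss_density[OF assms]
    by (subst (asm) emeasure_density) (auto simp: prod_ennreal cong: nn_integral_cong_simp)
qed

text \<open>Under the reference channel (output means \<open>h\<close>, variance \<open>u\<close>) the output carries no
  information on \<open>w\<close>, so correct decoding has total mass at most one.\<close>
lemma reference_measure_bound:
  assumes u: "u > 0" and v: "v > 0" and W: "finite W"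
    and m: "\<And>w i. w \<in> W \<Longrightarrow> i < N \<Longrightarrow> (\<lambda>e. m w i (fseq (m w) e i)) \<in> borel_measurable (leb N)"
    and h: "\<And>i. i < N \<Longrightarrow> (\<lambda>y. h i (trunc i y)) \<in> borel_measurable (leb N)"
    and dec: "\<And>w. w \<in> W \<Longrightarrow> {e \<in> space (leb N). dec (fseq (m w) e N) = w} \<in> sets (leb N)"
  shows "(\<Sum>w\<in>W. \<integral>\<^sup>+ e. ennreal ((if dec (fseq (m w) e N) = w then real (card W) else 1) *
            (\<Prod>i<N. normal_density 0 (sqrt u) (fseq (m w) e N i - h i (fseq (m w) e i))) /
            (\<Prod>i<N. normal_density 0 (sqrt v) (e i))) \<partial>gaussN N v) \<le> ennreal (2 * card W)"
proof -
  \<comment> \<open>The weight of correct decoding: large enough to contribute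
    \<open>ln (card W)\<close> after taking logarithms, yet adding only \<open>card W\<close> to the
    sum over all messages.\<close>
  define C where "C w y = (if dec y = w then real (card W) else 1)" for w and y :: "nat \<Rightarrow> real"
  define q where "q y = (\<Prod>i<N. normal_density 0 (sqrt u) (y i - h i (trunc i y)))" for y
  have qf: "(\<Prod>i<N. normal_density 0 (sqrt u) (fseq (m w) e N i - h i (fseq (m w) e i))) = q (fseq (m w) e N)" for w e
    unfolding q_def by (intro prod.cong refl) (simp add: trunc_fseq)
  have qt: "q (trunc N y) = q y" for y
  proof -
    have "trunc i (trunc N y) = trunc i y" if "i < N" for i using that by (auto simp: trunc_def)
    then show ?thesis unfolding q_def by (intro prod.cong refl) (auto simp: trunc_def)
  qed
  have q0: "q y \<ge> 0" for y unfolding q_def by (intro prod_nonneg) auto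
  have C0: "C w y \<ge> 0" for w y by (simp add: C_def)
  have mm: "(\<lambda>y. m w i (trunc i y)) \<in> borel_measurable (leb N)" if "w \<in> W" "i < N" for w i
    using measurable_of_feedback[of N "m w" "m w i" i] m that by simp
  have qm[measurable]: "q \<in> borel_measurable (leb N)"
    unfolding q_def using h by (intro borel_measurable_prod) auto
  have fm: "(\<lambda>e. ennreal (C w (fseq (m w) e N) * q (fseq (m w) e N))) \<in> borel_measurable (leb N)" if w: "w \<in> W" for w
  proof -
    have 1: "(\<lambda>e. C w (fseq (m w) e N)) \<in> borel_measurable (leb N)"
      unfolding C_def using dec[OF w] by (intro measurable_If) auto
    have "(\<lambda>e. fseq (m w) e N i - h i (fseq (m w) e i)) \<in> borel_measurable (leb N)" if i: "i < N" for i
    proof -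
      have [measurable]: "(\<lambda>e. fseq (m w) e n j) \<in> borel_measurable (leb N)" if "n \<le> N" for n j
        using fseq_measurable[of N "\<lambda>e. e" "leb N" "\<lambda>_. m w"] m[OF w] that by simp
      have meas: "(\<lambda>e. \<lambda>j\<in>{..<N}. fseq (m w) e N j) \<in> measurable (leb N) (leb N)"
        by (intro measurable_restrict) auto
      have "trunc i (\<lambda>j\<in>{..<N}. fseq (m w) e N j) = fseq (m w) e i" for e
      proof -
        have "trunc i (\<lambda>j\<in>{..<N}. fseq (m w) e N j) = trunc i (fseq (m w) e N)"
          using i by (auto simp: trunc_def)
        then show ?thesis using i by (simp add: trunc_fseq)
      qed
      then have [measurable]: "(\<lambda>e. h i (fseq (m w) e i)) \<in> borel_measurable (leb N)"
        using measurable_compose[OF meas h[OF i]] by simp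
      show ?thesis by measurable
    qed
    then have 2: "(\<lambda>e. q (fseq (m w) e N)) \<in> borel_measurable (leb N)"
      unfolding qf[symmetric] by (intro borel_measurable_prod measurable_compose[OF _ borel_measurable_normal_density]) auto
    show ?thesis using 1 2 by measurable
  qed
  have p_pos: "(\<Prod>i<N. normal_density 0 (sqrt v) (e i)) > 0" for e :: "nat \<Rightarrow> real"
    using v by (intro prod_pos) (auto intro!: normal_density_pos)
  \<comment> \<open>The noise density cancels the denominator, and undoing the feedback changes
    variables from noise to output. The message survives only in the decoding weight.\<close>
  have step: "(\<integral>\<^sup>+ e. ennreal (C w (fseq (m w) e N) * q (fseq (m w) e N) / (\<Prod>i<N. normal_density 0 (sqrt v) (e i))) \<partial>gaussN N v)
     = (\<integral>\<^sup>+ y. ennreal (C w (trunc N y) * q y) \<partial>leb N)" if w: "w \<in> W" for w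
  proof -
    note [measurable] = fm[OF w]
    have "(\<integral>\<^sup>+ e. ennreal (C w (fseq (m w) e N) * q (fseq (m w) e N) / (\<Prod>i<N. normal_density 0 (sqrt v) (e i))) \<partial>gaussN N v)
      = (\<integral>\<^sup>+ e. ennreal (\<Prod>i<N. normal_density 0 (sqrt v) (e i)) * ennreal (C w (fseq (m w) e N) * q (fseq (m w) e N) / (\<Prod>i<N. normal_density 0 (sqrt v) (e i))) \<partial>leb N)"
    proof -
      have "(\<lambda>e. ennreal (C w (fseq (m w) e N) * q (fseq (m w) e N)) / ennreal (\<Prod>i<N. normal_density 0 (sqrt v) (e i)))
         \<in> borel_measurable (leb N)"
        by measurable
      then have "(\<lambda>e. ennreal (C w (fseq (m w) e N) * q (fseq (m w) e N) / (\<Prod>i<N. normal_density 0 (sqrt v) (e i)))) \<in> borel_measurable (leb N)"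
        using p_pos C0 q0 by (simp add: divide_ennreal[symmetric])
      then show ?thesis
        unfolding PiM_gauss_density[OF v]
        by (subst nn_integral_density) (auto simp: prod_ennreal)
    qed
    also have "\<dots> = (\<integral>\<^sup>+ e. ennreal (C w (fseq (m w) e N) * q (fseq (m w) e N)) \<partial>leb N)"
      using p_pos by (intro nn_integral_cong) (simp add: ennreal_mult'[symmetric] less_imp_le less_imp_neq[THEN not_sym])
    also have "\<dots> = (\<integral>\<^sup>+ y. ennreal (C w (fseq (m w) (unfeed N (m w) y) N) * q (fseq (m w) (unfeed N (m w) y) N)) \<partial>leb N)"
      by (rule nn_integral_unfeed[symmetric]) (use mm w in auto)
    also have "\<dots> = (\<integral>\<^sup>+ y. ennreal (C w (trunc N y) * q y) \<partial>leb N)"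
      by (simp add: fseq_unfeed qt)
    finally show ?thesis .
  qed
  have cm: "(\<lambda>y. ennreal (C w (trunc N y) * q y)) \<in> borel_measurable (leb N)" if w: "w \<in> W" for w
    using measurable_compose[OF unfeed_measurable[of N "m w"] fm[OF w]] mm[OF w] by (simp add: fseq_unfeed qt)
  have "(\<Sum>w\<in>W. \<integral>\<^sup>+ e. ennreal ((if dec (fseq (m w) e N) = w then real (card W) else 1) *
            (\<Prod>i<N. normal_density 0 (sqrt u) (fseq (m w) e N i - h i (fseq (m w) e i))) /
            (\<Prod>i<N. normal_density 0 (sqrt v) (e i))) \<partial>gaussN N v)
     = (\<Sum>w\<in>W. \<integral>\<^sup>+ y. ennreal (C w (trunc N y) * q y) \<partial>leb N)"
    unfolding qf C_def[symmetric] by (intro sum.cong refl step)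
  also have "\<dots> = (\<integral>\<^sup>+ y. (\<Sum>w\<in>W. ennreal (C w (trunc N y) * q y)) \<partial>leb N)"
    by (rule nn_integral_sum[symmetric]) (rule cm)
  also have "\<dots> \<le> (\<integral>\<^sup>+ y. ennreal (2 * card W) * ennreal (q y) \<partial>leb N)"
  proof (intro nn_integral_mono)
    fix y
    \<comment> \<open>An output is decoded to at most one message of \<open>W\<close>, so the large
      weight occurs at most once, next to \<open>card W\<close> weights of size one.\<close>
    have "(\<Sum>w\<in>W. C w (trunc N y)) \<le> (\<Sum>w\<in>W. 1 + (if dec (trunc N y) = w then real (card W) else 0))"
      by (intro sum_mono) (auto simp: C_def)
    also have "\<dots> \<le> 2 * card W"
      using W by (simp add: sum.distrib)
    finally have "(\<Sum>w\<in>W. C w (trunc N y) * q y) \<le> 2 * card W * q y"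
      by (simp add: sum_distrib_right[symmetric] mult_right_mono q0)
    then show "(\<Sum>w\<in>W. ennreal (C w (trunc N y) * q y)) \<le> ennreal (2 * card W) * ennreal (q y)"
      using C0 q0 by (simp add: sum_ennreal ennreal_mult[symmetric])
  qed
  also have "\<dots> = ennreal (2 * card W) * (\<integral>\<^sup>+ y. ennreal (q y) \<partial>leb N)"
    by (intro nn_integral_cmult) measurable
  \<comment> \<open>The reference law is itself that of a feedback channel, with drift
    \<open>h\<close>; undoing that feedback leaves a product density of mass one.\<close>
  also have "(\<integral>\<^sup>+ y. ennreal (q y) \<partial>leb N) = (\<integral>\<^sup>+ y. ennreal (\<Prod>i<N. normal_density 0 (sqrt u) (unfeed N h y i)) \<partial>leb N)"
    by (intro nn_integral_cong) (simp add: q_def unfeed_def)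
  also have "\<dots> = 1"
    by (subst nn_integral_unfeed[where f="\<lambda>y. ennreal (\<Prod>i<N. normal_density 0 (sqrt u) (y i))"])
      (auto simp: h nn_integral_normal_density_prod[OF u])
  finally show ?thesis by simp
qed

section \<open>Comparison with a reference channel\<close>


definition tx1 :: "enc1 \<Rightarrow> enc2 \<Rightarrow> nat \<Rightarrow> nat \<times> nat \<Rightarrow> (nat \<Rightarrow> real) \<times> (nat \<Rightarrow> real) \<Rightarrow> real" where
  "tx1 f1 f2 i w \<omega> = f1 i (fst w) (fst \<omega>) (yseq f1 f2 (fst w) (snd w) (fst \<omega>) (snd \<omega>) i)"

definition tx2 :: "enc1 \<Rightarrow> enc2 \<Rightarrow> nat \<Rightarrow> nat \<times> nat \<Rightarrow> (nat \<Rightarrow> real) \<times> (nat \<Rightarrow> real) \<Rightarrow> real" where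
  "tx2 f1 f2 i w \<omega> = f2 i (fst w) (snd w) (fst \<omega>) (yseq f1 f2 (fst w) (snd w) (fst \<omega>) (snd \<omega>) i)"

definition correct :: "real \<Rightarrow> real \<Rightarrow> nat \<Rightarrow> enc1 \<Rightarrow> enc2 \<Rightarrow> ((nat \<Rightarrow> real) \<Rightarrow> nat \<times> nat) \<Rightarrow> nat \<times> nat
    \<Rightarrow> ((nat \<Rightarrow> real) \<times> (nat \<Rightarrow> real)) set" where
  "correct Q v N f1 f2 dec w =
    {\<omega> \<in> space (omega Q v N). dec (yseq f1 f2 (fst w) (snd w) (fst \<omega>) (snd \<omega>) N) = w}"

lemma prob_space_omega: "Q > 0 \<Longrightarrow> v > 0 \<Longrightarrow> prob_space (omega Q v N)"
  unfolding omega_def by (intro prob_space_pair prob_space_PiM_gauss)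

lemma yseq_upd: "n \<le> i \<Longrightarrow> yseq f1 f2 w1 w2 s (e(i := t)) n = yseq f1 f2 w1 w2 s e n"
  unfolding yseq_eq_fseq by (rule fseq_cong) simp

lemma sets_PiM_gauss: "sets (PiM I (\<lambda>_. gauss v)) = sets (PiM I (\<lambda>_. lborel))"
  by (intro sets_PiM_cong) auto

lemma measurable_PiM_gauss: "measurable (PiM I (\<lambda>_. gauss v)) M = measurable (PiM I (\<lambda>_. lborel)) M"
  by (intro measurable_cong_sets sets_PiM_gauss refl)

lemma noise_measurable[measurable]:
  "i < N \<Longrightarrow> (\<lambda>\<omega>. snd \<omega> i) \<in> borel_measurable (omega Q v N)"
  "i < N \<Longrightarrow> (\<lambda>\<omega>. fst \<omega> i) \<in> borel_measurable (omega Q v N)"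
  unfolding omega_def by auto

lemma nn_integral_omega:
  assumes "Q > 0" "v > 0" "f \<in> borel_measurable (omega Q v N)"
  shows "integral\<^sup>N (omega Q v N) f
    = (\<integral>\<^sup>+ s. (\<integral>\<^sup>+ e. f (s, e) \<partial>gaussN N v) \<partial>gaussN N Q)"
proof -
  interpret prob_space "gaussN N v" using assms by (intro prob_space_PiM_gauss)
  show ?thesis using assms(3) unfolding omega_def by (intro nn_integral_fst[symmetric])
qed

text \<open>\<open>d\<close> depends on the past noise only, hence is independent of the current noise letter.\<close>
lemma nn_integral_omega_noise_square:
  assumes Q: "Q > 0" and v: "v > 0" and i: "i < N" and d: "d \<in> borel_measurable (omega Q v N)"
    and past: "\<And>s e t. d (s, e(i := t)) = d (s, e)"
  shows "(\<integral>\<^sup>+ \<omega>. ennreal ((snd \<omega> i + d \<omega>)\<^sup>2) \<partial>omega Q v N) = (\<integral>\<^sup>+ \<omega>. ennreal ((d \<omega>)\<^sup>2) \<partial>omega Q v N) + ennreal v"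
proof -
  note [measurable] = d
  let ?S = "gaussN N Q" and ?E = "gaussN N v"
  interpret S: prob_space ?S by (rule prob_space_PiM_gauss[OF Q])
  interpret E: prob_space ?E by (rule prob_space_PiM_gauss[OF v])
  interpret prob_space "omega Q v N" by (rule prob_space_omega[OF Q v])
  have ds[measurable]: "(\<lambda>e. d (s, e)) \<in> borel_measurable ?E" if "s \<in> space ?S" for s
    using measurable_compose[OF measurable_Pair1'[OF that] d[unfolded omega_def]] .
  have "(\<integral>\<^sup>+ \<omega>. ennreal ((snd \<omega> i + d \<omega>)\<^sup>2) \<partial>omega Q v N)
     = (\<integral>\<^sup>+ s. (\<integral>\<^sup>+ e. ennreal ((e i + d (s, e))\<^sup>2) \<partial>?E) \<partial>?S)"
    using i by (subst nn_integral_omega[OF Q v]) auto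
  also have "\<dots> = (\<integral>\<^sup>+ s. (\<integral>\<^sup>+ e. ennreal ((d (s, e))\<^sup>2 + v) \<partial>?E) \<partial>?S)"
  proof (rule nn_integral_cong)
    fix s assume s: "s \<in> space ?S"
    have "(\<integral>\<^sup>+ e. ennreal ((e i + d (s, e))\<^sup>2) \<partial>?E) = (\<integral>\<^sup>+ e. (\<integral>\<^sup>+ t. ennreal ((d (s, e) + t)\<^sup>2) \<partial>gauss v) \<partial>?E)"
      using i ds[OF s] by (subst nn_integral_PiM_resample[OF prob_space_gauss[OF v], of _ i]) (auto simp: past add.commute)
    then show "(\<integral>\<^sup>+ e. ennreal ((e i + d (s, e))\<^sup>2) \<partial>?E) = (\<integral>\<^sup>+ e. ennreal ((d (s, e))\<^sup>2 + v) \<partial>?E)"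
      by (simp add: nn_integral_shifted_square[OF prob_space_gauss[OF v] gauss_mean[OF v] gauss_variance[OF v]])
  qed
  also have "\<dots> = (\<integral>\<^sup>+ \<omega>. ennreal ((d \<omega>)\<^sup>2 + v) \<partial>omega Q v N)"
    by (subst nn_integral_omega[OF Q v]) auto
  also have "\<dots> = (\<integral>\<^sup>+ \<omega>. ennreal ((d \<omega>)\<^sup>2) \<partial>omega Q v N) + ennreal v"
    using v by (simp add: ennreal_plus nn_integral_add emeasure_space_1)
  finally show ?thesis .
qed

lemma has_bochner_integral_noise_square:
  assumes "Q > 0" "v > 0" "i < N" "d \<in> borel_measurable (omega Q v N)"
    "\<And>s e t. d (s, e(i := t)) = d (s, e)" "has_bochner_integral (omega Q v N) (\<lambda>\<omega>. (d \<omega>)\<^sup>2) D"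
  shows "has_bochner_integral (omega Q v N) (\<lambda>\<omega>. (snd \<omega> i + d \<omega>)\<^sup>2) (D + v)"
proof -
  have D: "(\<integral>\<^sup>+ \<omega>. ennreal ((d \<omega>)\<^sup>2) \<partial>omega Q v N) = ennreal D" "D \<ge> 0"
    using assms(6) by (auto simp: has_bochner_integral_iff nn_integral_eq_integral)
  show ?thesis
    using nn_integral_omega_noise_square[OF assms(1-5)] assms D
    by (intro has_bochner_integral_nn_integral) (auto simp: ennreal_plus)
qed

text \<open>The tangent of \<open>ln\<close> at 2. The weight on correct decoding lets the
  likelihood ratio average to 2 rather than 1, and at that average the term \<open>t / 2 - 1\<close>
  vanishes.\<close>

lemma ln_le_half: "t > 0 \<Longrightarrow> ln t \<le> t / 2 - 1 + ln (2::real)"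
  using ln_le_minus_one[of "t / 2"] by (simp add: ln_div)

text \<open>The reference channel guesses \<open>X\<^sub>2\<close> by a multiple of \<open>X\<^sub>1\<close>; for jointly Gaussian inputs this
  linear guess is the conditional expectation, so nothing is lost.\<close>
lemma class_bound:
  assumes Q: "Q > 0" and v: "v > 0" and B: "B \<ge> 0" and W: "finite W" "W \<noteq> {}"
    and x1: "\<And>w i. w \<in> W \<Longrightarrow> i < N \<Longrightarrow> tx1 f1 f2 i w \<in> borel_measurable (omega Q v N)"
    and x2: "\<And>w i. w \<in> W \<Longrightarrow> i < N \<Longrightarrow> tx2 f1 f2 i w \<in> borel_measurable (omega Q v N)"
    and dec: "\<And>w. w \<in> W \<Longrightarrow> correct Q v N f1 f2 dec w \<in> sets (omega Q v N)"
    and c: "c = 0 \<or> (\<forall>w\<in>W. fst w = w10)"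
    and D: "\<And>w i. w \<in> W \<Longrightarrow> i < N \<Longrightarrow>
       has_bochner_integral (omega Q v N) (\<lambda>\<omega>. ((1 - c) * tx1 f1 f2 i w \<omega> + tx2 f1 f2 i w \<omega>)\<^sup>2) (D w i)"
  shows "(\<Sum>w\<in>W. measure (omega Q v N) (correct Q v N f1 f2 dec w) * ln (card W)
      + N / 2 * ln (v / (v + B)) + N / 2 - (N * v + (\<Sum>i<N. D w i)) / (2 * (v + B))) \<le> card W * ln 2"
proof -
  define u where "u = v + B"
  have u: "u > 0" using v B by (simp add: u_def)
  let ?\<Omega> = "omega Q v N"
  let ?S = "gaussN N Q" and ?E = "gaussN N v"
  interpret prob_space ?\<Omega> by (rule prob_space_omega[OF Q v])
  define d where "d w i \<omega> = (1 - c) * tx1 f1 f2 i w \<omega> + tx2 f1 f2 i w \<omega>" for w i \<omega>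
  define K where "K w = correct Q v N f1 f2 dec w" for w
  note [measurable] = x1 x2
  have Km[measurable]: "K w \<in> sets ?\<Omega>" if "w \<in> W" for w using dec[OF that] by (simp add: K_def)
  have dm[measurable]: "d w i \<in> borel_measurable ?\<Omega>" if "w \<in> W" "i < N" for w i
    unfolding d_def[abs_def] using that by measurable
  define M where "M = real (card W)"
  have M1: "M \<ge> 1" using W by (simp add: M_def card_gt_0_iff Suc_leI)
  \<comment> \<open>The numerator is the reference density of the output, written in terms of the
    noise: output minus predicted mean is noise plus the prediction error \<open>d\<close>.\<close>
  define t where "t w \<omega> = (if \<omega> \<in> K w then M else 1) *
      (\<Prod>i<N. normal_density 0 (sqrt u) (snd \<omega> i + d w i \<omega>)) / (\<Prod>i<N. normal_density 0 (sqrt v) (snd \<omega> i))" for w \<omega>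
  have t_meas[measurable]: "t w \<in> borel_measurable ?\<Omega>" if "w \<in> W" for w
  proof -
    have "(\<lambda>\<omega>. \<Prod>i<N. normal_density 0 (sqrt u) (snd \<omega> i + d w i \<omega>)) \<in> borel_measurable ?\<Omega>"
      "(\<lambda>\<omega>. \<Prod>i<N. normal_density 0 (sqrt v) (snd \<omega> i)) \<in> borel_measurable ?\<Omega>"
      "(\<lambda>\<omega>. if \<omega> \<in> K w then M else 1) \<in> borel_measurable ?\<Omega>"
      using that by (auto intro!: borel_measurable_prod measurable_compose[OF _ borel_measurable_normal_density] measurable_If_set)
    then show ?thesis unfolding t_def[abs_def] by measurable
  qed
  have t_pos: "t w \<omega> > 0" for w \<omega>
    unfolding t_def using u v M1 by (intro divide_pos_pos mult_pos_pos prod_pos) (auto intro!: normal_density_pos)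

  have "(\<Sum>w\<in>W. \<integral>\<^sup>+ \<omega>. ennreal (t w \<omega>) \<partial>?\<Omega>) = (\<Sum>w\<in>W. \<integral>\<^sup>+ s. \<integral>\<^sup>+ e. ennreal (t w (s, e)) \<partial>?E \<partial>?S)"
    by (intro sum.cong refl nn_integral_omega[OF Q v]) auto
  also have "\<dots> = (\<integral>\<^sup>+ s. (\<Sum>w\<in>W. \<integral>\<^sup>+ e. ennreal (t w (s, e)) \<partial>?E) \<partial>?S)"
  proof (rule nn_integral_sum[symmetric])
    interpret E: prob_space ?E by (rule prob_space_PiM_gauss[OF v])
    fix w assume "w \<in> W"
    then have "t w \<in> borel_measurable (?S \<Otimes>\<^sub>M ?E)" using t_meas by (simp add: omega_def)
    then show "(\<lambda>s. \<integral>\<^sup>+ e. ennreal (t w (s, e)) \<partial>?E) \<in> borel_measurable ?S" by measurable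
  qed
  also have "\<dots> \<le> (\<integral>\<^sup>+ s. ennreal (2 * card W) \<partial>?S)"
  proof (rule nn_integral_mono)
    fix s assume s: "s \<in> space ?S"
    define m where "m w i y = f1 i (fst w) s y + f2 i (fst w) (snd w) s y + s i" for w i y
    \<comment> \<open>If \<open>c\<close> is not zero, all messages of the class share the first
      component \<open>w10\<close>, so the reference channel can run encoder 1 on the past outputs
      itself.\<close>
    define h where "h i y = s i + c * f1 i w10 s y" for i y
    have ys: "yseq f1 f2 (fst w) (snd w) s e n = fseq (m w) e n" for w e n
      unfolding yseq_eq_fseq m_def[abs_def] ..
    have sec: "(\<lambda>e. X (s, e)) \<in> borel_measurable (leb N)" if "X \<in> borel_measurable ?\<Omega>" for X :: "_ \<Rightarrow> real"
      using measurable_compose[OF measurable_Pair1'[OF s] that[unfolded omega_def]] by (simp add: measurable_PiM_gauss)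
    have mm: "(\<lambda>e. m w i (fseq (m w) e i)) \<in> borel_measurable (leb N)" if "w \<in> W" "i < N" for w i
      using sec[OF x1[OF that]] sec[OF x2[OF that]]
      by (simp add: tx1_def tx2_def m_def[of _ i] ys)
    have hm: "(\<lambda>y. h i (trunc i y)) \<in> borel_measurable (leb N)" if i: "i < N" for i
    \<comment> \<open>Measurability of encoder 1 in the outputs is obtained from an arbitrary
      message of \<open>W\<close>, since each of them has first component
      \<open>w10\<close>.\<close>
    proof (cases "c = 0")
      case False
      from W obtain w where w: "w \<in> W" by auto
      with False c have w10: "fst w = w10" by auto
      have "(\<lambda>y. f1 i w10 s (trunc i y)) \<in> borel_measurable (leb N)"
        by (rule measurable_of_feedback[of N "m w"]) (use mm[OF w] sec[OF x1[OF w i]] i in \<open>auto simp: tx1_def w10[symmetric] ys\<close>)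
      then show ?thesis by (simp add: h_def)
    qed (simp add: h_def)
    have dec': "{e \<in> space (leb N). dec (fseq (m w) e N) = w} \<in> sets (leb N)" if w: "w \<in> W" for w
    proof -
      have "Pair s -` correct Q v N f1 f2 dec w \<inter> space ?E \<in> sets ?E"
        using measurable_sets[OF measurable_Pair1'[OF s] dec[OF w, unfolded omega_def]] by simp
      also have "Pair s -` correct Q v N f1 f2 dec w \<inter> space ?E = {e \<in> space (leb N). dec (fseq (m w) e N) = w}"
        using s by (auto simp: correct_def omega_def ys space_PiM space_pair_measure)
      finally show ?thesis by (simp add: sets_PiM_gauss)
    qed
    have "(\<Sum>w\<in>W. \<integral>\<^sup>+ e. ennreal (t w (s, e)) \<partial>?E)
      = (\<Sum>w\<in>W. \<integral>\<^sup>+ e. ennreal ((if dec (fseq (m w) e N) = w then real (card W) else 1) *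
            (\<Prod>i<N. normal_density 0 (sqrt u) (fseq (m w) e N i - h i (fseq (m w) e i))) /
            (\<Prod>i<N. normal_density 0 (sqrt v) (e i))) \<partial>?E)"
    proof (intro sum.cong refl nn_integral_cong)
      fix w e assume w: "w \<in> W" and e: "e \<in> space ?E"
      \<comment> \<open>The state occurs in the output and in the predicted mean, so it cancels:
        knowing it cannot raise the bound.\<close>
      have 1: "fseq (m w) e N i - h i (fseq (m w) e i) = e i + d w i (s, e)" if "i < N" for i
        using c w that by (subst fseq_at) (auto simp: m_def[of _ i] h_def d_def tx1_def tx2_def ys algebra_simps)
      have 2: "(s, e) \<in> K w \<longleftrightarrow> dec (fseq (m w) e N) = w"
        using s e by (auto simp: K_def correct_def omega_def space_pair_measure ys)
      show "ennreal (t w (s, e)) = ennreal ((if dec (fseq (m w) e N) = w then real (card W) else 1) *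
            (\<Prod>i<N. normal_density 0 (sqrt u) (fseq (m w) e N i - h i (fseq (m w) e i))) /
            (\<Prod>i<N. normal_density 0 (sqrt v) (e i)))"
        by (simp add: t_def 1 2 M_def)
    qed
    also have "\<dots> \<le> ennreal (2 * card W)"
      by (rule reference_measure_bound[OF u v W(1) mm hm dec'])
    finally show "(\<Sum>w\<in>W. \<integral>\<^sup>+ e. ennreal (t w (s, e)) \<partial>?E) \<le> ennreal (2 * card W)" .
  qed
  also have "\<dots> = ennreal (2 * M)"
    using prob_space.emeasure_space_1[OF prob_space_PiM_gauss[OF Q, of "{..<N}"]] by (simp add: M_def)
  finally have tsum: "(\<Sum>w\<in>W. \<integral>\<^sup>+ \<omega>. ennreal (t w \<omega>) \<partial>?\<Omega>) \<le> ennreal (2 * M)" .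
  have ti: "integrable ?\<Omega> (t w)" if w: "w \<in> W" for w
  proof -
    have "(\<integral>\<^sup>+ \<omega>. ennreal (t w \<omega>) \<partial>?\<Omega>) \<le> (\<Sum>w\<in>W. \<integral>\<^sup>+ \<omega>. ennreal (t w \<omega>) \<partial>?\<Omega>)"
      by (rule member_le_sum[OF w]) (use W in auto)
    also have "\<dots> < \<infinity>" using tsum by (rule le_less_trans) simp
    finally show ?thesis
      using w by (intro integrableI_nonneg) (auto simp: less_imp_le[OF t_pos])
  qed
  have tsum': "(\<Sum>w\<in>W. \<integral>\<omega>. t w \<omega> \<partial>?\<Omega>) \<le> 2 * M"
  proof -
    have "(\<Sum>w\<in>W. \<integral>\<^sup>+ \<omega>. ennreal (t w \<omega>) \<partial>?\<Omega>) = (\<Sum>w\<in>W. ennreal (\<integral>\<omega>. t w \<omega> \<partial>?\<Omega>))"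
      by (intro sum.cong refl nn_integral_eq_integral ti) (auto simp: less_imp_le[OF t_pos])
    also have "\<dots> = ennreal (\<Sum>w\<in>W. \<integral>\<omega>. t w \<omega> \<partial>?\<Omega>)"
      by (intro sum_ennreal Bochner_Integration.integral_nonneg less_imp_le[OF t_pos])
    finally have "(\<Sum>w\<in>W. \<integral>\<^sup>+ \<omega>. ennreal (t w \<omega>) \<partial>?\<Omega>) = ennreal (\<Sum>w\<in>W. \<integral>\<omega>. t w \<omega> \<partial>?\<Omega>)" .
    then show ?thesis using tsum M1 by (simp add: ennreal_le_iff)
  qed
  \<comment> \<open>Only an indicator and squares remain random in the logarithm, so its mean
    follows from the success probability and second moments.\<close>
  define L where "L w \<omega> = ln M * indicator (K w) \<omega> + N / 2 * ln (v / u)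
      + (\<Sum>i<N. (snd \<omega> i)\<^sup>2) / (2 * v) - (\<Sum>i<N. (snd \<omega> i + d w i \<omega>)\<^sup>2) / (2 * u)" for w \<omega>
  have ln_t: "ln (t w \<omega>) = L w \<omega>" for w \<omega>
  proof -
    have p: "ln (\<Prod>i<N. normal_density 0 (sqrt x) (g i)) = - N / 2 * ln (2 * pi * x) - (\<Sum>i<N. (g i)\<^sup>2) / (2 * x)"
      "(\<Prod>i<N. normal_density 0 (sqrt x) (g i)) > 0" if "x > 0" for g x
      using that by (auto simp: normal_density_prod ln_mult ln_powr ip_def power2_eq_square intro!: prod_pos normal_density_pos)
    have "ln (t w \<omega>) = ln (if \<omega> \<in> K w then M else 1) + ln (\<Prod>i<N. normal_density 0 (sqrt u) (snd \<omega> i + d w i \<omega>))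
         - ln (\<Prod>i<N. normal_density 0 (sqrt v) (snd \<omega> i))"
    proof -
      have lnq: "ln (c * x / y) = ln c + ln x - ln y" if "c > 0" "x > 0" "y > 0" for c x y :: real
        using that by (simp add: ln_mult ln_div)
      show ?thesis
        unfolding t_def using M1 by (intro lnq p(2)[OF u] p(2)[OF v]) auto
    qed
    also have "\<dots> = L w \<omega>"
      unfolding p(1)[OF u] p(1)[OF v] L_def using u v
      by (simp add: ln_mult ln_div field_simps)
    finally show ?thesis .
  qed
  have hD: "has_bochner_integral ?\<Omega> (\<lambda>\<omega>. (snd \<omega> i + d w i \<omega>)\<^sup>2) (D w i + v)" if w: "w \<in> W" and i: "i < N" for w i
  proof (rule has_bochner_integral_noise_square[OF Q v i dm[OF w i]])
    show "d w i (s, e(i := t)) = d w i (s, e)" for s e t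
      by (simp add: d_def tx1_def tx2_def yseq_upd)
    show "has_bochner_integral ?\<Omega> (\<lambda>\<omega>. (d w i \<omega>)\<^sup>2) (D w i)"
      using D[OF w i] by (simp add: d_def)
  qed
  have h0: "has_bochner_integral ?\<Omega> (\<lambda>\<omega>. (snd \<omega> i)\<^sup>2) v" if i: "i < N" for i
    using has_bochner_integral_noise_square[OF Q v i, of "\<lambda>_. 0" 0] by (simp add: has_bochner_integral_zero)
  have hL: "has_bochner_integral ?\<Omega> (L w) (ln M * prob (K w) + N / 2 * ln (v / u)
      + (\<Sum>i<N. v) / (2 * v) - (\<Sum>i<N. D w i + v) / (2 * u))" if w: "w \<in> W" for w
  proof -
    have "has_bochner_integral ?\<Omega> (\<lambda>\<omega>. ln M * indicator (K w) \<omega>) (ln M * prob (K w))"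
      using Km[OF w] by (intro has_bochner_integral_mult_right has_bochner_integral_real_indicator) (auto simp: emeasure_eq_measure)
    moreover have "has_bochner_integral ?\<Omega> (\<lambda>\<omega>. N / 2 * ln (v / u)) (N / 2 * ln (v / u))"
      by (simp add: has_bochner_integral_iff prob_space)
    ultimately show ?thesis
      unfolding L_def[abs_def]
      by (intro has_bochner_integral_diff has_bochner_integral_add has_bochner_integral_divide has_bochner_integral_sum)
        (auto simp: h0 hD[OF w] intro: has_bochner_integral_divide_zero)
  qed
  have "(\<Sum>w\<in>W. ln M * prob (K w) + N / 2 * ln (v / u) + (\<Sum>i<N. v) / (2 * v) - (\<Sum>i<N. D w i + v) / (2 * u))
      \<le> (\<Sum>w\<in>W. (\<integral>\<omega>. t w \<omega> \<partial>?\<Omega>) / 2 - 1 + ln 2)"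
  proof (rule sum_mono)
    fix w assume w: "w \<in> W"
    have "(\<integral>\<omega>. L w \<omega> \<partial>?\<Omega>) \<le> (\<integral>\<omega>. t w \<omega> / 2 - 1 + ln 2 \<partial>?\<Omega>)"
      using hL[OF w] ti[OF w] ln_le_half[OF t_pos]
      by (intro integral_mono) (auto simp: has_bochner_integral_iff ln_t)
    also have "\<dots> = (\<integral>\<omega>. t w \<omega> \<partial>?\<Omega>) / 2 - 1 + ln 2"
      using ti[OF w] by (simp add: prob_space)
    finally show "ln M * prob (K w) + N / 2 * ln (v / u) + (\<Sum>i<N. v) / (2 * v) - (\<Sum>i<N. D w i + v) / (2 * u)
        \<le> (\<integral>\<omega>. t w \<omega> \<partial>?\<Omega>) / 2 - 1 + ln 2"
      using hL[OF w] by (simp add: has_bochner_integral_iff)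
  qed
  also have "\<dots> = (\<Sum>w\<in>W. \<integral>\<omega>. t w \<omega> \<partial>?\<Omega>) / 2 - M + M * ln 2"
    by (simp add: sum.distrib sum_subtractf sum_divide_distrib M_def)
  also have "\<dots> \<le> M * ln 2" using tsum' by simp
  finally show ?thesis
    using v by (simp add: M_def K_def u_def sum.distrib mult.commute add.commute)
qed

section \<open>Converse\<close>


text \<open>The quadratic form will be the second moment of \<open>\<gamma> * X1 + X2\<close>,
  summed over messages and times, and its discriminant cannot be positive.\<close>

lemma cauchy_schwarz_quadratic:
  fixes a b r :: real
  assumes nonneg: "\<And>\<gamma>. 0 \<le> \<gamma>\<^sup>2 * a + 2 * \<gamma> * r + b" and "a \<ge> 0"
  shows "r\<^sup>2 \<le> a * b"
proof (cases "a = 0")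
  case True
  have "r = 0"
  proof (rule ccontr)
    assume "r \<noteq> 0"
    \<comment> \<open>Without a quadratic term the form is affine in \<open>\<gamma>\<close>, and
      here it takes the value -1.\<close>
    then show False using nonneg[of "- (b + 1) / (2 * r)"] True by (simp add: field_simps)
  qed
  then show ?thesis using True by simp
next
  case False
  then show ?thesis
    using nonneg[of "- r / a"] \<open>a \<ge> 0\<close> by (simp add: field_simps power2_eq_square)
qed

text \<open>Here \<open>p1\<close>, \<open>p2\<close> are the powers really used and
  \<open>r\<close> the mean product. The least-squares coefficient \<open>- r / p1\<close> leaves
  the residual \<open>p2 * (1 - \<rho>\<^sup>2)\<close>. With \<open>\<rho>\<close> held fixed, both
  bounds grow with the powers, so these may be raised to \<open>P1\<close>, \<open>P2\<close>; a
  negative \<open>r\<close> is replaced by its absolute value.\<close>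

lemma correlation_choice:
  fixes p1 p2 r P1 P2 :: real
  assumes p: "0 \<le> p1" "0 \<le> p2" "p1 \<le> P1" "p2 \<le> P2" and r: "r\<^sup>2 \<le> p1 * p2"
  shows "\<exists>\<rho>\<in>{0..1}. \<exists>\<gamma>. p2 + 2 * \<gamma> * r + \<gamma>\<^sup>2 * p1 \<le> P2 * (1 - \<rho>\<^sup>2) \<and>
     p1 + p2 + 2 * r \<le> P1 + P2 + 2 * sqrt (P1 * P2) * \<rho>"
proof (cases "p1 * p2 = 0")
  case True
  then have "r\<^sup>2 \<le> 0" using r by metis
  then have "r = 0" by simp
  then show ?thesis using p by (intro bexI[of _ 0] exI[of _ 0]) auto
next
  case False
  with p have pos: "p1 > 0" "p2 > 0" by auto
  define \<rho> where "\<rho> = \<bar>r\<bar> / sqrt (p1 * p2)"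
  have "\<bar>r\<bar> \<le> sqrt (p1 * p2)" using r by (metis real_sqrt_abs real_sqrt_le_iff)
  then have \<rho>: "\<rho> \<in> {0..1}" using pos by (auto simp: \<rho>_def)
  have \<rho>2: "\<rho>\<^sup>2 = r\<^sup>2 / (p1 * p2)" using pos by (simp add: \<rho>_def power_divide)
  have "p2 + 2 * (- r / p1) * r + (- r / p1)\<^sup>2 * p1 = p2 * (1 - \<rho>\<^sup>2)"
    using pos unfolding \<rho>2 by (simp add: field_simps power2_eq_square)
  also have "\<dots> \<le> P2 * (1 - \<rho>\<^sup>2)"
    using \<rho> p by (intro mult_right_mono) (auto simp: power_le_one_iff)
  finally have 1: "p2 + 2 * (- r / p1) * r + (- r / p1)\<^sup>2 * p1 \<le> P2 * (1 - \<rho>\<^sup>2)" .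
  have "r \<le> \<bar>r\<bar>" by simp
  also have "\<bar>r\<bar> = sqrt (p1 * p2) * \<rho>" using pos by (simp add: \<rho>_def)
  also have "\<dots> \<le> sqrt (P1 * P2) * \<rho>"
    using \<rho> p by (intro mult_right_mono real_sqrt_le_mono mult_mono) auto
  finally show ?thesis using 1 p \<rho> by (intro bexI[of _ \<rho>] exI[of _ "- r / p1"]) auto
qed

text \<open>The inflation \<open>B\<close> is chosen to match the mean squared prediction error, so
  the quadratic term is at most \<open>M * N / 2\<close> and is cancelled. \<open>K\<close> is the
  summed success probability, and \<open>l\<close> is the logarithm of the size of one class, which
  may be smaller than \<open>M\<close>.\<close>

lemma rate_of_class_bound:
  fixes M N v B D l eps K :: real
  assumes "M > 0" "N > 0" "v > 0" "B \<ge> 0" "D \<le> M * N * B" "(1 - eps) * M \<le> K" "l \<ge> 0"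
    and "K * l + M * (N / 2 * ln (v / (v + B))) + M * (N / 2) - (M * (N * v) + D) / (2 * (v + B)) \<le> M * ln 2"
  shows "(1 - eps) * l \<le> N / 2 * ln (1 + B / v) + ln 2"
proof -
  have "(M * (N * v) + D) / (2 * (v + B)) \<le> (M * N * (v + B)) / (2 * (v + B))"
    using assms by (intro divide_right_mono) (auto simp: algebra_simps)
  also have "\<dots> = M * (N / 2)" using assms by (simp add: field_simps)
  finally have "K * l + M * (N / 2 * ln (v / (v + B))) \<le> M * ln 2" using assms(8) by linarith
  moreover have "(1 - eps) * M * l \<le> K * l" using assms by (intro mult_right_mono)
  moreover have "ln (v / (v + B)) = - ln (1 + B / v)"
    using assms by (simp add: ln_div field_simps add_pos_nonneg)
  ultimately have "M * ((1 - eps) * l) \<le> M * (N / 2 * ln (1 + B / v) + ln 2)"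
    by (simp add: algebra_simps)
  then show ?thesis using assms by simp
qed

section \<open>From one code to two rate inequalities\<close>

lemma good_codeD:
  assumes "good_code P1 P2 Q v N M1 M2 eps f1 f2 dec"
  defines "W \<equiv> {1..M1} \<times> {1..M2}"
  shows "\<And>w i. w \<in> W \<Longrightarrow> i < N \<Longrightarrow> tx1 f1 f2 i w \<in> borel_measurable (omega Q v N)"
    and "\<And>w i. w \<in> W \<Longrightarrow> i < N \<Longrightarrow> tx2 f1 f2 i w \<in> borel_measurable (omega Q v N)"
    and "\<And>w. w \<in> W \<Longrightarrow> space (omega Q v N) - correct Q v N f1 f2 dec w \<in> sets (omega Q v N)"
    and "(\<Sum>w\<in>W. \<Sum>i<N. \<integral>\<^sup>+ \<omega>. ennreal ((tx1 f1 f2 i w \<omega>)\<^sup>2) \<partial>omega Q v N) \<le> ennreal (real N * real M1 * real M2 * P1)"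
    and "(\<Sum>w\<in>W. \<Sum>i<N. \<integral>\<^sup>+ \<omega>. ennreal ((tx2 f1 f2 i w \<omega>)\<^sup>2) \<partial>omega Q v N) \<le> ennreal (real N * real M1 * real M2 * P2)"
    and "(\<Sum>w\<in>W. measure (omega Q v N) (space (omega Q v N) - correct Q v N f1 f2 dec w)) / (real M1 * real M2) \<le> eps"
proof -
  have err: "space (omega Q v N) - correct Q v N f1 f2 dec (w1, w2)
     = {\<omega> \<in> space (omega Q v N). dec (yseq f1 f2 w1 w2 (fst \<omega>) (snd \<omega>) N) \<noteq> (w1, w2)}" for w1 w2
    by (auto simp: correct_def)
  note g = assms(1)[unfolded good_code_def Let_def, folded err]
  show "tx1 f1 f2 i w \<in> borel_measurable (omega Q v N)" if "w \<in> W" "i < N" for w i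
    using g that by (auto simp: W_def tx1_def[abs_def])
  show "tx2 f1 f2 i w \<in> borel_measurable (omega Q v N)" if "w \<in> W" "i < N" for w i
    using g that by (auto simp: W_def tx2_def[abs_def])
  show "space (omega Q v N) - correct Q v N f1 f2 dec w \<in> sets (omega Q v N)" if "w \<in> W" for w
    using g that by (auto simp: W_def)
  show "(\<Sum>w\<in>W. \<Sum>i<N. \<integral>\<^sup>+ \<omega>. ennreal ((tx1 f1 f2 i w \<omega>)\<^sup>2) \<partial>omega Q v N) \<le> ennreal (real N * real M1 * real M2 * P1)"
    unfolding W_def using g by (subst sum.swap) (simp add: sum.cartesian_product tx1_def case_prod_unfold)
  show "(\<Sum>w\<in>W. \<Sum>i<N. \<integral>\<^sup>+ \<omega>. ennreal ((tx2 f1 f2 i w \<omega>)\<^sup>2) \<partial>omega Q v N) \<le> ennreal (real N * real M1 * real M2 * P2)"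
    unfolding W_def using g by (subst sum.swap) (simp add: sum.cartesian_product tx2_def case_prod_unfold)
  show "(\<Sum>w\<in>W. measure (omega Q v N) (space (omega Q v N) - correct Q v N f1 f2 dec w)) / (real M1 * real M2) \<le> eps"
    using g by (simp add: W_def sum.cartesian_product case_prod_unfold)
qed

lemma integrable_of_sum_nn_integral:
  assumes "finite W" "finite I" and g: "\<And>w i. w \<in> W \<Longrightarrow> i \<in> I \<Longrightarrow> g w i \<in> borel_measurable M"
    and nn: "\<And>w i x. g w i x \<ge> 0"
    and le: "(\<Sum>w\<in>W. \<Sum>i\<in>I. \<integral>\<^sup>+ x. ennreal (g w i x) \<partial>M) \<le> ennreal c" and c: "c \<ge> 0"
  shows "\<And>w i. w \<in> W \<Longrightarrow> i \<in> I \<Longrightarrow> integrable M (g w i)"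
    and "(\<Sum>w\<in>W. \<Sum>i\<in>I. \<integral>x. g w i x \<partial>M) \<le> c"
proof -
  show int: "integrable M (g w i)" if w: "w \<in> W" and i: "i \<in> I" for w i
  proof -
    have "(\<integral>\<^sup>+ x. ennreal (g w i x) \<partial>M) \<le> (\<Sum>i\<in>I. \<integral>\<^sup>+ x. ennreal (g w i x) \<partial>M)"
      by (rule member_le_sum[OF i]) (use assms in auto)
    also have "\<dots> \<le> (\<Sum>w\<in>W. \<Sum>i\<in>I. \<integral>\<^sup>+ x. ennreal (g w i x) \<partial>M)"
      by (rule member_le_sum[OF w]) (use assms in auto)
    also have "\<dots> < \<infinity>" using le by (rule le_less_trans) simp
    finally show ?thesis using g[OF w i] nn by (intro integrableI_nonneg) auto
  qed
  have "(\<Sum>w\<in>W. \<Sum>i\<in>I. \<integral>\<^sup>+ x. ennreal (g w i x) \<partial>M) = (\<Sum>w\<in>W. \<Sum>i\<in>I. ennreal (\<integral>x. g w i x \<partial>M))"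
    by (intro sum.cong refl nn_integral_eq_integral int) (auto simp: nn)
  also have "\<dots> = (\<Sum>w\<in>W. ennreal (\<Sum>i\<in>I. \<integral>x. g w i x \<partial>M))"
    by (intro sum.cong refl sum_ennreal Bochner_Integration.integral_nonneg nn)
  also have "\<dots> = ennreal (\<Sum>w\<in>W. \<Sum>i\<in>I. \<integral>x. g w i x \<partial>M)"
    by (intro sum_ennreal sum_nonneg Bochner_Integration.integral_nonneg nn)
  finally have "ennreal (\<Sum>w\<in>W. \<Sum>i\<in>I. \<integral>x. g w i x \<partial>M) = (\<Sum>w\<in>W. \<Sum>i\<in>I. \<integral>\<^sup>+ x. ennreal (g w i x) \<partial>M)" ..
  then show "(\<Sum>w\<in>W. \<Sum>i\<in>I. \<integral>x. g w i x \<partial>M) \<le> c" using le c by (metis ennreal_le_iff)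
qed

lemma converse_code:
  assumes P: "P1 > 0" "P2 > 0" and Q: "Q > 0" and v: "v > 0"
    and NM: "N \<ge> 1" "M1 \<ge> 1" "M2 \<ge> 1"
    and code: "good_code P1 P2 Q v N M1 M2 eps f1 f2 dec"
  shows "\<exists>\<rho>\<in>{0..1}. (1 - eps) * ln (real M2) \<le> N / 2 * ln (1 + P2 * (1 - \<rho>\<^sup>2) / v) + ln 2 \<and>
     (1 - eps) * ln (real M1 * real M2) \<le> N / 2 * ln (1 + (P1 + P2 + 2 * sqrt (P1 * P2) * \<rho>) / v) + ln 2"
proof -
  let ?\<Omega> = "omega Q v N"
  define W where "W = {1..M1} \<times> {1..M2}"
  note g = good_codeD[OF code, folded W_def]
  interpret prob_space ?\<Omega> by (rule prob_space_omega[OF Q v])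
  have W: "finite W" "W \<noteq> {}" "card W = M1 * M2" using NM by (auto simp: W_def)
  note [measurable] = g(1,2)
  have K: "correct Q v N f1 f2 dec w \<in> events" if "w \<in> W" for w
  proof -
    have "correct Q v N f1 f2 dec w = space ?\<Omega> - (space ?\<Omega> - correct Q v N f1 f2 dec w)"
      by (auto simp: correct_def)
    then show ?thesis using g(3)[OF that] by (metis sets.compl_sets)
  qed
  \<comment> \<open>Number of message pairs times block length; dividing by it turns the sums below
    into average powers.\<close>
  define T where "T = real M1 * real M2 * real N"
  have T: "T > 0" using NM by (simp add: T_def)
  have i1: "integrable ?\<Omega> (\<lambda>\<omega>. (tx1 f1 f2 i w \<omega>)\<^sup>2)" and i2: "integrable ?\<Omega> (\<lambda>\<omega>. (tx2 f1 f2 i w \<omega>)\<^sup>2)"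
    if "w \<in> W" "i < N" for w i
    using integrable_of_sum_nn_integral(1)[OF W(1) _ _ _ g(4)] integrable_of_sum_nn_integral(1)[OF W(1) _ _ _ g(5)] that P
    by auto
  define a where "a = (\<Sum>w\<in>W. \<Sum>i<N. \<integral>\<omega>. (tx1 f1 f2 i w \<omega>)\<^sup>2 \<partial>?\<Omega>)"
  define b where "b = (\<Sum>w\<in>W. \<Sum>i<N. \<integral>\<omega>. (tx2 f1 f2 i w \<omega>)\<^sup>2 \<partial>?\<Omega>)"
  define r where "r = (\<Sum>w\<in>W. \<Sum>i<N. \<integral>\<omega>. tx1 f1 f2 i w \<omega> * tx2 f1 f2 i w \<omega> \<partial>?\<Omega>)"
  have ab: "0 \<le> a" "0 \<le> b" by (auto simp: a_def b_def intro!: sum_nonneg)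
  have aP: "a \<le> T * P1" and bP: "b \<le> T * P2"
    using integrable_of_sum_nn_integral(2)[OF W(1) _ _ _ g(4)] integrable_of_sum_nn_integral(2)[OF W(1) _ _ _ g(5)] P
    by (auto simp: a_def b_def T_def mult_ac)
  have i12: "integrable ?\<Omega> (\<lambda>\<omega>. tx1 f1 f2 i w \<omega> * tx2 f1 f2 i w \<omega>)" if "w \<in> W" "i < N" for w i
  proof (rule Bochner_Integration.integrable_bound)
    show "integrable ?\<Omega> (\<lambda>\<omega>. (tx1 f1 f2 i w \<omega>)\<^sup>2 + (tx2 f1 f2 i w \<omega>)\<^sup>2)"
      using i1[OF that] i2[OF that] by simp
    have "\<bar>x * y\<bar> \<le> x\<^sup>2 + y\<^sup>2" for x y :: real
    proof -
      have "0 \<le> (\<bar>x\<bar> - \<bar>y\<bar>)\<^sup>2" by simp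
      then have "2 * \<bar>x * y\<bar> \<le> x\<^sup>2 + y\<^sup>2" by (simp add: power2_diff abs_mult)
      then show ?thesis by (smt (verit) zero_le_power2)
    qed
    then show "AE \<omega> in ?\<Omega>. norm (tx1 f1 f2 i w \<omega> * tx2 f1 f2 i w \<omega>) \<le> norm ((tx1 f1 f2 i w \<omega>)\<^sup>2 + (tx2 f1 f2 i w \<omega>)\<^sup>2)"
      by auto
  qed (use that in measurable)
  \<comment> \<open>One expression for both bounds: \<open>\<gamma> = 1\<close> measures the whole
    input, and the least-squares \<open>\<gamma>\<close> the part of \<open>X2\<close> that
    \<open>X1\<close> does not predict.\<close>
  define D where "D \<gamma> w i = \<gamma>\<^sup>2 * (\<integral>\<omega>. (tx1 f1 f2 i w \<omega>)\<^sup>2 \<partial>?\<Omega>)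
      + 2 * \<gamma> * (\<integral>\<omega>. tx1 f1 f2 i w \<omega> * tx2 f1 f2 i w \<omega> \<partial>?\<Omega>) + (\<integral>\<omega>. (tx2 f1 f2 i w \<omega>)\<^sup>2 \<partial>?\<Omega>)" for \<gamma> w i
  have D: "has_bochner_integral ?\<Omega> (\<lambda>\<omega>. (\<gamma> * tx1 f1 f2 i w \<omega> + tx2 f1 f2 i w \<omega>)\<^sup>2) (D \<gamma> w i)" if "w \<in> W" "i < N" for \<gamma> w i
  proof -
    have "has_bochner_integral ?\<Omega> (\<lambda>\<omega>. \<gamma>\<^sup>2 * (tx1 f1 f2 i w \<omega>)\<^sup>2 + 2 * \<gamma> * (tx1 f1 f2 i w \<omega> * tx2 f1 f2 i w \<omega>) + (tx2 f1 f2 i w \<omega>)\<^sup>2) (D \<gamma> w i)"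
      unfolding D_def using i1[OF that] i2[OF that] i12[OF that]
      by (intro has_bochner_integral_add has_bochner_integral_mult_right has_bochner_integral_integrable)
    then show ?thesis by (simp add: power2_sum power_mult_distrib algebra_simps)
  qed
  have Dsum: "(\<Sum>w\<in>W. \<Sum>i<N. D \<gamma> w i) = \<gamma>\<^sup>2 * a + 2 * \<gamma> * r + b" for \<gamma>
    unfolding D_def a_def b_def r_def by (simp add: sum.distrib sum_distrib_left)
  have "0 \<le> \<gamma>\<^sup>2 * a + 2 * \<gamma> * r + b" for \<gamma>
    unfolding Dsum[symmetric]
  proof (intro sum_nonneg)
    fix w i assume "w \<in> W" "i \<in> {..<N}"
    then have "D \<gamma> w i = (\<integral>\<omega>. (\<gamma> * tx1 f1 f2 i w \<omega> + tx2 f1 f2 i w \<omega>)\<^sup>2 \<partial>?\<Omega>)"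
      using D[of w i \<gamma>] by (auto simp: has_bochner_integral_iff)
    then show "0 \<le> D \<gamma> w i" by simp
  qed
  then have "r\<^sup>2 \<le> a * b" by (rule cauchy_schwarz_quadratic) (rule ab)
  then have "(r / T)\<^sup>2 \<le> a / T * (b / T)"
    using T by (simp add: power_divide divide_right_mono power2_eq_square)
  then obtain \<rho> \<gamma> where \<rho>: "\<rho> \<in> {0..1}"
    and 1: "b / T + 2 * \<gamma> * (r / T) + \<gamma>\<^sup>2 * (a / T) \<le> P2 * (1 - \<rho>\<^sup>2)"
    and 2: "a / T + b / T + 2 * (r / T) \<le> P1 + P2 + 2 * sqrt (P1 * P2) * \<rho>"
  proof -
    have "0 \<le> a / T" "0 \<le> b / T" "a / T \<le> P1" "b / T \<le> P2"
      using ab aP bP T by (simp_all add: pos_divide_le_eq mult.commute)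
    from correlation_choice[OF this \<open>(r / T)\<^sup>2 \<le> a / T * (b / T)\<close>] that show ?thesis by blast
  qed
  have Kw: "(1 - eps) * (real M1 * real M2) \<le> (\<Sum>w\<in>W. prob (correct Q v N f1 f2 dec w))"
  proof -
    have "(\<Sum>w\<in>W. prob (space ?\<Omega> - correct Q v N f1 f2 dec w)) = M1 * M2 - (\<Sum>w\<in>W. prob (correct Q v N f1 f2 dec w))"
      using K by (simp add: prob_compl sum_subtractf W(3))
    then show ?thesis using g(6) NM by (simp add: field_simps)
  qed
  define B where "B = P2 * (1 - \<rho>\<^sup>2)"
  have B: "B \<ge> 0" using \<rho> P by (auto simp: B_def power_le_one_iff)
  have D1: "(\<Sum>w\<in>W. \<Sum>i<N. D \<gamma> w i) \<le> T * B"
    using 1 T unfolding Dsum B_def by (simp add: field_simps)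
  have "(1 - eps) * ln (real M2) \<le> N / 2 * ln (1 + B / v) + ln 2"
  proof (rule rate_of_class_bound[OF _ _ v B _ Kw])
    show "(\<Sum>w\<in>W. \<Sum>i<N. D \<gamma> w i) \<le> real M1 * real M2 * real N * B" using D1 by (simp add: T_def)
    \<comment> \<open>Predicting from \<open>X1\<close> requires the first message, so there is one
      class for each \<open>w1\<close>, of size \<open>M2\<close>. The coefficient is the same in
      all classes, and adding them brings back the global second moments.\<close>
    have "(\<Sum>w1=1..M1. \<Sum>w\<in>{w1} \<times> {1..M2}. prob (correct Q v N f1 f2 dec w) * ln (card ({w1} \<times> {1..M2}))
      + N / 2 * ln (v / (v + B)) + N / 2 - (N * v + (\<Sum>i<N. D \<gamma> w i)) / (2 * (v + B))) \<le> (\<Sum>w1=1..M1. card ({w1} \<times> {1..M2}) * ln 2)"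
    proof (intro sum_mono class_bound[OF Q v B, where c="1 - \<gamma>" and ?f1.0=f1 and ?f2.0=f2])
      fix w1 assume w1: "w1 \<in> {1..M1}"
      show "1 - \<gamma> = 0 \<or> (\<forall>w\<in>{w1} \<times> {1..M2}. fst w = w1)" by auto
    qed (use g(1,2) K D NM in \<open>auto simp: W_def\<close>)
    moreover have "(\<Sum>w1=1..M1. \<Sum>w\<in>{w1} \<times> {1..M2}. F w) = (\<Sum>w\<in>W. F w)" for F :: "_ \<Rightarrow> real"
      unfolding W_def by (simp add: sum.cartesian_product')
    ultimately show "(\<Sum>w\<in>W. prob (correct Q v N f1 f2 dec w)) * ln (real M2) + real M1 * real M2 * (N / 2 * ln (v / (v + B)))
       + real M1 * real M2 * (N / 2) - (real M1 * real M2 * (N * v) + (\<Sum>w\<in>W. \<Sum>i<N. D \<gamma> w i)) / (2 * (v + B)) \<le> real M1 * real M2 * ln 2"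
      by (simp add: sum.distrib sum_subtractf sum_divide_distrib[symmetric] sum_distrib_right[symmetric] W card_cartesian_product mult.assoc)
  qed (use NM in auto)
  moreover define A where "A = P1 + P2 + 2 * sqrt (P1 * P2) * \<rho>"
  have A: "A \<ge> 0" using \<rho> P by (auto simp: A_def)
  have D2: "(\<Sum>w\<in>W. \<Sum>i<N. D 1 w i) \<le> T * A"
  proof -
    have "T * (a / T + b / T + 2 * (r / T)) \<le> T * A"
      using 2 T unfolding A_def by (intro mult_left_mono) auto
    moreover have "T * (a / T + b / T + 2 * (r / T)) = a + b + 2 * r"
      using T by (simp add: distrib_left)
    ultimately show ?thesis unfolding Dsum by simp
  qed
  have "(1 - eps) * ln (real M1 * real M2) \<le> N / 2 * ln (1 + A / v) + ln 2"
  proof (rule rate_of_class_bound[OF _ _ v A _ Kw])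
    show "(\<Sum>w\<in>W. \<Sum>i<N. D 1 w i) \<le> real M1 * real M2 * real N * A" using D2 by (simp add: T_def)
    \<comment> \<open>Now all message pairs form one class, and the reference mean is the state
      alone.\<close>
    have "(\<Sum>w\<in>W. prob (correct Q v N f1 f2 dec w) * ln (card W)
      + N / 2 * ln (v / (v + A)) + N / 2 - (N * v + (\<Sum>i<N. D 1 w i)) / (2 * (v + A))) \<le> card W * ln 2"
      by (intro class_bound[OF Q v A W(1,2), where c=0 and ?f1.0=f1 and ?f2.0=f2]) (use g(1,2) K D[of _ _ 1] in auto)
    then show "(\<Sum>w\<in>W. prob (correct Q v N f1 f2 dec w)) * ln (real M1 * real M2) + real M1 * real M2 * (N / 2 * ln (v / (v + A)))
       + real M1 * real M2 * (N / 2) - (real M1 * real M2 * (N * v) + (\<Sum>w\<in>W. \<Sum>i<N. D 1 w i)) / (2 * (v + A)) \<le> real M1 * real M2 * ln 2"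
      by (simp add: sum.distrib sum_subtractf sum_divide_distrib[symmetric] sum_distrib_right[symmetric] W)
    have "1 \<le> M1 * M2" using NM by (simp add: Suc_leI)
    then have "1 \<le> real M1 * real M2" by (metis of_nat_1 of_nat_le_iff of_nat_mult)
    then show "0 \<le> ln (real M1 * real M2)" by simp
  qed (use NM in auto)
  ultimately show ?thesis using \<rho> by (auto simp: A_def B_def)
qed

section \<open>Letting the block length grow\<close>

lemma msgs_bounds:
  assumes "R \<ge> 0"
  shows "2 powr (real N * R) \<le> real (msgs N R)" "real (msgs N R) \<le> 2 * 2 powr (real N * R)" "msgs N R \<ge> 1"
proof -
  have 1: "2 powr (real N * R) \<ge> 1" using assms by (intro ge_one_powr_ge_zero) auto
  then have "\<lceil>2 powr (real N * R)\<rceil> \<ge> 1" by linarith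
  then have eq: "real (msgs N R) = of_int \<lceil>2 powr (real N * R)\<rceil>" by (simp add: msgs_def)
  show "2 powr (real N * R) \<le> real (msgs N R)" unfolding eq by simp
  show "real (msgs N R) \<le> 2 * 2 powr (real N * R)" unfolding eq using 1 by linarith
  have "real (msgs N R) \<ge> 1" unfolding eq using \<open>\<lceil>2 powr (real N * R)\<rceil> \<ge> 1\<close> by simp
  then show "msgs N R \<ge> 1" by simp
qed

text \<open>The leftover \<open>ln 2\<close> is one bit per block, hence 1/N per letter. It is
  weakened to \<open>1 / n\<close> to share an index with the error tolerance.\<close>

lemma log_rate_bound:
  assumes "N \<ge> 1" "n \<ge> 1" "n \<le> real N" "x > 0" and le: "(1 - eps) * ln m \<le> real N / 2 * ln x + ln 2"
    and m: "2 powr (real N * R) \<le> m" and eps: "eps \<le> 1"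
  shows "(1 - eps) * R \<le> 1 / 2 * log 2 x + 1 / n"
proof -
  have "ln (2 powr (real N * R)) \<le> ln m" using m by (subst ln_le_cancel_iff) (auto intro: less_le_trans[of _ "2 powr (real N * R)"])
  then have "(1 - eps) * (real N * R * ln 2) \<le> real N / 2 * ln x + ln 2"
    using mult_left_mono[of "real N * R * ln 2" "ln m" "1 - eps"] eps le by (simp add: ln_powr)
  then have "(1 - eps) * R \<le> (real N / 2 * ln x + ln 2) / (real N * ln 2)"
    using assms by (simp add: field_simps)
  also have "\<dots> = 1 / 2 * log 2 x + 1 / real N" using assms by (simp add: log_def field_simps)
  also have "1 / real N \<le> 1 / n" using assms by (intro divide_left_mono) auto
  finally show ?thesis by simp
qed

lemma converse:
  assumes P: "P1 > 0" "P2 > 0" and Q: "Q > 0" and v: "v > 0" and ach: "achievable_fb P1 P2 Q v r"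
  shows "r \<in> region P1 P2 v"
proof -
  obtain R1 R2 where r: "r = (R1, R2)" by (cases r)
  have R: "R1 \<ge> 0" "R2 \<ge> 0" using ach by (auto simp: achievable_fb_def r)
  define g1 where "g1 \<rho> = 1 / 2 * log 2 (1 + P2 * (1 - \<rho>\<^sup>2) / v)" for \<rho>
  define g2 where "g2 \<rho> = 1 / 2 * log 2 (1 + (P1 + P2 + 2 * sqrt (P1 * P2) * \<rho>) / v)" for \<rho>
  have pos: "1 + P2 * (1 - \<rho>\<^sup>2) / v > 0" "1 + (P1 + P2 + 2 * sqrt (P1 * P2) * \<rho>) / v > 0" if "\<rho> \<in> {0..1}" for \<rho>
    using that P v by (auto intro!: add_pos_nonneg simp: power_le_one_iff)
  have "\<exists>\<rho>\<in>{0..1}. (1 - 1 / real (Suc n)) * R2 \<le> g1 \<rho> + 1 / real (Suc n) \<and> (1 - 1 / real (Suc n)) * (R1 + R2) \<le> g2 \<rho> + 1 / real (Suc n)" for n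
  proof -
    obtain N0 where "\<forall>N\<ge>N0. \<exists>f1 f2 dec. good_code P1 P2 Q v N (msgs N R1) (msgs N R2) (1 / real (Suc n)) f1 f2 dec"
      using ach unfolding achievable_fb_def r by (auto dest: spec[of _ "1 / real (Suc n)"])
    then obtain f1 f2 dec where code: "good_code P1 P2 Q v (max N0 (Suc n)) (msgs (max N0 (Suc n)) R1) (msgs (max N0 (Suc n)) R2) (1 / real (Suc n)) f1 f2 dec"
      by fastforce
    \<comment> \<open>Block length at least \<open>Suc n\<close> with error
      \<open>1 / Suc n\<close>, so that both losses vanish along the same sequence.\<close>
    define N where "N = max N0 (Suc n)"
    have N: "N \<ge> 1" "real (Suc n) \<le> real N" by (auto simp: N_def)
    from converse_code[OF P Q v N(1) msgs_bounds(3)[OF R(1)] msgs_bounds(3)[OF R(2)] code[folded N_def]]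
    obtain \<rho> where \<rho>: "\<rho> \<in> {0..1}"
      and 1: "(1 - 1 / real (Suc n)) * ln (real (msgs N R2)) \<le> N / 2 * ln (1 + P2 * (1 - \<rho>\<^sup>2) / v) + ln 2"
      and 2: "(1 - 1 / real (Suc n)) * ln (real (msgs N R1) * real (msgs N R2)) \<le> N / 2 * ln (1 + (P1 + P2 + 2 * sqrt (P1 * P2) * \<rho>) / v) + ln 2"
      by blast
    have m: "2 powr (real N * (R1 + R2)) \<le> real (msgs N R1) * real (msgs N R2)"
      using mult_mono[OF msgs_bounds(1)[OF R(1), of N] msgs_bounds(1)[OF R(2), of N]] by (simp add: powr_add distrib_left)
    show ?thesis
      using log_rate_bound[OF N(1) _ N(2) pos(1)[OF \<rho>] 1 msgs_bounds(1)[OF R(2)]]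
        log_rate_bound[OF N(1) _ N(2) pos(2)[OF \<rho>] 2 m] \<rho>
      by (intro bexI[of _ \<rho>]) (auto simp: g1_def g2_def)
  qed
  then obtain \<rho> where \<rho>: "\<And>n. \<rho> n \<in> {0..1}"
    and b1: "\<And>n. (1 - 1 / real (Suc n)) * R2 \<le> g1 (\<rho> n) + 1 / real (Suc n)"
    and b2: "\<And>n. (1 - 1 / real (Suc n)) * (R1 + R2) \<le> g2 (\<rho> n) + 1 / real (Suc n)"
    by metis
  \<comment> \<open>The correlation depends on the code; compactness supplies one limit that
    satisfies both constraints simultaneously.\<close>
  obtain l s where l: "l \<in> {0..1}" and s: "strict_mono s" and lim: "(\<rho> \<circ> s) \<longlonglongrightarrow> l"
    using compact_imp_seq_compact[OF compact_Icc[of "0::real" 1]] \<rho> unfolding seq_compact_def by metis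
  have lim': "(\<lambda>n. \<rho> (s n)) \<longlonglongrightarrow> l" using lim by (simp add: comp_def)
  have z: "(\<lambda>n. 1 / real (Suc (s n))) \<longlonglongrightarrow> 0"
    using LIMSEQ_subseq_LIMSEQ[OF lim_1_over_n[THEN LIMSEQ_Suc] s] by (simp add: comp_def)
  have "(\<lambda>n. g1 (\<rho> (s n)) + 1 / real (Suc (s n))) \<longlonglongrightarrow> g1 l + 0"
    unfolding g1_def using pos(1)[OF l] v by (intro tendsto_intros lim' z) auto
  moreover have "(\<lambda>n. (1 - 1 / real (Suc (s n))) * R2) \<longlonglongrightarrow> (1 - 0) * R2" by (intro tendsto_intros z)
  ultimately have 1: "R2 \<le> g1 l" using LIMSEQ_le[of _ "(1 - 0) * R2" _ "g1 l + 0"] b1 by auto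
  have "(\<lambda>n. g2 (\<rho> (s n)) + 1 / real (Suc (s n))) \<longlonglongrightarrow> g2 l + 0"
    unfolding g2_def using pos(2)[OF l] v by (intro tendsto_intros lim' z) auto
  moreover have "(\<lambda>n. (1 - 1 / real (Suc (s n))) * (R1 + R2)) \<longlonglongrightarrow> (1 - 0) * (R1 + R2)" by (intro tendsto_intros z)
  ultimately have 2: "R1 + R2 \<le> g2 l" using LIMSEQ_le[of _ "(1 - 0) * (R1 + R2)" _ "g2 l + 0"] b2 by auto
  show ?thesis
    unfolding region_def r using l R 1 2 by (auto simp: g1_def g2_def)
qed

section \<open>Random bins in a cube\<close>


text \<open>The admissible channel inputs: power close to \<open>V\<close> and nearly orthogonal to
  \<open>X\<close>. Orthogonality makes the powers of superposed words add and suppresses a cross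
  term in the decoder's residual.\<close>

definition accept :: "nat \<Rightarrow> real \<Rightarrow> real \<Rightarrow> (nat \<Rightarrow> real) \<Rightarrow> (nat \<Rightarrow> real) \<Rightarrow> bool" where
  "accept N V \<delta> X x \<longleftrightarrow> \<bar>sqn N x - real N * V\<bar> \<le> real N * \<delta> \<and> \<bar>ip N X x\<bar> \<le> real N * \<delta>"

lemma ip_measurable:
  "(\<And>i. i < N \<Longrightarrow> (\<lambda>x. f x i) \<in> borel_measurable M) \<Longrightarrow> (\<And>i. i < N \<Longrightarrow> (\<lambda>x. g x i) \<in> borel_measurable M)
    \<Longrightarrow> (\<lambda>x. ip N (f x) (g x)) \<in> borel_measurable M"
  unfolding ip_def by (intro borel_measurable_sum borel_measurable_times) auto

lemma accept_measurable:
  assumes "\<And>i. i < N \<Longrightarrow> (\<lambda>x. f x i) \<in> borel_measurable M" "\<And>i. i < N \<Longrightarrow> (\<lambda>x. g x i) \<in> borel_measurable M"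
  shows "Measurable.pred M (\<lambda>x. accept N V \<delta> (f x) (g x))"
proof -
  have [measurable]: "(\<lambda>x. ip N (f x) (g x)) \<in> borel_measurable M" "(\<lambda>x. ip N (g x) (g x)) \<in> borel_measurable M"
    using assms by (auto intro!: ip_measurable)
  show ?thesis unfolding accept_def by measurable
qed

lemma ip_coordinate_measurable[measurable]:
  "(\<lambda>x. ip N X x) \<in> borel_measurable (leb N)" "(\<lambda>x. sqn N x) \<in> borel_measurable (leb N)"
  "Measurable.pred (leb N) (accept N V \<delta> X)"
  by (auto intro!: ip_measurable accept_measurable)

lemma ip_gauss_measurable[measurable]:
  "(\<lambda>x. ip N X x) \<in> borel_measurable (gaussN N v)"
  "(\<lambda>x. sqn N x) \<in> borel_measurable (gaussN N v)"
  by (simp_all add: measurable_PiM_gauss ip_coordinate_measurable)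

lemma ip_cong: "(\<And>i. i < N \<Longrightarrow> x i = x' i) \<Longrightarrow> (\<And>i. i < N \<Longrightarrow> y i = y' i) \<Longrightarrow> ip N x y = ip N x' y'"
  unfolding ip_def by (intro sum.cong) auto

lemma accept_cong: "(\<And>i. i < N \<Longrightarrow> y i = y' i) \<Longrightarrow> accept N V \<delta> X y = accept N V \<delta> X y'"
  unfolding accept_def using ip_cong[of N X X y y'] ip_cong[of N y y' y y'] by simp

text \<open>Half the reciprocal of the largest N(0,V) density at squared norm at least
  \<open>N * (V - \<delta>)\<close>; one half because the admissible vectors will carry at least
  half of the Gaussian mass.\<close>

definition accept_vol :: "nat \<Rightarrow> real \<Rightarrow> real \<Rightarrow> real" where
  "accept_vol N V \<delta> = 1 / 2 * ((2 * pi * V) powr (N / 2) * exp (N * (V - \<delta>) / (2 * V)))"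

text \<open>Reciprocal of the smallest N(0,r) density on the ball of squared radius
  \<open>N * r\<close>, whose Gaussian mass is at most one.\<close>

definition ball_vol :: "nat \<Rightarrow> real \<Rightarrow> real" where
  "ball_vol N r = (2 * pi * r) powr (N / 2) * exp (N / 2)"

text \<open>Volumes are compared with Gaussian probabilities, whose densities are nearly constant on the
  relevant shells; this avoids computing the volume of a ball.\<close>
lemma emeasure_accept:
  assumes V: "V > 0" and \<delta>: "\<delta> > 0" and N: "N \<ge> 1" and X: "sqn N X \<le> real N * C"
    and big: "(2 * V\<^sup>2 + C * V) / (real N * \<delta>\<^sup>2) \<le> 1 / 2"
  shows "ennreal (accept_vol N V \<delta>) \<le> emeasure (leb N) {x \<in> space (leb N). accept N V \<delta> X x}"
proof -
  let ?G = "gaussN N V"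
  interpret prob_space ?G by (rule prob_space_PiM_gauss[OF V])
  let ?A = "{x \<in> space (leb N). accept N V \<delta> X x}"
  define \<kappa> where "\<kappa> = (2 * pi * V) powr (- real N / 2) * exp (- (N * (V - \<delta>) / (2 * V)))"
  have \<kappa>: "\<kappa> > 0" using V by (simp add: \<kappa>_def)
  have sp: "space ?G = space (leb N)" by (simp add: space_PiM)
  have A[measurable]: "?A \<in> sets (leb N)" by measurable
  then have A'[measurable]: "?A \<in> sets ?G" by (simp add: sets_PiM_gauss)
  let ?B1 = "{x \<in> space ?G. \<bar>sqn N x - real N * V\<bar> \<ge> real N * \<delta>}"
  let ?B2 = "{x \<in> space ?G. \<bar>ip N X x\<bar> \<ge> real N * \<delta>}"
  have Nd: "real N * \<delta> > 0" using N \<delta> by simp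
  have B12: "?B1 \<in> sets ?G" "?B2 \<in> sets ?G" by measurable
  have "space ?G - ?A \<subseteq> ?B1 \<union> ?B2"
  proof
    fix x assume x: "x \<in> space ?G - ?A"
    then have "\<not> accept N V \<delta> X x" unfolding sp by blast
    then have "\<bar>sqn N x - real N * V\<bar> \<ge> real N * \<delta> \<or> \<bar>ip N X x\<bar> \<ge> real N * \<delta>"
      unfolding accept_def by argo
    then show "x \<in> ?B1 \<union> ?B2" using x by blast
  qed
  then have "emeasure ?G (space ?G - ?A) \<le> emeasure ?G (?B1 \<union> ?B2)"
    by (rule emeasure_mono) (intro sets.Un B12)
  also have "\<dots> \<le> emeasure ?G ?B1 + emeasure ?G ?B2" by (intro emeasure_subadditive B12)
  also have "\<dots> \<le> ennreal (2 * real N * V\<^sup>2 / (real N * \<delta>)\<^sup>2) + ennreal (sqn N X * V / (real N * \<delta>)\<^sup>2)"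
    by (intro add_mono gauss_norm_concentration[OF V Nd] gauss_ip_concentration[OF V Nd])
  also have "\<dots> \<le> ennreal (1 / 2)"
  proof -
    have "2 * real N * V\<^sup>2 / (real N * \<delta>)\<^sup>2 + sqn N X * V / (real N * \<delta>)\<^sup>2 \<le> (2 * real N * V\<^sup>2 + real N * C * V) / (real N * \<delta>)\<^sup>2"
      using X V by (simp add: add_divide_distrib[symmetric] divide_right_mono)
    also have "\<dots> = (2 * V\<^sup>2 + C * V) / (real N * \<delta>\<^sup>2)"
    proof -
      have "2 * real N * V\<^sup>2 + real N * C * V = real N * (2 * V\<^sup>2 + C * V)" by (simp add: algebra_simps)
      moreover have "(real N * \<delta>)\<^sup>2 = real N * (real N * \<delta>\<^sup>2)" by (simp add: power2_eq_square)
      ultimately show ?thesis using N by simp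
    qed
    also note big
    finally have h: "2 * real N * V\<^sup>2 / (real N * \<delta>)\<^sup>2 + sqn N X * V / (real N * \<delta>)\<^sup>2 \<le> 1 / 2" .
    have "0 \<le> sqn N X" by (simp add: ip_def sum_nonneg)
    then have eq: "ennreal (2 * real N * V\<^sup>2 / (real N * \<delta>)\<^sup>2) + ennreal (sqn N X * V / (real N * \<delta>)\<^sup>2)
       = ennreal (2 * real N * V\<^sup>2 / (real N * \<delta>)\<^sup>2 + sqn N X * V / (real N * \<delta>)\<^sup>2)"
      using V by (intro ennreal_plus[symmetric]) auto
    show ?thesis unfolding eq by (rule ennreal_leI[OF h])
  qed
  finally have "prob (space ?G - ?A) \<le> 1 / 2"
    by (simp add: emeasure_eq_measure ennreal_le_iff del: ennreal_half)
  then have "ennreal (1 / 2) \<le> emeasure ?G ?A" using prob_compl[OF A']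
    by (simp add: emeasure_eq_measure ennreal_le_iff del: ennreal_half)
  also have "\<dots> = (\<integral>\<^sup>+ x. ennreal (\<Prod>i<N. normal_density 0 (sqrt V) (x i)) * indicator ?A x \<partial>leb N)"
    unfolding PiM_gauss_density[OF V] by (subst emeasure_density) (auto simp: prod_ennreal)
  also have "\<dots> \<le> (\<integral>\<^sup>+ x. ennreal \<kappa> * indicator ?A x \<partial>leb N)"
  proof (rule nn_integral_mono)
    fix x
    show "ennreal (\<Prod>i<N. normal_density 0 (sqrt V) (x i)) * indicator ?A x \<le> ennreal \<kappa> * indicator ?A x"
    proof (cases "x \<in> ?A")
      case True
      then have "N * (V - \<delta>) \<le> sqn N x" by (auto simp: accept_def abs_le_iff algebra_simps)
      then have "- sqn N x / (2 * V) \<le> - (N * (V - \<delta>) / (2 * V))" using V by (simp add: divide_right_mono)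
      then have "(\<Prod>i<N. normal_density 0 (sqrt V) (x i)) \<le> \<kappa>"
        unfolding normal_density_prod[OF V] \<kappa>_def by (intro mult_left_mono) auto
      then show ?thesis using True by (auto intro!: ennreal_leI)
    qed auto
  qed
  also have "\<dots> = ennreal \<kappa> * emeasure (leb N) ?A" by (rule nn_integral_cmult_indicator[OF A])
  finally have *: "ennreal (1 / 2) \<le> ennreal \<kappa> * emeasure (leb N) ?A" .
  have "accept_vol N V \<delta> = 1 / \<kappa> * (1 / 2)"
    using V by (simp add: accept_vol_def \<kappa>_def powr_minus exp_minus field_simps)
  then have "ennreal (accept_vol N V \<delta>) = ennreal (1 / \<kappa>) * ennreal (1 / 2)"
    using \<kappa> by (simp only: ennreal_mult less_imp_le zero_le_divide_1_iff zero_le_one)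
  also have "\<dots> \<le> ennreal (1 / \<kappa>) * (ennreal \<kappa> * emeasure (leb N) ?A)" by (intro mult_left_mono *) simp
  also have "\<dots> = emeasure (leb N) ?A" using \<kappa> by (simp add: mult.assoc[symmetric] ennreal_mult[symmetric])
  finally show ?thesis .
qed

lemma emeasure_ball:
  assumes r: "r > 0"
  shows "emeasure (leb N) {x \<in> space (leb N). sqn N x \<le> real N * r} \<le> ennreal (ball_vol N r)"
proof -
  let ?G = "gaussN N r"
  interpret prob_space ?G by (rule prob_space_PiM_gauss[OF r])
  let ?A = "{x \<in> space (leb N). sqn N x \<le> real N * r}"
  define \<kappa> where "\<kappa> = (2 * pi * r) powr (- real N / 2) * exp (- (N / 2))"
  have \<kappa>: "\<kappa> > 0" using r by (simp add: \<kappa>_def)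
  have A[measurable]: "?A \<in> sets (leb N)" by measurable
  have "ennreal \<kappa> * emeasure (leb N) ?A = (\<integral>\<^sup>+ x. ennreal \<kappa> * indicator ?A x \<partial>leb N)"
    by (rule nn_integral_cmult_indicator[OF A, symmetric])
  also have "\<dots> \<le> (\<integral>\<^sup>+ x. ennreal (\<Prod>i<N. normal_density 0 (sqrt r) (x i)) * indicator ?A x \<partial>leb N)"
  proof (rule nn_integral_mono)
    fix x
    show "ennreal \<kappa> * indicator ?A x \<le> ennreal (\<Prod>i<N. normal_density 0 (sqrt r) (x i)) * indicator ?A x"
    proof (cases "x \<in> ?A")
      case True
      then have "- (N / 2) \<le> - sqn N x / (2 * r)" using r by (simp add: field_simps)
      then have "\<kappa> \<le> (\<Prod>i<N. normal_density 0 (sqrt r) (x i))"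
        unfolding normal_density_prod[OF r] \<kappa>_def by (intro mult_left_mono) auto
      then show ?thesis using True by (auto intro!: ennreal_leI)
    qed auto
  qed
  also have "\<dots> = emeasure ?G ?A"
    unfolding PiM_gauss_density[OF r] by (subst emeasure_density) (auto simp: prod_ennreal)
  also have "\<dots> \<le> 1" by (rule emeasure_le_1)
  finally have *: "ennreal \<kappa> * emeasure (leb N) ?A \<le> 1" .
  have "emeasure (leb N) ?A = ennreal (1 / \<kappa>) * (ennreal \<kappa> * emeasure (leb N) ?A)"
    using \<kappa> by (simp add: mult.assoc[symmetric] ennreal_mult[symmetric])
  also have "\<dots> \<le> ennreal (1 / \<kappa>) * 1" by (intro mult_left_mono *) simp
  also have "1 / \<kappa> = ball_vol N r" using r by (simp add: ball_vol_def \<kappa>_def powr_minus exp_minus field_simps)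
  finally show ?thesis by simp
qed

section \<open>Uniform words in a cube and their translates\<close>

definition translate :: "nat \<Rightarrow> (nat \<Rightarrow> real) \<Rightarrow> (nat \<Rightarrow> real) \<Rightarrow> nat \<Rightarrow> real" where
  "translate N a u = (\<lambda>i\<in>{..<N}. u i - a i)"

lemma translate_measurable: "translate N a \<in> measurable (leb N) (leb N)"
  unfolding translate_def[abs_def] by (intro measurable_restrict) auto

lemma emeasure_translate:
  assumes A: "A \<in> sets (leb N)"
  shows "emeasure (leb N) {u \<in> space (leb N). translate N a u \<in> A} = emeasure (leb N) A"
proof -
  have T: "{u \<in> space (leb N). translate N a u \<in> A} \<in> sets (leb N)"
    using measurable_sets[OF translate_measurable A] by (simp add: vimage_def Int_def conj_commute)
  have "emeasure (leb N) {u \<in> space (leb N). translate N a u \<in> A}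
      = (\<integral>\<^sup>+ u. indicator {u \<in> space (leb N). translate N a u \<in> A} u \<partial>leb N)"
    using T by simp
  \<comment> \<open>A translation is \<open>unfeed\<close> with a constant drift, so preservation of
    volume is already available.\<close>
  also have "\<dots> = (\<integral>\<^sup>+ u. indicator A (unfeed N (\<lambda>i _. a i) u) \<partial>leb N)"
    by (intro nn_integral_cong) (auto simp: unfeed_def translate_def indicator_def)
  also have "\<dots> = (\<integral>\<^sup>+ u. indicator A u \<partial>leb N)"
    by (rule nn_integral_unfeed) (use A in auto)
  finally show ?thesis using A by simp
qed

definition cube :: "nat \<Rightarrow> real \<Rightarrow> (nat \<Rightarrow> real) set" where
  "cube N L = (\<Pi>\<^sub>E i\<in>{..<N}. {-L..L})"

definition ucube :: "nat \<Rightarrow> real \<Rightarrow> (nat \<Rightarrow> real) measure" where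
  "ucube N L = uniform_measure (leb N) (cube N L)"

lemma cube_sets[measurable]: "cube N L \<in> sets (leb N)"
  unfolding cube_def by (intro sets_PiM_I_finite) auto

lemma emeasure_cube: "L > 0 \<Longrightarrow> emeasure (leb N) (cube N L) = ennreal ((2 * L) ^ N)"
  unfolding cube_def by (subst lebP.emeasure_PiM) (auto simp: ennreal_power power_mult_distrib)

lemma sets_ucube[simp, measurable_cong]: "sets (ucube N L) = sets (leb N)"
  by (simp add: ucube_def)

lemma space_ucube[simp]: "space (ucube N L) = space (leb N)"
  by (simp add: ucube_def)

lemma prob_space_ucube: "L > 0 \<Longrightarrow> prob_space (ucube N L)"
  unfolding ucube_def by (intro prob_space_uniform_measure) (auto simp: emeasure_cube)

text \<open>As long as the translate stays in the cube, the chance of hitting it does not depend on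
  \<open>a\<close>. This is why the cube must exceed every offset the encoders can meet.\<close>

lemma ucube_translate_ge:
  assumes L: "L > 0" and A: "A \<in> sets (leb N)" and p: "ennreal p \<le> emeasure (leb N) A" "p \<ge> 0"
    and inside: "\<And>x i. x \<in> A \<Longrightarrow> i < N \<Longrightarrow> \<bar>x i + a i\<bar> \<le> L"
  shows "ennreal (p / (2 * L) ^ N) \<le> emeasure (ucube N L) {u \<in> space (leb N). translate N a u \<in> A}"
proof -
  let ?T = "{u \<in> space (leb N). translate N a u \<in> A}"
  have T: "?T \<in> sets (leb N)"
    using measurable_sets[OF translate_measurable A] by (simp add: vimage_def Int_def conj_commute)
  have "?T \<subseteq> cube N L"
  proof
    fix u assume u: "u \<in> ?T"
    have "\<bar>u i\<bar> \<le> L" if "i < N" for i using inside[of "translate N a u" i] u that by (simp add: translate_def)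
    then show "u \<in> cube N L" using u by (auto simp: cube_def space_PiM PiE_iff abs_le_iff minus_le_iff)
  qed
  then have "cube N L \<inter> ?T = ?T" by auto
  then have "emeasure (ucube N L) ?T = emeasure (leb N) A / ennreal ((2 * L) ^ N)"
    unfolding ucube_def using T L by (simp add: emeasure_cube emeasure_translate[OF A])
  moreover have "ennreal (p / (2 * L) ^ N) = ennreal p / ennreal ((2 * L) ^ N)"
    using p L by (subst divide_ennreal) auto
  ultimately show ?thesis using p by (simp add: divide_right_mono_ennreal)
qed

text \<open>Cutting by the cube only loses volume, so this bound holds wherever the unbounded noise
  places the translate.\<close>

lemma ucube_translate_le:
  assumes L: "L > 0" and A: "A \<in> sets (leb N)" and q: "emeasure (leb N) A \<le> ennreal q" "q \<ge> 0"
  shows "emeasure (ucube N L) {u \<in> space (leb N). translate N a u \<in> A} \<le> ennreal (q / (2 * L) ^ N)"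
proof -
  let ?T = "{u \<in> space (leb N). translate N a u \<in> A}"
  have T: "?T \<in> sets (leb N)"
    using measurable_sets[OF translate_measurable A] by (simp add: vimage_def Int_def conj_commute)
  have "emeasure (ucube N L) ?T = emeasure (leb N) (cube N L \<inter> ?T) / ennreal ((2 * L) ^ N)"
    unfolding ucube_def using T L by (simp add: emeasure_cube)
  also have "\<dots> \<le> emeasure (leb N) ?T / ennreal ((2 * L) ^ N)"
    using T by (intro divide_right_mono_ennreal emeasure_mono) auto
  also have "\<dots> \<le> ennreal q / ennreal ((2 * L) ^ N)"
    unfolding emeasure_translate[OF A] by (intro divide_right_mono_ennreal q)
  also have "\<dots> = ennreal (q / (2 * L) ^ N)"
    using q L by (subst divide_ennreal) auto
  finally show ?thesis .
qed

text \<open>The words of one bin are independent, so they all miss \<open>A\<close> with probability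
  \<open>(1 - P(A)) ^ K\<close>, and \<open>1 - p \<le> exp (- p)\<close>.\<close>

lemma covering_failure:
  assumes U: "prob_space U" and m: "m < M" and A: "A \<in> sets U" and p: "ennreal p \<le> emeasure U A" "p \<ge> 0"
  shows "emeasure (PiM ({..<M::nat} \<times> {..<K::nat}) (\<lambda>_. U))
      {c \<in> space (PiM ({..<M} \<times> {..<K}) (\<lambda>_. U)). \<forall>k<K. c (m, k) \<notin> A} \<le> ennreal (exp (- (K * p)))"
proof -
  interpret U: prob_space U by fact
  interpret product_prob_space "\<lambda>_. U" "{..<M} \<times> {..<K}" by unfold_locales
  let ?P = "PiM ({..<M} \<times> {..<K}) (\<lambda>_. U)"
  have p1: "p \<le> U.prob A" using p by (simp add: U.emeasure_eq_measure)
  have "{c \<in> space ?P. \<forall>k<K. c (m, k) \<notin> A} = {c \<in> space ?P. \<forall>j\<in>{m} \<times> {..<K}. c j \<in> space U - A}"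
    using m by (auto simp: space_PiM PiE_iff)
  also have "emeasure ?P \<dots> = (\<Prod>j\<in>{m} \<times> {..<K}. emeasure U (space U - A))"
    using m A by (intro emeasure_PiM_Collect) auto
  also have "\<dots> = ennreal ((1 - U.prob A) ^ K)"
    using A by (simp add: U.emeasure_eq_measure U.prob_compl ennreal_power)
  also have "\<dots> \<le> ennreal (exp (- p) ^ K)"
  proof (intro ennreal_leI power_mono)
    show "1 - U.prob A \<le> exp (- p)" using p1 exp_ge_add_one_self[of "- p"] by linarith
  qed simp
  finally show ?thesis by (simp add: exp_of_nat_mult[symmetric])
qed

text \<open>The test \<open>T c\<close> sees the codebook only through bin \<open>m\<close>, so a
  word of another bin may be redrawn without changing the test. Each such word passes with
  probability at most \<open>q\<close>, and the union bound counts them.\<close>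

lemma packing_failure:
  assumes U: "prob_space U" and m: "m < M"
    and T: "\<And>j. j \<in> {..<M} \<times> {..<K} \<Longrightarrow> Measurable.pred (PiM ({..<M::nat} \<times> {..<K::nat}) (\<lambda>_. U)) (\<lambda>c. T c (c j))"
    and indep: "\<And>c m' k u u'. m' \<noteq> m \<Longrightarrow> T (c((m', k) := u')) u = T c u"
    and q: "\<And>c. c \<in> space (PiM ({..<M} \<times> {..<K}) (\<lambda>_. U)) \<Longrightarrow> emeasure U {u \<in> space U. T c u} \<le> ennreal q" "q \<ge> 0"
  shows "emeasure (PiM ({..<M} \<times> {..<K}) (\<lambda>_. U))
      {c \<in> space (PiM ({..<M} \<times> {..<K}) (\<lambda>_. U)). \<exists>m'<M. m' \<noteq> m \<and> (\<exists>k<K. T c (c (m', k)))} \<le> ennreal (M * K * q)"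
proof -
  let ?I = "{..<M} \<times> {..<K}"
  let ?P = "PiM ?I (\<lambda>_. U)"
  interpret P: prob_space ?P by (intro prob_space_PiM U)
  let ?J = "({..<M} - {m}) \<times> {..<K}"
  define F where "F j = {c \<in> space ?P. T c (c j)}" for j
  have F: "F j \<in> sets ?P" if "j \<in> ?J" for j
    using T[of j] that by (auto simp: F_def pred_def)
  have bound: "emeasure ?P (F j) \<le> ennreal q" if j: "j \<in> ?J" for j
  proof -
    obtain m' k where mk: "j = (m', k)" "m' \<noteq> m" using j by auto
    have "emeasure ?P (F j) = (\<integral>\<^sup>+ c. indicator (F j) c \<partial>?P)" using F[OF j] by simp
    also have "\<dots> = (\<integral>\<^sup>+ c. (\<integral>\<^sup>+ u. indicator (F j) (c(j := u)) \<partial>U) \<partial>?P)"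
      using F[OF j] j by (intro nn_integral_PiM_resample[OF U]) auto
    also have "\<dots> \<le> (\<integral>\<^sup>+ c. ennreal q \<partial>?P)"
    proof (rule nn_integral_mono)
      fix c assume c: "c \<in> space ?P"
      have iff: "c(j := u) \<in> F j \<longleftrightarrow> T c u" if "u \<in> space U" for u
      proof -
        have "c(j := u) \<in> space ?P" using c j that by (auto simp: space_PiM PiE_iff extensional_def)
        moreover have "T (c(j := u)) u = T c u" unfolding mk(1) by (rule indep[OF mk(2)])
        ultimately show ?thesis by (simp add: F_def)
      qed
      have "(\<integral>\<^sup>+ u. indicator (F j) (c(j := u)) \<partial>U) = (\<integral>\<^sup>+ u. indicator {u \<in> space U. T c u} u \<partial>U)"
        by (intro nn_integral_cong) (simp add: indicator_def iff)
      also have "\<dots> = emeasure U {u \<in> space U. T c u}"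
      proof (rule nn_integral_indicator)
        have "(\<lambda>u. c(j := u)) \<in> measurable U ?P"
          using c j by (intro measurable_fun_upd[of _ ?I]) auto
        then have "(\<lambda>u. c(j := u)) -` F j \<inter> space U \<in> sets U" using F[OF j] by (rule measurable_sets)
        also have "(\<lambda>u. c(j := u)) -` F j \<inter> space U = {u \<in> space U. T c u}"
          using iff by blast
        finally show "{u \<in> space U. T c u} \<in> sets U" .
      qed
      also have "\<dots> \<le> ennreal q" by (rule q(1)[OF c])
      finally show "(\<integral>\<^sup>+ u. indicator (F j) (c(j := u)) \<partial>U) \<le> ennreal q" .
    qed
    finally show ?thesis by (simp add: P.emeasure_space_1)
  qed
  have "{c \<in> space ?P. \<exists>m'<M. m' \<noteq> m \<and> (\<exists>k<K. T c (c (m', k)))} = (\<Union>j\<in>?J. F j)"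
    by (auto simp: F_def)
  also have "emeasure ?P \<dots> \<le> (\<Sum>j\<in>?J. emeasure ?P (F j))"
    using F by (intro emeasure_subadditive_finite) auto
  also have "\<dots> \<le> (\<Sum>j\<in>?J. ennreal q)" by (intro sum_mono bound)
  also have "\<dots> = ennreal (card ?J * q)" using q(2) by (simp add: ennreal_mult ennreal_of_nat_eq_real_of_nat)
  also have "\<dots> \<le> ennreal (real M * real K * q)"
  proof -
    have "card ?J \<le> M * K" using card_mono[of ?I ?J] by (auto simp: card_cartesian_product)
    then have "real (card ?J) \<le> real M * real K" by (metis of_nat_le_iff of_nat_mult)
    then show ?thesis using q(2) by (intro ennreal_leI mult_right_mono) auto
  qed
  finally show ?thesis .
qed

text \<open>Costa's encoder: among the \<open>K\<close> words of bin \<open>m\<close> take the first one whose offset from the scaled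
  interference is an admissible channel input, and send that offset (zero if there is none).\<close>
definition bin_enc :: "nat \<Rightarrow> ((nat \<Rightarrow> real) \<Rightarrow> bool) \<Rightarrow> real \<Rightarrow> (nat \<times> nat \<Rightarrow> nat \<Rightarrow> real) \<Rightarrow> nat \<Rightarrow> (nat \<Rightarrow> real) \<Rightarrow> nat \<Rightarrow> real" where
  "bin_enc K A \<alpha> c m t i = (\<Sum>k<K. if A (\<lambda>i. c (m, k) i - \<alpha> * t i) \<and> (\<forall>j\<in>{..<k}. \<not> A (\<lambda>i. c (m, j) i - \<alpha> * t i))
      then c (m, k) i - \<alpha> * t i else 0)"

text \<open>The disjunct \<open>M \<le> m\<close> guarantees that a least index exists: the decoder
  answers \<open>M\<close> when no bin matches. If several match, the smallest wins.\<close>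

definition bin_dec :: "nat \<Rightarrow> nat \<Rightarrow> nat \<Rightarrow> real \<Rightarrow> real \<Rightarrow> (nat \<times> nat \<Rightarrow> nat \<Rightarrow> real) \<Rightarrow> (nat \<Rightarrow> real) \<Rightarrow> nat" where
  "bin_dec N M K r \<alpha> c y = (LEAST m. M \<le> m \<or> (\<exists>k\<in>{..<K}. sqn N (\<lambda>i. c (m, k) i - \<alpha> * y i) \<le> real N * r))"

lemma bin_enc_success:
  assumes "\<exists>k<K. A (\<lambda>i. c (m, k) i - \<alpha> * t i)"
  obtains k where "k < K" "A (\<lambda>i. c (m, k) i - \<alpha> * t i)" "bin_enc K A \<alpha> c m t = (\<lambda>i. c (m, k) i - \<alpha> * t i)"
proof -
  define P where "P k \<longleftrightarrow> A (\<lambda>i. c (m, k) i - \<alpha> * t i)" for k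
  define k where "k = (LEAST k. P k)"
  obtain k' where "k' < K" "P k'" using assms by (auto simp: P_def)
  then have k: "P k" "k < K" using LeastI[of P k'] Least_le[of P k'] by (auto simp: k_def)
  \<comment> \<open>Hence exactly one summand in the definition of \<open>bin_enc\<close>
    survives.\<close>
  have first: "P l \<and> (\<forall>j\<in>{..<l}. \<not> P j) \<longleftrightarrow> l = k" for l
    using k not_less_Least[of _ P, folded k_def] by (metis lessThan_iff linorder_neqE_nat)
  have "bin_enc K A \<alpha> c m t i = c (m, k) i - \<alpha> * t i" for i
    unfolding bin_enc_def P_def[symmetric] first using k(2) by simp
  then show ?thesis using that[of k] k by (auto simp: P_def)
qed

lemma bin_enc_failure: "\<not> (\<exists>k<K. A (\<lambda>i. c (m, k) i - \<alpha> * t i)) \<Longrightarrow> bin_enc K A \<alpha> c m t = (\<lambda>_. 0)"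
  by (auto simp: bin_enc_def intro!: ext sum.neutral)

lemma bin_enc_cong: "(\<And>k. k < K \<Longrightarrow> c (m, k) = c' (m, k)) \<Longrightarrow> bin_enc K A \<alpha> c m t = bin_enc K A \<alpha> c' m t"
  unfolding bin_enc_def by (intro ext sum.cong refl) auto

lemma bin_enc_measurable:
  assumes c: "\<And>k i. k < K \<Longrightarrow> i < N \<Longrightarrow> (\<lambda>x. c x (m, k) i) \<in> borel_measurable M"
    and t: "\<And>i. i < N \<Longrightarrow> (\<lambda>x. t x i) \<in> borel_measurable M"
    and X: "\<And>i. i < N \<Longrightarrow> (\<lambda>x. X x i) \<in> borel_measurable M" and i: "i < N"
  shows "(\<lambda>x. bin_enc K (accept N V \<delta> (X x)) \<alpha> (c x) m (t x) i) \<in> borel_measurable M"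
proof -
  have [measurable]: "(\<lambda>x. c x (m, k) i - \<alpha> * t x i) \<in> borel_measurable M" if "k < K" "i < N" for k i
    using c[OF that] t[OF that(2)] by measurable
  have [measurable]: "Measurable.pred M (\<lambda>x. accept N V \<delta> (X x) (\<lambda>i. c x (m, k) i - \<alpha> * t x i))" if "k < K" for k
    using that X by (intro accept_measurable) auto
  show ?thesis
    unfolding bin_enc_def
  proof (intro borel_measurable_sum measurable_If)
    fix k assume k: "k \<in> {..<K}"
    have "Measurable.pred M (\<lambda>x. \<forall>j\<in>{..<k}. \<not> accept N V \<delta> (X x) (\<lambda>i. c x (m, j) i - \<alpha> * t x i))"
      using k by (intro pred_intros_finite(3)) auto
    moreover have "Measurable.pred M (\<lambda>x. accept N V \<delta> (X x) (\<lambda>i. c x (m, k) i - \<alpha> * t x i))"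
      using k by simp
    ultimately have "Measurable.pred M (\<lambda>x. accept N V \<delta> (X x) (\<lambda>i. c x (m, k) i - \<alpha> * t x i) \<and>
        (\<forall>j\<in>{..<k}. \<not> accept N V \<delta> (X x) (\<lambda>i. c x (m, j) i - \<alpha> * t x i)))"
      by (intro pred_intros_logic(3))
    then show "{x \<in> space M. accept N V \<delta> (X x) (\<lambda>i. c x (m, k) i - \<alpha> * t x i) \<and>
        (\<forall>j\<in>{..<k}. \<not> accept N V \<delta> (X x) (\<lambda>i. c x (m, j) i - \<alpha> * t x i))} \<in> sets M"
      unfolding pred_def .
  qed (use i in auto)
qed

lemma bin_dec_eq:
  assumes "m < M" "k < K" "sqn N (\<lambda>i. c (m, k) i - \<alpha> * y i) \<le> real N * r"
    and "\<not> (\<exists>m'<M. m' \<noteq> m \<and> (\<exists>k<K. sqn N (\<lambda>i. c (m', k) i - \<alpha> * y i) \<le> real N * r))"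
  shows "bin_dec N M K r \<alpha> c y = m"
  unfolding bin_dec_def
proof (rule Least_equality)
  show "M \<le> m \<or> (\<exists>k\<in>{..<K}. sqn N (\<lambda>i. c (m, k) i - \<alpha> * y i) \<le> real N * r)"
    using assms(2,3) by blast
  fix m' assume m': "M \<le> m' \<or> (\<exists>k\<in>{..<K}. sqn N (\<lambda>i. c (m', k) i - \<alpha> * y i) \<le> real N * r)"
  show "m \<le> m'"
  proof (rule ccontr)
    assume "\<not> m \<le> m'"
    then have "m' < M" "m' \<noteq> m" using assms(1) by auto
    then show False using assms(4) m' by auto
  qed
qed

lemma bin_dec_measurable:
  assumes c: "\<And>m k i. m < M \<Longrightarrow> k < K \<Longrightarrow> i < N \<Longrightarrow> (\<lambda>x. c x (m, k) i) \<in> borel_measurable S"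
    and y: "\<And>i. i < N \<Longrightarrow> (\<lambda>x. y x i) \<in> borel_measurable S"
  shows "(\<lambda>x. bin_dec N M K r \<alpha> (c x) (y x)) \<in> measurable S (count_space UNIV)"
  unfolding bin_dec_def
proof (intro measurable_Least)
  fix m
  define P where "P x \<longleftrightarrow> (\<exists>k\<in>{..<K}. sqn N (\<lambda>i. c x (m, k) i - \<alpha> * y x i) \<le> real N * r)" for x
  have "Measurable.pred S (\<lambda>x. M \<le> m \<or> P x)"
  proof (cases "m < M")
    case True
    have m1: "(\<lambda>x. sqn N (\<lambda>i. c x (m, k) i - \<alpha> * y x i)) \<in> borel_measurable S" if k: "k \<in> {..<K}" for k
    proof -
      have ck: "\<And>i. i < N \<Longrightarrow> (\<lambda>x. c x (m, k) i) \<in> borel_measurable S" using c[OF True] k by blast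
      show ?thesis
        by (rule ip_measurable; intro borel_measurable_diff borel_measurable_times borel_measurable_const ck y; assumption)
    qed
    have "Measurable.pred S (\<lambda>x. \<exists>k\<in>{..<K}. sqn N (\<lambda>i. c x (m, k) i - \<alpha> * y x i) \<le> real N * r)"
    proof (rule pred_intros_finite(4))
      fix k assume "k \<in> {..<K}"
      note [measurable] = m1[OF this]
      show "Measurable.pred S (\<lambda>x. sqn N (\<lambda>i. c x (m, k) i - \<alpha> * y x i) \<le> real N * r)" by measurable
    qed (rule finite_lessThan)
    then have "Measurable.pred S P" unfolding P_def[abs_def] .
    moreover have "(\<lambda>x. M \<le> m \<or> P x) = P" using True by (auto simp: fun_eq_iff)
    ultimately show ?thesis by (rule ssubst[rotated])
  next
    case False
    then have eq: "(\<lambda>x. M \<le> m \<or> P x) = (\<lambda>_. True)" by (auto simp: fun_eq_iff)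
    show ?thesis unfolding eq by (rule measurable_const) simp
  qed
  then show "(\<lambda>x. M \<le> m \<or> (\<exists>k\<in>{..<K}. sqn N (\<lambda>i. c x (m, k) i - \<alpha> * y x i) \<le> real N * r)) \<in> measurable S (count_space UNIV)"
    unfolding P_def .
qed

section \<open>Two superposed dirty-paper codes\<close>


text \<open>Freezes one source of randomness; each error event is bounded by freezing all sources
  except the one that makes it rare.\<close>

lemma emeasure_pair_le_fst:
  assumes "prob_space A" "prob_space B" "Measurable.pred (A \<Otimes>\<^sub>M B) P"
    and "\<And>x. x \<in> space A \<Longrightarrow> emeasure B {y \<in> space B. P (x, y)} \<le> c"
  shows "emeasure (A \<Otimes>\<^sub>M B) {z \<in> space (A \<Otimes>\<^sub>M B). P z} \<le> c"
proof -
  interpret A: prob_space A by fact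
  interpret B: prob_space B by fact
  let ?E = "{z \<in> space (A \<Otimes>\<^sub>M B). P z}"
  have E: "?E \<in> sets (A \<Otimes>\<^sub>M B)" using assms(3) by (simp add: pred_def)
  have "emeasure (A \<Otimes>\<^sub>M B) ?E = (\<integral>\<^sup>+ x. emeasure B (Pair x -` ?E) \<partial>A)"
    by (rule B.emeasure_pair_measure_alt[OF E])
  also have "\<dots> \<le> (\<integral>\<^sup>+ x. c \<partial>A)"
  proof (rule nn_integral_mono)
    fix x assume x: "x \<in> space A"
    have "Pair x -` ?E = {y \<in> space B. P (x, y)}" using x by (auto simp: space_pair_measure)
    then show "emeasure B (Pair x -` ?E) \<le> c" using assms(4)[OF x] by simp
  qed
  finally show ?thesis by (simp add: A.emeasure_space_1)
qed

lemma emeasure_pair_le_snd: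
  assumes "prob_space A" "prob_space B" "Measurable.pred (A \<Otimes>\<^sub>M B) P"
    and "\<And>y. y \<in> space B \<Longrightarrow> emeasure A {x \<in> space A. P (x, y)} \<le> c"
  shows "emeasure (A \<Otimes>\<^sub>M B) {z \<in> space (A \<Otimes>\<^sub>M B). P z} \<le> c"
proof -
  interpret A: prob_space A by fact
  interpret B: prob_space B by fact
  interpret pair_sigma_finite A B ..
  let ?E = "{z \<in> space (A \<Otimes>\<^sub>M B). P z}"
  have E: "?E \<in> sets (A \<Otimes>\<^sub>M B)" using assms(3) by (simp add: pred_def)
  have "emeasure (A \<Otimes>\<^sub>M B) ?E = (\<integral>\<^sup>+ y. emeasure A ((\<lambda>x. (x, y)) -` ?E) \<partial>B)"
    by (rule emeasure_pair_measure_alt2[OF E])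
  also have "\<dots> \<le> (\<integral>\<^sup>+ x. c \<partial>B)"
  proof (rule nn_integral_mono)
    fix y assume y: "y \<in> space B"
    have "(\<lambda>x. (x, y)) -` ?E = {x \<in> space A. P (x, y)}" using y by (auto simp: space_pair_measure)
    then show "emeasure A ((\<lambda>x. (x, y)) -` ?E) \<le> c" using assms(4)[OF y] by simp
  qed
  finally show ?thesis by (simp add: B.emeasure_space_1)
qed

lemma pred_section_fst: "Measurable.pred (A \<Otimes>\<^sub>M B) P \<Longrightarrow> x \<in> space A \<Longrightarrow> Measurable.pred B (\<lambda>y. P (x, y))"
  by (rule measurable_compose[OF measurable_Pair1'])

lemma pred_section_snd: "Measurable.pred (A \<Otimes>\<^sub>M B) P \<Longrightarrow> y \<in> space B \<Longrightarrow> Measurable.pred A (\<lambda>x. P (x, y))"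
  by (rule measurable_compose[OF measurable_Pair2'])

lemma bin_enc_cases: "A (bin_enc K A \<alpha> c m t) \<or> bin_enc K A \<alpha> c m t = (\<lambda>_. 0)"
  using bin_enc_success[of K A c m \<alpha> t] bin_enc_failure[of K A c m \<alpha> t] by metis

text \<open>The zero word sent after a failed search satisfies both bounds too, so they hold surely,
  for every codebook and state.\<close>

lemma bin_enc_accept_bounds:
  assumes "V > 0" "\<delta> > 0"
  shows "sqn N (bin_enc K (accept N V \<delta> X) \<alpha> c m t) \<le> real N * (V + \<delta>)"
    "\<bar>ip N X (bin_enc K (accept N V \<delta> X) \<alpha> c m t)\<bar> \<le> real N * \<delta>"
proof -
  have "sqn N x \<le> real N * (V + \<delta>) \<and> \<bar>ip N X x\<bar> \<le> real N * \<delta>" if "accept N V \<delta> X x \<or> x = (\<lambda>_. 0)" for x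
    using that
  proof
    assume "accept N V \<delta> X x"
    then show ?thesis by (auto simp: accept_def abs_le_iff algebra_simps)
  next
    assume "x = (\<lambda>_. 0)"
    then show ?thesis using assms by (simp add: ip_def)
  qed
  from this[OF bin_enc_cases] show "sqn N (bin_enc K (accept N V \<delta> X) \<alpha> c m t) \<le> real N * (V + \<delta>)"
    "\<bar>ip N X (bin_enc K (accept N V \<delta> X) \<alpha> c m t)\<bar> \<le> real N * \<delta>" by blast+
qed

lemma abs_le_sqrt_sqn: "i < N \<Longrightarrow> sqn N x \<le> c \<Longrightarrow> \<bar>x i\<bar> \<le> sqrt c"
proof -
  assume i: "i < N" and c: "sqn N x \<le> c"
  have "(x i)\<^sup>2 \<le> sqn N x" unfolding ip_def power2_eq_square
    by (rule member_le_sum) (use i in auto)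
  then show ?thesis using c by (metis order_trans real_sqrt_abs real_sqrt_le_iff)
qed

lemma sqn_combination:
  "sqn N (\<lambda>i. \<beta> * x i - \<alpha> * (z i + e i)) = \<beta>\<^sup>2 * sqn N x + \<alpha>\<^sup>2 * (sqn N z + sqn N e + 2 * ip N z e)
     - 2 * (\<alpha> * \<beta>) * (ip N x z + ip N x e)"
  unfolding ip_def sum_distrib_left sum.distrib[symmetric] sum_subtractf[symmetric]
  by (intro sum.cong refl) (simp add: power2_eq_square algebra_simps)

text \<open>\<open>\<alpha>\<close> is the MMSE coefficient for noise power \<open>b + v\<close>; the residual has power
  \<open>a (b + v) / (a + b + v)\<close> up to nine error terms, each at most \<open>\<delta>\<close> per letter.\<close>
lemma mmse_residual:
  fixes a b v \<delta> :: real
  assumes pos: "a > 0" "b \<ge> 0" "v > 0" "\<delta> > 0" and \<alpha>: "\<alpha> = a / (a + (b + v))"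
    and x: "sqn N x \<le> real N * (a + \<delta>)" and z: "sqn N z \<le> real N * (b + \<delta>)" and e: "sqn N e \<le> real N * (v + \<delta>)"
    and xz: "\<bar>ip N x z\<bar> \<le> real N * \<delta>" and xe: "\<bar>ip N x e\<bar> \<le> real N * \<delta>" and ze: "\<bar>ip N z e\<bar> \<le> real N * \<delta>"
  shows "sqn N (\<lambda>i. (1 - \<alpha>) * x i - \<alpha> * (z i + e i)) \<le> real N * (a * (b + v) / (a + (b + v)) + 9 * \<delta>)"
proof -
  have \<alpha>01: "0 \<le> \<alpha>" "\<alpha> \<le> 1" using pos by (auto simp: \<alpha>)
  have sq: "0 \<le> \<alpha>\<^sup>2" "\<alpha>\<^sup>2 \<le> 1" "(1 - \<alpha>)\<^sup>2 \<le> 1" "0 \<le> \<alpha> * (1 - \<alpha>)" "\<alpha> * (1 - \<alpha>) \<le> 1"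
    using \<alpha>01 by (auto simp: power_le_one_iff mult_le_one)
  have N\<delta>: "real N * \<delta> \<ge> 0" using pos by simp
  have "sqn N (\<lambda>i. (1 - \<alpha>) * x i - \<alpha> * (z i + e i)) \<le> (1 - \<alpha>)\<^sup>2 * (real N * (a + \<delta>))
      + \<alpha>\<^sup>2 * (real N * (b + \<delta>) + real N * (v + \<delta>) + 2 * (real N * \<delta>)) + 2 * (\<alpha> * (1 - \<alpha>)) * (real N * \<delta> + real N * \<delta>)"
  proof -
    have 1: "(1 - \<alpha>)\<^sup>2 * sqn N x \<le> (1 - \<alpha>)\<^sup>2 * (real N * (a + \<delta>))" by (intro mult_left_mono x) simp
    have 2: "\<alpha>\<^sup>2 * (sqn N z + sqn N e + 2 * ip N z e) \<le> \<alpha>\<^sup>2 * (real N * (b + \<delta>) + real N * (v + \<delta>) + 2 * (real N * \<delta>))"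
      using z e ze by (intro mult_left_mono) auto
    have "- (ip N x z + ip N x e) \<le> real N * \<delta> + real N * \<delta>" using xz xe by linarith
    then have "2 * (\<alpha> * (1 - \<alpha>)) * (- (ip N x z + ip N x e)) \<le> 2 * (\<alpha> * (1 - \<alpha>)) * (real N * \<delta> + real N * \<delta>)"
      using sq by (intro mult_left_mono) auto
    then have 3: "- (2 * (\<alpha> * (1 - \<alpha>)) * (ip N x z + ip N x e)) \<le> 2 * (\<alpha> * (1 - \<alpha>)) * (real N * \<delta> + real N * \<delta>)"
      by (simp only: mult_minus_right)
    show ?thesis unfolding sqn_combination using 1 2 3 by linarith
  qed
  \<comment> \<open>The error terms number 1 + 4 + 4, with coefficients
    \<open>(1 - \<alpha>)\<^sup>2\<close>, \<open>\<alpha>\<^sup>2\<close> and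
    \<open>\<alpha> * (1 - \<alpha>)\<close>, none of which exceeds one.\<close>
  also have "\<dots> = real N * ((1 - \<alpha>)\<^sup>2 * a + \<alpha>\<^sup>2 * (b + v))
      + ((1 - \<alpha>)\<^sup>2 * (real N * \<delta>) + 4 * (\<alpha>\<^sup>2 * (real N * \<delta>)) + 4 * ((\<alpha> * (1 - \<alpha>)) * (real N * \<delta>)))"
    by (simp add: algebra_simps)
  also have "\<dots> \<le> real N * ((1 - \<alpha>)\<^sup>2 * a + \<alpha>\<^sup>2 * (b + v)) + (real N * \<delta> + 4 * (real N * \<delta>) + 4 * (real N * \<delta>))"
    using mult_right_mono[OF sq(2) N\<delta>] mult_right_mono[OF sq(3) N\<delta>] mult_right_mono[OF sq(5) N\<delta>] by linarith
  also have "(1 - \<alpha>)\<^sup>2 * a + \<alpha>\<^sup>2 * (b + v) = a * (b + v) / (a + (b + v))"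
  proof -
    define n where "n = b + v"
    have n: "n > 0" using pos by (simp add: n_def)
    then have a: "a + n > 0" using pos by simp
    have "1 - \<alpha> = n / (a + n)" using a by (simp add: \<alpha> n_def field_simps)
    then have "(1 - \<alpha>)\<^sup>2 * a + \<alpha>\<^sup>2 * n = (n\<^sup>2 * a + a\<^sup>2 * n) / (a + n)\<^sup>2"
      by (simp add: \<alpha> n_def[symmetric] power_divide add_divide_distrib)
    also have "n\<^sup>2 * a + a\<^sup>2 * n = (a * n) * (a + n)" by (simp add: power2_eq_square algebra_simps)
    also have "\<dots> / (a + n)\<^sup>2 = a * n / (a + n)" using a by (simp add: power2_eq_square)
    finally show ?thesis by (simp add: n_def)
  qed
  finally show ?thesis by (simp add: algebra_simps)
qed

text \<open>\<open>A\<close> and \<open>B\<close> are the powers of the common word and of encoder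
  2's own word, with \<open>Ma\<close> bins of \<open>K1\<close> words and \<open>Mb\<close> bins of
  \<open>K2\<close> words. The last two assumptions make Chebyshev leave half of the mass admissible
  in each stage.\<close>

locale two_stage =
  fixes N K1 K2 Ma Mb :: nat and A B v Q \<delta> L0 :: real
  assumes A: "A > 0" and B: "B > 0" and v: "v > 0" and Q: "Q > 0" and \<delta>: "\<delta> > 0" and N: "N \<ge> 1" and L0: "L0 > 0"
    and large1: "2 * A\<^sup>2 / (real N * \<delta>\<^sup>2) \<le> 1 / 2" and large2: "(2 * B\<^sup>2 + (A + \<delta>) * B) / (real N * \<delta>\<^sup>2) \<le> 1 / 2"
begin

definition "\<alpha>1 = A / (A + (B + v))"
text \<open>The common word is interference here, not noise, hence no share of \<open>A\<close>. The
  form \<open>0 + v\<close> is the case \<open>b = 0\<close> of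
  \<open>mmse_residual\<close>.\<close>

definition "\<alpha>2 = B / (B + (0 + v))"
definition "r1 = A * (B + v) / (A + (B + v)) + 9 * \<delta>"
definition "r2 = B * (0 + v) / (B + (0 + v)) + 9 * \<delta>"
text \<open>Large enough for a boxed state, a common word and a word of encoder 2 together, so that
  every offset fits in the cube.\<close>

definition "L = L0 + sqrt (real N * (A + \<delta>)) + sqrt (real N * (B + \<delta>))"
definition "Ca = PiM ({..<Ma} \<times> {..<K1}) (\<lambda>_. ucube N L)"
definition "Cb = PiM ({..<Mb} \<times> {..<K2}) (\<lambda>_. ucube N L)"
definition "T = (Ca \<Otimes>\<^sub>M Cb) \<Otimes>\<^sub>M omega Q v N"

definition "X ca ma s = bin_enc K1 (accept N A \<delta> (\<lambda>_. 0)) \<alpha>1 ca ma s"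
definition "Z ca cb ma mb s = bin_enc K2 (accept N B \<delta> (X ca ma s)) \<alpha>2 cb mb (\<lambda>i. s i + X ca ma s i)"
definition "Y ca cb ma mb s e i = X ca ma s i + Z ca cb ma mb s i + s i + e i" for i :: nat

definition "deca ca y = bin_dec N Ma K1 r1 \<alpha>1 ca y"
definition "decb cb y = bin_dec N Mb K2 r2 \<alpha>2 cb y"

lemma L: "L > 0"
  unfolding L_def using L0 A B \<delta> N by (intro add_pos_nonneg) auto

lemma \<alpha>_range: "0 \<le> \<alpha>1" "\<alpha>1 \<le> 1" "0 \<le> \<alpha>2" "\<alpha>2 \<le> 1"
  using A B v by (auto simp: \<alpha>1_def \<alpha>2_def)

lemma r_pos: "r1 > 0" "r2 > 0"
  unfolding r1_def r2_def using A B v \<delta> by (auto intro!: add_nonneg_pos divide_nonneg_nonneg)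

lemma prob_Ca: "prob_space Ca" and prob_Cb: "prob_space Cb"
  unfolding Ca_def Cb_def by (intro prob_space_PiM prob_space_ucube L)+

lemma prob_Cab: "prob_space (Ca \<Otimes>\<^sub>M Cb)"
  by (intro prob_space_pair prob_Ca prob_Cb)

lemmas prob_O = prob_space_omega[OF Q v, of N]

lemma X_bound: "sqn N (X ca ma s) \<le> real N * (A + \<delta>)"
  unfolding X_def by (rule bin_enc_accept_bounds[OF A \<delta>])

lemma Z_bound: "sqn N (Z ca cb ma mb s) \<le> real N * (B + \<delta>)"
  and XZ_bound: "\<bar>ip N (X ca ma s) (Z ca cb ma mb s)\<bar> \<le> real N * \<delta>"
  unfolding Z_def by (rule bin_enc_accept_bounds[OF B \<delta>])+

text \<open>The dirty-paper identity: a bin word is the channel input plus the scaled state, so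
  subtracting the equally scaled output cancels the state and leaves an MMSE estimation
  error.\<close>

lemma residual_a:
  assumes "\<exists>k<K1. accept N A \<delta> (\<lambda>_. 0) (\<lambda>i. ca (ma, k) i - \<alpha>1 * s i)"
    and e: "sqn N e \<le> real N * (v + \<delta>)" and xe: "\<bar>ip N (X ca ma s) e\<bar> \<le> real N * \<delta>" and ze: "\<bar>ip N (Z ca cb ma mb s) e\<bar> \<le> real N * \<delta>"
  shows "\<exists>k<K1. sqn N (\<lambda>i. ca (ma, k) i - \<alpha>1 * Y ca cb ma mb s e i) \<le> real N * r1"
proof -
  obtain k where k: "k < K1" and Xk: "X ca ma s = (\<lambda>i. ca (ma, k) i - \<alpha>1 * s i)"
    unfolding X_def using bin_enc_success[OF assms(1)] by metis
  have "ca (ma, k) i - \<alpha>1 * Y ca cb ma mb s e i = (1 - \<alpha>1) * X ca ma s i - \<alpha>1 * (Z ca cb ma mb s i + e i)" for i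
  proof -
    have "ca (ma, k) i = X ca ma s i + \<alpha>1 * s i" using Xk by (simp add: fun_eq_iff)
    then show ?thesis by (simp add: Y_def algebra_simps)
  qed
  moreover have "sqn N (\<lambda>i. (1 - \<alpha>1) * X ca ma s i - \<alpha>1 * (Z ca cb ma mb s i + e i)) \<le> real N * r1"
    unfolding r1_def by (rule mmse_residual[OF A less_imp_le[OF B] v \<delta> \<alpha>1_def X_bound Z_bound e XZ_bound xe ze])
  ultimately show ?thesis using k by (intro exI[of _ k]) simp
qed

lemma residual_b:
  assumes "\<exists>k<K2. accept N B \<delta> (X ca ma s) (\<lambda>i. cb (mb, k) i - \<alpha>2 * (s i + X ca ma s i))"
    and e: "sqn N e \<le> real N * (v + \<delta>)" and ze: "\<bar>ip N (Z ca cb ma mb s) e\<bar> \<le> real N * \<delta>"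
  shows "\<exists>k<K2. sqn N (\<lambda>i. cb (mb, k) i - \<alpha>2 * Y ca cb ma mb s e i) \<le> real N * r2"
proof -
  obtain k where k: "k < K2" and Zk: "Z ca cb ma mb s = (\<lambda>i. cb (mb, k) i - \<alpha>2 * (s i + X ca ma s i))"
    unfolding Z_def using bin_enc_success[OF assms(1)] by metis
  have "cb (mb, k) i - \<alpha>2 * Y ca cb ma mb s e i = (1 - \<alpha>2) * Z ca cb ma mb s i - \<alpha>2 * (0 + e i)" for i
  proof -
    have "cb (mb, k) i = Z ca cb ma mb s i + \<alpha>2 * (s i + X ca ma s i)" using Zk by (simp add: fun_eq_iff)
    then show ?thesis by (simp add: Y_def algebra_simps)
  qed
  moreover have "sqn N (\<lambda>i. (1 - \<alpha>2) * Z ca cb ma mb s i - \<alpha>2 * (0 + e i)) \<le> real N * r2"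
    unfolding r2_def
    by (rule mmse_residual[where z="\<lambda>_. 0", OF B order_refl v \<delta> \<alpha>2_def Z_bound _ e _ ze]) (use \<delta> in \<open>auto simp: ip_def\<close>)
  ultimately show ?thesis using k by (intro exI[of _ k]) simp
qed

end

text \<open>Coordinatewise measurability along an arbitrary space \<open>S\<close>: the same rules
  then serve a random codebook, a fixed one, and the redrawn one in the packing bound.\<close>

definition code_measurable :: "'x measure \<Rightarrow> nat \<Rightarrow> nat \<Rightarrow> nat \<Rightarrow> ('x \<Rightarrow> nat \<times> nat \<Rightarrow> nat \<Rightarrow> real) \<Rightarrow> bool" where
  "code_measurable S N M K c \<longleftrightarrow> (\<forall>m<M. \<forall>k<K. \<forall>i<N. (\<lambda>x. c x (m, k) i) \<in> borel_measurable S)"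

definition vec_measurable :: "'x measure \<Rightarrow> nat \<Rightarrow> ('x \<Rightarrow> nat \<Rightarrow> real) \<Rightarrow> bool" where
  "vec_measurable S N c \<longleftrightarrow> (\<forall>i<N. (\<lambda>x. c x i) \<in> borel_measurable S)"

lemma code_measurable_PiM: "code_measurable (PiM ({..<M} \<times> {..<K}) (\<lambda>_. ucube N L)) N M K (\<lambda>c. c)"
  unfolding code_measurable_def
proof (intro allI impI)
  fix m k i assume mki: "m < M" "k < K" "i < N"
  have "(\<lambda>c. c (m, k)) \<in> measurable (PiM ({..<M} \<times> {..<K}) (\<lambda>_. ucube N L)) (ucube N L)"
    by (rule measurable_component_singleton) (use mki in auto)
  moreover have "(\<lambda>u. u i) \<in> borel_measurable (ucube N L)"
    using mki(3) by (subst measurable_cong_sets[OF sets_ucube refl]) auto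
  ultimately show "(\<lambda>c. c (m, k) i) \<in> borel_measurable (PiM ({..<M} \<times> {..<K}) (\<lambda>_. ucube N L))"
    by (rule measurable_compose)
qed

lemma code_measurable_comp: "f \<in> measurable S S' \<Longrightarrow> code_measurable S' N M K c \<Longrightarrow> code_measurable S N M K (\<lambda>x. c (f x))"
  unfolding code_measurable_def using measurable_compose by blast

lemma vec_measurable_comp: "f \<in> measurable S S' \<Longrightarrow> vec_measurable S' N c \<Longrightarrow> vec_measurable S N (\<lambda>x. c (f x))"
  unfolding vec_measurable_def using measurable_compose by blast

lemma code_measurable_const: "code_measurable S N M K (\<lambda>_. c)"
  by (simp add: code_measurable_def)

lemma vec_measurable_const: "vec_measurable S N (\<lambda>_. c)"
  by (simp add: vec_measurable_def)

lemma vec_measurable_affine: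
  "vec_measurable S N f \<Longrightarrow> vec_measurable S N g \<Longrightarrow> vec_measurable S N (\<lambda>x i. f x i - a * g x i)"
  unfolding vec_measurable_def by (intro allI impI borel_measurable_diff borel_measurable_times borel_measurable_const) auto

lemma vec_measurable_add:
  "vec_measurable S N f \<Longrightarrow> vec_measurable S N g \<Longrightarrow> vec_measurable S N (\<lambda>x i. f x i + g x i)"
  unfolding vec_measurable_def by (intro allI impI borel_measurable_add) auto

lemma vec_measurable_code: "code_measurable S N M K c \<Longrightarrow> m < M \<Longrightarrow> k < K \<Longrightarrow> vec_measurable S N (\<lambda>x. c x (m, k))"
  by (simp add: vec_measurable_def code_measurable_def)

lemma vec_measurable_omega: "vec_measurable (omega Q v N) N fst" "vec_measurable (omega Q v N) N snd"
  unfolding vec_measurable_def by (auto intro: noise_measurable)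

lemma vec_ip_measurable: "vec_measurable S N f \<Longrightarrow> vec_measurable S N g \<Longrightarrow> (\<lambda>x. ip N (f x) (g x)) \<in> borel_measurable S"
  unfolding vec_measurable_def by (rule ip_measurable) blast+

lemma vec_accept_measurable:
  "vec_measurable S N f \<Longrightarrow> vec_measurable S N g \<Longrightarrow> Measurable.pred S (\<lambda>x. accept N V \<delta> (f x) (g x))"
  unfolding vec_measurable_def by (rule accept_measurable) blast+

lemma vec_bin_enc_measurable:
  assumes "code_measurable S N M K c" "m < M" "vec_measurable S N t" "vec_measurable S N f"
  shows "vec_measurable S N (\<lambda>x. bin_enc K (accept N V \<delta> (f x)) \<alpha> (c x) m (t x))"
  using assms unfolding vec_measurable_def code_measurable_def
  by (intro allI impI bin_enc_measurable) blast+

section \<open>Measurability of the two codes and probabilities of the error events\<close>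

context two_stage
begin

lemma X_measurable:
  "code_measurable S N Ma K1 ca \<Longrightarrow> ma < Ma \<Longrightarrow> vec_measurable S N s \<Longrightarrow> vec_measurable S N (\<lambda>x. X (ca x) ma (s x))"
  unfolding X_def by (rule vec_bin_enc_measurable[OF _ _ _ vec_measurable_const])

lemma Z_measurable:
  "code_measurable S N Ma K1 ca \<Longrightarrow> ma < Ma \<Longrightarrow> code_measurable S N Mb K2 cb \<Longrightarrow> mb < Mb \<Longrightarrow> vec_measurable S N s
   \<Longrightarrow> vec_measurable S N (\<lambda>x. Z (ca x) (cb x) ma mb (s x))"
  unfolding Z_def by (intro vec_bin_enc_measurable[where M=Mb] vec_measurable_add X_measurable)

lemma Y_measurable:
  "code_measurable S N Ma K1 ca \<Longrightarrow> ma < Ma \<Longrightarrow> code_measurable S N Mb K2 cb \<Longrightarrow> mb < Mb \<Longrightarrow> vec_measurable S N s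
   \<Longrightarrow> vec_measurable S N e \<Longrightarrow> vec_measurable S N (\<lambda>x. Y (ca x) (cb x) ma mb (s x) (e x))"
  unfolding Y_def[abs_def] by (intro vec_measurable_add X_measurable Z_measurable)

lemma deca_measurable:
  "code_measurable S N Ma K1 ca \<Longrightarrow> vec_measurable S N y \<Longrightarrow> (\<lambda>x. deca (ca x) (y x)) \<in> measurable S (count_space UNIV)"
  unfolding deca_def code_measurable_def vec_measurable_def by (rule bin_dec_measurable) blast+

lemma decb_measurable:
  "code_measurable S N Mb K2 cb \<Longrightarrow> vec_measurable S N y \<Longrightarrow> (\<lambda>x. decb (cb x) (y x)) \<in> measurable S (count_space UNIV)"
  unfolding decb_def code_measurable_def vec_measurable_def by (rule bin_dec_measurable) blast+

lemma cm_T: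
  "code_measurable T N Ma K1 (\<lambda>x. fst (fst x))" "code_measurable T N Mb K2 (\<lambda>x. snd (fst x))"
  "vec_measurable T N (\<lambda>x. fst (snd x))" "vec_measurable T N (\<lambda>x. snd (snd x))"
proof -
  have [measurable]: "(\<lambda>x. fst (fst x)) \<in> measurable T Ca" "(\<lambda>x. snd (fst x)) \<in> measurable T Cb"
    "snd \<in> measurable T (omega Q v N)"
    unfolding T_def by measurable
  show "code_measurable T N Ma K1 (\<lambda>x. fst (fst x))"
    by (rule code_measurable_comp[OF _ code_measurable_PiM[of Ma K1 N L, folded Ca_def]]) simp
  show "code_measurable T N Mb K2 (\<lambda>x. snd (fst x))"
    by (rule code_measurable_comp[OF _ code_measurable_PiM[of Mb K2 N L, folded Cb_def]]) simp
  show "vec_measurable T N (\<lambda>x. fst (snd x))"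
    by (rule vec_measurable_comp[OF _ vec_measurable_omega(1)]) measurable
  show "vec_measurable T N (\<lambda>x. snd (snd x))"
    by (rule vec_measurable_comp[OF _ vec_measurable_omega(2)]) measurable
qed

text \<open>For one uniform word, \<open>p1\<close> and \<open>p2\<close> bound the chance of being
  admissible from below, \<open>q1\<close> and \<open>q2\<close> the chance of a false match from
  above. The cube volume cancels in their ratio.\<close>

definition "p1 = accept_vol N A \<delta> / (2 * L) ^ N"
definition "p2 = accept_vol N B \<delta> / (2 * L) ^ N"
definition "q1 = ball_vol N r1 / (2 * L) ^ N"
definition "q2 = ball_vol N r2 / (2 * L) ^ N"

lemma nonneg_pq: "p1 \<ge> 0" "p2 \<ge> 0" "q1 \<ge> 0" "q2 \<ge> 0"
  using L by (auto simp: p1_def p2_def q1_def q2_def accept_vol_def ball_vol_def)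

text \<open>Serves both stages: the common word, where \<open>g\<close> will be zero, and encoder
  2's word, which must be nearly orthogonal to a common word of power at most
  \<open>A + \<delta>\<close>.\<close>

lemma offset_accept_prob:
  assumes V: "V = A \<and> C = 0 \<or> V = B \<and> C = A + \<delta>" and g: "sqn N g \<le> real N * C"
    and a: "\<And>i. i < N \<Longrightarrow> \<bar>a i\<bar> \<le> L - sqrt (real N * (V + \<delta>))"
  defines "S \<equiv> {u \<in> space (leb N). translate N a u \<in> {x \<in> space (leb N). accept N V \<delta> g x}}"
  shows "S \<in> sets (ucube N L)" "ennreal (accept_vol N V \<delta> / (2 * L) ^ N) \<le> emeasure (ucube N L) S"
proof -
  have acc: "{x \<in> space (leb N). accept N V \<delta> g x} \<in> sets (leb N)" by measurable
  show "S \<in> sets (ucube N L)"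
    unfolding S_def using measurable_sets[OF translate_measurable acc] by (simp add: vimage_def Int_def conj_commute)
  have V0: "V > 0" and big: "(2 * V\<^sup>2 + C * V) / (real N * \<delta>\<^sup>2) \<le> 1 / 2"
    using V A B large1 large2 by auto
  show "ennreal (accept_vol N V \<delta> / (2 * L) ^ N) \<le> emeasure (ucube N L) S"
    unfolding S_def
  proof (rule ucube_translate_ge[OF L acc emeasure_accept[OF V0 \<delta> N g big]])
    show "accept_vol N V \<delta> \<ge> 0" by (simp add: accept_vol_def)
    fix x i assume x: "x \<in> {x \<in> space (leb N). accept N V \<delta> g x}" and i: "i < N"
    then have "sqn N x \<le> real N * (V + \<delta>)" by (auto simp: accept_def abs_le_iff algebra_simps)
    then have "\<bar>x i\<bar> \<le> sqrt (real N * (V + \<delta>))" by (rule abs_le_sqrt_sqn[OF i])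
    then show "\<bar>x i + a i\<bar> \<le> L" using a[OF i] by linarith
  qed
qed

lemma in_offset_accept:
  assumes "u \<in> space (leb N)"
  shows "u \<in> {u \<in> space (leb N). translate N a u \<in> {x \<in> space (leb N). accept N V \<delta> g x}} \<longleftrightarrow> accept N V \<delta> g (\<lambda>i. u i - a i)"
proof -
  have "accept N V \<delta> g (translate N a u) \<longleftrightarrow> accept N V \<delta> g (\<lambda>i. u i - a i)"
    by (rule accept_cong) (simp add: translate_def)
  moreover have "translate N a u \<in> space (leb N)" by (simp add: translate_def space_PiM)
  ultimately show ?thesis using assms by simp
qed

lemma bin_covering:
  fixes m M K :: nat
  assumes m: "m < M" and V: "V = A \<and> C = 0 \<or> V = B \<and> C = A + \<delta>" and g: "sqn N g \<le> real N * C"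
    and a: "\<And>i. i < N \<Longrightarrow> \<bar>a i\<bar> \<le> L - sqrt (real N * (V + \<delta>))"
  shows "emeasure (PiM ({..<M} \<times> {..<K}) (\<lambda>_. ucube N L))
     {c \<in> space (PiM ({..<M} \<times> {..<K}) (\<lambda>_. ucube N L)). \<forall>k<K. \<not> accept N V \<delta> g (\<lambda>i. c (m, k) i - a i)}
     \<le> ennreal (exp (- (K * (accept_vol N V \<delta> / (2 * L) ^ N))))"
proof -
  let ?S = "{u \<in> space (leb N). translate N a u \<in> {x \<in> space (leb N). accept N V \<delta> g x}}"
  have "c (m, k) \<in> space (leb N)" if "c \<in> space (PiM ({..<M} \<times> {..<K}) (\<lambda>_. ucube N L))" "k < K" for c k
  proof -
    have "c \<in> ({..<M} \<times> {..<K}) \<rightarrow>\<^sub>E space (leb N)" using that(1) unfolding space_PiM[of _ "\<lambda>_. ucube N L"] space_ucube .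
    then show ?thesis using m that(2) by (auto dest: PiE_mem)
  qed
  then have "{c \<in> space (PiM ({..<M} \<times> {..<K}) (\<lambda>_. ucube N L)). \<forall>k<K. \<not> accept N V \<delta> g (\<lambda>i. c (m, k) i - a i)}
    = {c \<in> space (PiM ({..<M} \<times> {..<K}) (\<lambda>_. ucube N L)). \<forall>k<K. c (m, k) \<notin> ?S}"
    using in_offset_accept[of _ a V g] by blast
  then show ?thesis
    using covering_failure[OF prob_space_ucube[OF L] m offset_accept_prob[where a=a, OF V g a], of K] L
    by (simp add: accept_vol_def)
qed

lemma residual_ball_prob:
  assumes "r > 0"
  shows "emeasure (ucube N L) {u \<in> space (ucube N L). sqn N (\<lambda>i. u i - a i) \<le> real N * r} \<le> ennreal (ball_vol N r / (2 * L) ^ N)"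
proof -
  have "{u \<in> space (ucube N L). sqn N (\<lambda>i. u i - a i) \<le> real N * r}
     = {u \<in> space (leb N). translate N a u \<in> {x \<in> space (leb N). sqn N x \<le> real N * r}}"
  proof -
    have "sqn N (translate N a u) = sqn N (\<lambda>i. u i - a i)" for u
      by (rule ip_cong) (simp_all add: translate_def)
    moreover have "translate N a u \<in> space (leb N)" for u by (simp add: translate_def space_PiM)
    ultimately show ?thesis unfolding space_ucube by simp
  qed
  moreover have "{x \<in> space (leb N). sqn N x \<le> real N * r} \<in> sets (leb N)" by measurable
  ultimately show ?thesis
    using ucube_translate_le[OF L _ emeasure_ball[OF assms]] by (simp add: ball_vol_def)
qed

text \<open>The state box is built into the event, so the event is empty for states whose offset
  could leave the cube.\<close>

definition "uncovered_a ma x \<longleftrightarrow> (\<forall>i\<in>{..<N}. \<bar>fst (snd x) i\<bar> \<le> L0) \<and>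
  (\<forall>k\<in>{..<K1}. \<not> accept N A \<delta> (\<lambda>_. 0) (\<lambda>i. fst (fst x) (ma, k) i - \<alpha>1 * fst (snd x) i))"
  for x :: "((nat \<times> nat \<Rightarrow> nat \<Rightarrow> real) \<times> (nat \<times> nat \<Rightarrow> nat \<Rightarrow> real)) \<times> (nat \<Rightarrow> real) \<times> (nat \<Rightarrow> real)"

definition "uncovered_b ma mb x \<longleftrightarrow> (\<forall>i\<in>{..<N}. \<bar>fst (snd x) i\<bar> \<le> L0) \<and>
  (\<forall>k\<in>{..<K2}. \<not> accept N B \<delta> (X (fst (fst x)) ma (fst (snd x)))
     (\<lambda>i. snd (fst x) (mb, k) i - \<alpha>2 * (fst (snd x) i + X (fst (fst x)) ma (fst (snd x)) i)))"

definition "confused_a ma mb x \<longleftrightarrow> (\<exists>m\<in>{..<Ma}. m \<noteq> ma \<and> (\<exists>k\<in>{..<K1}.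
   sqn N (\<lambda>i. fst (fst x) (m, k) i - \<alpha>1 * Y (fst (fst x)) (snd (fst x)) ma mb (fst (snd x)) (snd (snd x)) i) \<le> real N * r1))"

definition "confused_b ma mb x \<longleftrightarrow> (\<exists>m\<in>{..<Mb}. m \<noteq> mb \<and> (\<exists>k\<in>{..<K2}.
   sqn N (\<lambda>i. snd (fst x) (m, k) i - \<alpha>2 * Y (fst (fst x)) (snd (fst x)) ma mb (fst (snd x)) (snd (snd x)) i) \<le> real N * r2))"

lemma pred_state_box: "Measurable.pred T (\<lambda>x. \<forall>i\<in>{..<N}. \<bar>fst (snd x) i\<bar> \<le> L0)"
proof (rule pred_intros_finite(3))
  fix i assume "i \<in> {..<N}"
  then have [measurable]: "(\<lambda>x. fst (snd x) i) \<in> borel_measurable T" using cm_T(3) by (simp add: vec_measurable_def)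
  show "Measurable.pred T (\<lambda>x. \<bar>fst (snd x) i\<bar> \<le> L0)" by measurable
qed simp

lemma pred_uncovered_a: "ma < Ma \<Longrightarrow> Measurable.pred T (uncovered_a ma)"
  unfolding uncovered_a_def[abs_def]
  by (intro pred_intros_logic(2,3) pred_state_box pred_intros_finite(3) vec_accept_measurable
      vec_measurable_const vec_measurable_affine vec_measurable_code[OF cm_T(1)] cm_T(3)) auto

lemma pred_uncovered_b: "ma < Ma \<Longrightarrow> mb < Mb \<Longrightarrow> Measurable.pred T (uncovered_b ma mb)"
  unfolding uncovered_b_def[abs_def]
  by (intro pred_intros_logic(2,3) pred_state_box pred_intros_finite(3) vec_accept_measurable
      vec_measurable_affine vec_measurable_add X_measurable vec_measurable_code[OF cm_T(2)] cm_T) auto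

lemma pred_constant: "Measurable.pred M (\<lambda>_. c)"
  by simp

lemma pred_le_const:
  assumes "(\<lambda>x. f x) \<in> borel_measurable S"
  shows "Measurable.pred S (\<lambda>x. f x \<le> (c::real))"
  using assms by measurable

lemma pred_confused_a: "ma < Ma \<Longrightarrow> mb < Mb \<Longrightarrow> Measurable.pred T (confused_a ma mb)"
  unfolding confused_a_def[abs_def]
  by (intro pred_intros_logic(3) pred_constant pred_intros_finite(4) pred_le_const vec_ip_measurable
      vec_measurable_affine Y_measurable vec_measurable_code[OF cm_T(1)] cm_T) auto

lemma pred_confused_b: "ma < Ma \<Longrightarrow> mb < Mb \<Longrightarrow> Measurable.pred T (confused_b ma mb)"
  unfolding confused_b_def[abs_def]
  by (intro pred_intros_logic(3) pred_constant pred_intros_finite(4) pred_le_const vec_ip_measurable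
      vec_measurable_affine Y_measurable vec_measurable_code[OF cm_T(2)] cm_T) auto

lemma sqrt_L: "L0 \<le> L - sqrt (real N * (A + \<delta>))" "L0 + sqrt (real N * (A + \<delta>)) \<le> L - sqrt (real N * (B + \<delta>))"
  using A B \<delta> by (auto simp: L_def)

lemma scaled_abs_le: "0 \<le> a \<Longrightarrow> a \<le> 1 \<Longrightarrow> \<bar>x\<bar> \<le> c \<Longrightarrow> \<bar>a * x\<bar> \<le> (c::real)"
  using mult_mono[of a 1 "\<bar>x\<bar>" c] by (simp add: abs_mult)

lemma prob_uncovered_a:
  assumes ma: "ma < Ma"
  shows "emeasure T {x \<in> space T. uncovered_a ma x} \<le> ennreal (exp (- (K1 * p1)))"
  unfolding T_def
proof (rule emeasure_pair_le_snd[OF prob_Cab prob_O pred_uncovered_a[OF ma, unfolded T_def]])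
  fix \<omega> assume \<omega>: "\<omega> \<in> space (omega Q v N)"
  show "emeasure (Ca \<Otimes>\<^sub>M Cb) {c \<in> space (Ca \<Otimes>\<^sub>M Cb). uncovered_a ma (c, \<omega>)} \<le> ennreal (exp (- (K1 * p1)))"
  proof (rule emeasure_pair_le_snd[OF prob_Ca prob_Cb pred_section_snd[OF pred_uncovered_a[OF ma, unfolded T_def] \<omega>]])
    fix cb
    show "emeasure Ca {ca \<in> space Ca. uncovered_a ma ((ca, cb), \<omega>)} \<le> ennreal (exp (- (K1 * p1)))"
    proof (cases "\<forall>i<N. \<bar>fst \<omega> i\<bar> \<le> L0")
      case True
      have "\<bar>\<alpha>1 * fst \<omega> i\<bar> \<le> L - sqrt (real N * (A + \<delta>))" if "i < N" for i
        using scaled_abs_le[OF \<alpha>_range(1,2)] True that sqrt_L(1) order_trans by blast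
      from bin_covering[where V=A and C=0 and g="\<lambda>_. 0" and a="\<lambda>i. \<alpha>1 * fst \<omega> i", OF ma _ _ this, of K1]
      show ?thesis using True unfolding Ca_def p1_def uncovered_a_def by (simp add: ip_def Ball_def)
    next
      case False
      then have eq: "{ca \<in> space Ca. uncovered_a ma ((ca, cb), \<omega>)} = {}" unfolding uncovered_a_def by auto
      show ?thesis unfolding eq by simp
    qed
  qed
qed

text \<open>Once the state and the first codebook are frozen, the common word is a fixed vector, and
  the second codebook is independent of both the interference and the orthogonality
  requirement.\<close>

lemma prob_uncovered_b:
  assumes ma: "ma < Ma" and mb: "mb < Mb"
  shows "emeasure T {x \<in> space T. uncovered_b ma mb x} \<le> ennreal (exp (- (K2 * p2)))"
  unfolding T_def
proof (rule emeasure_pair_le_snd[OF prob_Cab prob_O pred_uncovered_b[OF ma mb, unfolded T_def]])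
  fix \<omega> assume \<omega>: "\<omega> \<in> space (omega Q v N)"
  show "emeasure (Ca \<Otimes>\<^sub>M Cb) {c \<in> space (Ca \<Otimes>\<^sub>M Cb). uncovered_b ma mb (c, \<omega>)} \<le> ennreal (exp (- (K2 * p2)))"
  proof (rule emeasure_pair_le_fst[OF prob_Ca prob_Cb pred_section_snd[OF pred_uncovered_b[OF ma mb, unfolded T_def] \<omega>]])
    fix ca
    show "emeasure Cb {cb \<in> space Cb. uncovered_b ma mb ((ca, cb), \<omega>)} \<le> ennreal (exp (- (K2 * p2)))"
    proof (cases "\<forall>i<N. \<bar>fst \<omega> i\<bar> \<le> L0")
      case True
      have "\<bar>\<alpha>2 * (fst \<omega> i + X ca ma (fst \<omega>) i)\<bar> \<le> L - sqrt (real N * (B + \<delta>))" if i: "i < N" for i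
      proof (rule scaled_abs_le[OF \<alpha>_range(3,4)])
        have "\<bar>X ca ma (fst \<omega>) i\<bar> \<le> sqrt (real N * (A + \<delta>))" by (rule abs_le_sqrt_sqn[OF i X_bound])
        then show "\<bar>fst \<omega> i + X ca ma (fst \<omega>) i\<bar> \<le> L - sqrt (real N * (B + \<delta>))"
          using True i sqrt_L(2) by (smt (verit))
      qed
      from bin_covering[where V=B and C="A + \<delta>" and g="X ca ma (fst \<omega>)" and a="\<lambda>i. \<alpha>2 * (fst \<omega> i + X ca ma (fst \<omega>) i)", OF mb _ X_bound this, of K2]
      show ?thesis using True unfolding Cb_def p2_def uncovered_b_def by (simp add: Ball_def)
    next
      case False
      then have eq: "{cb \<in> space Cb. uncovered_b ma mb ((ca, cb), \<omega>)} = {}" unfolding uncovered_b_def by auto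
      show ?thesis unfolding eq by simp
    qed
  qed
qed

lemma X_upd: "m \<noteq> ma \<Longrightarrow> X (ca((m, k) := u)) ma s = X ca ma s"
  unfolding X_def by (rule bin_enc_cong) auto

lemma Z_upd: "m \<noteq> mb \<Longrightarrow> Z ca (cb((m, k) := u)) ma mb s = Z ca cb ma mb s"
  unfolding Z_def by (rule bin_enc_cong) auto

text \<open>The output involves the first codebook only through bin \<open>ma\<close>, since encoder
  2's word sees it only through \<open>X\<close>. With everything else frozen, words of other bins
  are therefore independent of the output.\<close>

lemma prob_confused_a:
  assumes ma: "ma < Ma" and mb: "mb < Mb"
  shows "emeasure T {x \<in> space T. confused_a ma mb x} \<le> ennreal (real Ma * real K1 * q1)"
  unfolding T_def
proof (rule emeasure_pair_le_snd[OF prob_Cab prob_O pred_confused_a[OF ma mb, unfolded T_def]])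
  fix \<omega> assume \<omega>: "\<omega> \<in> space (omega Q v N)"
  show "emeasure (Ca \<Otimes>\<^sub>M Cb) {c \<in> space (Ca \<Otimes>\<^sub>M Cb). confused_a ma mb (c, \<omega>)} \<le> ennreal (real Ma * real K1 * q1)"
  proof (rule emeasure_pair_le_snd[OF prob_Ca prob_Cb pred_section_snd[OF pred_confused_a[OF ma mb, unfolded T_def] \<omega>]])
    fix cb
    define R where "R ca u \<longleftrightarrow> sqn N (\<lambda>i. u i - \<alpha>1 * Y ca cb ma mb (fst \<omega>) (snd \<omega>) i) \<le> real N * r1" for ca and u :: "nat \<Rightarrow> real"
    note cmCa = code_measurable_PiM[of Ma K1 N L]
    have "emeasure (PiM ({..<Ma} \<times> {..<K1}) (\<lambda>_. ucube N L))
       {c \<in> space (PiM ({..<Ma} \<times> {..<K1}) (\<lambda>_. ucube N L)). \<exists>m'<Ma. m' \<noteq> ma \<and> (\<exists>k<K1. R c (c (m', k)))} \<le> ennreal (real Ma * real K1 * q1)"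
    proof (rule packing_failure[OF prob_space_ucube[OF L] ma])
      fix j assume j: "j \<in> {..<Ma} \<times> {..<K1}"
      then obtain m k where jmk: "j = (m, k)" "m < Ma" "k < K1" by auto
      show "Measurable.pred (PiM ({..<Ma} \<times> {..<K1}) (\<lambda>_. ucube N L)) (\<lambda>c. R c (c j))"
        unfolding R_def jmk(1)
        by (intro pred_le_const vec_ip_measurable vec_measurable_affine Y_measurable vec_measurable_code[OF cmCa]
           cmCa code_measurable_const vec_measurable_const ma mb jmk)
    next
      fix c :: "nat \<times> nat \<Rightarrow> nat \<Rightarrow> real" and m' k u u' assume ne: "m' \<noteq> ma"
      show "R (c((m', k) := u')) u = R c u" unfolding R_def Y_def Z_def by (simp only: X_upd[OF ne])
    next
      fix c
      show "emeasure (ucube N L) {u \<in> space (ucube N L). R c u} \<le> ennreal q1"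
        unfolding R_def q1_def by (rule residual_ball_prob[OF r_pos(1)])
    qed (rule nonneg_pq)
    then show "emeasure Ca {ca \<in> space Ca. confused_a ma mb ((ca, cb), \<omega>)} \<le> ennreal (real Ma * real K1 * q1)"
      unfolding Ca_def confused_a_def R_def by (simp add: Bex_def)
  qed
qed

lemma prob_confused_b:
  assumes ma: "ma < Ma" and mb: "mb < Mb"
  shows "emeasure T {x \<in> space T. confused_b ma mb x} \<le> ennreal (real Mb * real K2 * q2)"
  unfolding T_def
proof (rule emeasure_pair_le_snd[OF prob_Cab prob_O pred_confused_b[OF ma mb, unfolded T_def]])
  fix \<omega> assume \<omega>: "\<omega> \<in> space (omega Q v N)"
  show "emeasure (Ca \<Otimes>\<^sub>M Cb) {c \<in> space (Ca \<Otimes>\<^sub>M Cb). confused_b ma mb (c, \<omega>)} \<le> ennreal (real Mb * real K2 * q2)"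
  proof (rule emeasure_pair_le_fst[OF prob_Ca prob_Cb pred_section_snd[OF pred_confused_b[OF ma mb, unfolded T_def] \<omega>]])
    fix ca
    define R where "R cb u \<longleftrightarrow> sqn N (\<lambda>i. u i - \<alpha>2 * Y ca cb ma mb (fst \<omega>) (snd \<omega>) i) \<le> real N * r2" for cb and u :: "nat \<Rightarrow> real"
    note cmCb = code_measurable_PiM[of Mb K2 N L]
    have "emeasure (PiM ({..<Mb} \<times> {..<K2}) (\<lambda>_. ucube N L))
       {c \<in> space (PiM ({..<Mb} \<times> {..<K2}) (\<lambda>_. ucube N L)). \<exists>m'<Mb. m' \<noteq> mb \<and> (\<exists>k<K2. R c (c (m', k)))} \<le> ennreal (real Mb * real K2 * q2)"
    proof (rule packing_failure[OF prob_space_ucube[OF L] mb])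
      fix j assume j: "j \<in> {..<Mb} \<times> {..<K2}"
      then obtain m k where jmk: "j = (m, k)" "m < Mb" "k < K2" by auto
      show "Measurable.pred (PiM ({..<Mb} \<times> {..<K2}) (\<lambda>_. ucube N L)) (\<lambda>c. R c (c j))"
        unfolding R_def jmk(1)
        by (intro pred_le_const vec_ip_measurable vec_measurable_affine Y_measurable vec_measurable_code[OF cmCb]
           cmCb code_measurable_const vec_measurable_const ma mb jmk)
    next
      fix c :: "nat \<times> nat \<Rightarrow> nat \<Rightarrow> real" and m' k u u' assume ne: "m' \<noteq> mb"
      show "R (c((m', k) := u')) u = R c u" unfolding R_def Y_def by (simp only: Z_upd[OF ne])
    next
      fix c
      show "emeasure (ucube N L) {u \<in> space (ucube N L). R c u} \<le> ennreal q2"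
        unfolding R_def q2_def by (rule residual_ball_prob[OF r_pos(2)])
    qed (rule nonneg_pq)
    then show "emeasure Cb {cb \<in> space Cb. confused_b ma mb ((ca, cb), \<omega>)} \<le> ennreal (real Mb * real K2 * q2)"
      unfolding Cb_def confused_b_def R_def by (simp add: Bex_def)
  qed
qed

section \<open>Union bound over the error events\<close>

lemma prob_noise_event:
  assumes "Measurable.pred T P"
    and "\<And>c s. emeasure (gaussN N v) {e \<in> space (gaussN N v). P (c, s, e)} \<le> b"
  shows "emeasure T {x \<in> space T. P x} \<le> b"
  unfolding T_def
proof (rule emeasure_pair_le_fst[OF prob_Cab prob_O assms(1)[unfolded T_def]])
  fix c assume c: "c \<in> space (Ca \<Otimes>\<^sub>M Cb)"
  show "emeasure (omega Q v N) {\<omega> \<in> space (omega Q v N). P (c, \<omega>)} \<le> b"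
    unfolding omega_def
    by (rule emeasure_pair_le_fst[OF prob_space_PiM_gauss[OF Q] prob_space_PiM_gauss[OF v]
        pred_section_fst[OF assms(1)[unfolded T_def] c, unfolded omega_def]]) (rule assms(2))
qed

lemma prob_state_event:
  assumes "Measurable.pred T (\<lambda>x. P (fst (snd x)))"
    and "emeasure (gaussN N Q) {s \<in> space (gaussN N Q). P s} \<le> b"
  shows "emeasure T {x \<in> space T. P (fst (snd x))} \<le> b"
  unfolding T_def
proof (rule emeasure_pair_le_fst[OF prob_Cab prob_O assms(1)[unfolded T_def]])
  fix c assume c: "c \<in> space (Ca \<Otimes>\<^sub>M Cb)"
  show "emeasure (omega Q v N) {\<omega> \<in> space (omega Q v N). P (fst (snd (c, \<omega>)))} \<le> b"
    unfolding omega_def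
    by (rule emeasure_pair_le_snd[OF prob_space_PiM_gauss[OF Q] prob_space_PiM_gauss[OF v]
        pred_section_fst[OF assms(1)[unfolded T_def] c, unfolded omega_def]]) (simp add: assms(2))
qed

text \<open>Bundles measurability with the bound, so that the union bound becomes one composable
  rule.\<close>

definition "rare P b \<longleftrightarrow> Measurable.pred T P \<and> b \<ge> 0 \<and> emeasure T {x \<in> space T. P x} \<le> ennreal b"
  for P :: "((nat \<times> nat \<Rightarrow> nat \<Rightarrow> real) \<times> (nat \<times> nat \<Rightarrow> nat \<Rightarrow> real)) \<times> (nat \<Rightarrow> real) \<times> (nat \<Rightarrow> real) \<Rightarrow> bool"

lemma rare_disj:
  assumes "rare P a" "rare R b"
  shows "rare (\<lambda>x. P x \<or> R x) (a + b)"
proof -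
  have "emeasure T {x \<in> space T. P x \<or> R x} = emeasure T ({x \<in> space T. P x} \<union> {x \<in> space T. R x})"
    by (intro arg_cong[where f="emeasure T"]) auto
  also have "\<dots> \<le> emeasure T {x \<in> space T. P x} + emeasure T {x \<in> space T. R x}"
    using assms by (intro emeasure_subadditive) (simp_all add: rare_def pred_def)
  also have "\<dots> \<le> ennreal a + ennreal b" using assms by (intro add_mono) (simp_all add: rare_def)
  also have "\<dots> = ennreal (a + b)" using assms by (simp add: rare_def ennreal_plus)
  finally show ?thesis using assms unfolding rare_def by (auto intro: pred_intros_logic(5))
qed

definition "bad ma mb x \<longleftrightarrow> (let y = Y (fst (fst x)) (snd (fst x)) ma mb (fst (snd x)) (snd (snd x)) in
   deca (fst (fst x)) y \<noteq> ma \<or> decb (snd (fst x)) y \<noteq> mb)"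

lemma pred_ne: "f \<in> measurable S (count_space UNIV) \<Longrightarrow> Measurable.pred S (\<lambda>x. f x \<noteq> (c::nat))"
  by measurable

lemma pred_bad: "ma < Ma \<Longrightarrow> mb < Mb \<Longrightarrow> Measurable.pred T (bad ma mb)"
  unfolding bad_def[abs_def] Let_def
  by (intro pred_intros_logic(5) pred_ne deca_measurable decb_measurable Y_measurable cm_T)

text \<open>One summand per event, in the order and nesting of the disjunction \<open>E\<close> in
  the proof of \<open>rare_bad\<close>.\<close>

definition "err_bound e0 = e0 + exp (- (K1 * p1)) + exp (- (K2 * p2)) + 2 * real N * v\<^sup>2 / (real N * \<delta>)\<^sup>2
  + real N * (A + \<delta>) * v / (real N * \<delta>)\<^sup>2 + real N * (B + \<delta>) * v / (real N * \<delta>)\<^sup>2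
  + real Ma * real K1 * q1 + real Mb * real K2 * q2"

lemma pred_const_le_abs:
  assumes "f \<in> borel_measurable S"
  shows "Measurable.pred S (\<lambda>x. (c::real) \<le> \<bar>f x\<bar>)" "Measurable.pred S (\<lambda>x. (c::real) \<le> \<bar>f x - a\<bar>)"
  using assms by measurable

lemma rare_bad:
  assumes ma: "ma < Ma" and mb: "mb < Mb" and e0: "e0 \<ge> 0"
    and state: "emeasure (gaussN N Q) {s \<in> space (gaussN N Q). \<not> (\<forall>i\<in>{..<N}. \<bar>s i\<bar> \<le> L0)} \<le> ennreal e0"
  shows "emeasure T {x \<in> space T. bad ma mb x} \<le> ennreal (err_bound e0)"
proof -
  have Nd: "real N * \<delta> > 0" using N \<delta> by simp
  let ?X = "\<lambda>x. X (fst (fst x)) ma (fst (snd x))"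
  let ?Z = "\<lambda>x. Z (fst (fst x)) (snd (fst x)) ma mb (fst (snd x))"
  have 1: "rare (\<lambda>x. \<not> (\<forall>i\<in>{..<N}. \<bar>fst (snd x) i\<bar> \<le> L0)) e0"
    unfolding rare_def using e0 prob_state_event[OF pred_intros_logic(2)[OF pred_state_box] state]
      pred_intros_logic(2)[OF pred_state_box] by blast
  have 2: "rare (uncovered_a ma) (exp (- (K1 * p1)))"
    unfolding rare_def using prob_uncovered_a[OF ma] pred_uncovered_a[OF ma] by simp
  have 3: "rare (uncovered_b ma mb) (exp (- (K2 * p2)))"
    unfolding rare_def using prob_uncovered_b[OF ma mb] pred_uncovered_b[OF ma mb] by simp
  have m4: "Measurable.pred T (\<lambda>x. real N * \<delta> \<le> \<bar>sqn N (snd (snd x)) - real N * v\<bar>)"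
    by (intro pred_const_le_abs vec_ip_measurable cm_T)
  have 4: "rare (\<lambda>x. real N * \<delta> \<le> \<bar>sqn N (snd (snd x)) - real N * v\<bar>) (2 * real N * v\<^sup>2 / (real N * \<delta>)\<^sup>2)"
    unfolding rare_def
  proof (intro conjI m4 prob_noise_event[OF m4])
    show "emeasure (gaussN N v) {e \<in> space (gaussN N v). real N * \<delta> \<le> \<bar>sqn N (snd (snd (c, s, e))) - real N * v\<bar>}
       \<le> ennreal (2 * real N * v\<^sup>2 / (real N * \<delta>)\<^sup>2)" for c :: "(nat \<times> nat \<Rightarrow> nat \<Rightarrow> real) \<times> (nat \<times> nat \<Rightarrow> nat \<Rightarrow> real)" and s :: "nat \<Rightarrow> real"
      unfolding snd_conv by (rule gauss_norm_concentration[OF v Nd])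
  qed simp
  have ipb: "emeasure (gaussN N v) {e \<in> space (gaussN N v). real N * \<delta> \<le> \<bar>ip N g e\<bar>}
      \<le> ennreal (real N * a * v / (real N * \<delta>)\<^sup>2)" if "sqn N g \<le> real N * a" for g a
    by (rule order_trans[OF gauss_ip_concentration[OF v Nd]])
      (use that v in \<open>intro ennreal_leI divide_right_mono mult_right_mono; simp\<close>)
  have m5: "Measurable.pred T (\<lambda>x. real N * \<delta> \<le> \<bar>ip N (?X x) (snd (snd x))\<bar>)"
    by (intro pred_const_le_abs vec_ip_measurable X_measurable cm_T ma)
  have 5: "rare (\<lambda>x. real N * \<delta> \<le> \<bar>ip N (?X x) (snd (snd x))\<bar>) (real N * (A + \<delta>) * v / (real N * \<delta>)\<^sup>2)"
    unfolding rare_def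
  proof (intro conjI m5 prob_noise_event[OF m5])
    show "0 \<le> real N * (A + \<delta>) * v / (real N * \<delta>)\<^sup>2" using A v \<delta> by simp
  qed (unfold fst_conv snd_conv, rule ipb, rule X_bound)
  have m6: "Measurable.pred T (\<lambda>x. real N * \<delta> \<le> \<bar>ip N (?Z x) (snd (snd x))\<bar>)"
    by (intro pred_const_le_abs vec_ip_measurable Z_measurable cm_T ma mb)
  have 6: "rare (\<lambda>x. real N * \<delta> \<le> \<bar>ip N (?Z x) (snd (snd x))\<bar>) (real N * (B + \<delta>) * v / (real N * \<delta>)\<^sup>2)"
    unfolding rare_def
  proof (intro conjI m6 prob_noise_event[OF m6])
    show "0 \<le> real N * (B + \<delta>) * v / (real N * \<delta>)\<^sup>2" using B v \<delta> by simp
  qed (unfold fst_conv snd_conv, rule ipb, rule Z_bound)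
  have 7: "rare (confused_a ma mb) (real Ma * real K1 * q1)"
    unfolding rare_def using prob_confused_a[OF ma mb] pred_confused_a[OF ma mb] nonneg_pq by simp
  have 8: "rare (confused_b ma mb) (real Mb * real K2 * q2)"
    unfolding rare_def using prob_confused_b[OF ma mb] pred_confused_b[OF ma mb] nonneg_pq by simp
  define E where "E x \<longleftrightarrow> (((((((\<not> (\<forall>i\<in>{..<N}. \<bar>fst (snd x) i\<bar> \<le> L0)) \<or> uncovered_a ma x) \<or> uncovered_b ma mb x)
     \<or> real N * \<delta> \<le> \<bar>sqn N (snd (snd x)) - real N * v\<bar>) \<or> real N * \<delta> \<le> \<bar>ip N (?X x) (snd (snd x))\<bar>)
     \<or> real N * \<delta> \<le> \<bar>ip N (?Z x) (snd (snd x))\<bar>) \<or> confused_a ma mb x) \<or> confused_b ma mb x" for x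
  have E: "rare E (err_bound e0)"
    unfolding err_bound_def E_def[abs_def] by (intro rare_disj 1 2 3 4 5 6 7 8)
  \<comment> \<open>Outside \<open>E\<close> both searches succeed, both true bins pass the residual
    test, and no other bin does. Each decoder works from \<open>Y\<close> alone; neither uses the
    other's decision.\<close>
  have "\<not> bad ma mb x" if "\<not> E x" for x
  proof -
    obtain ca cb s e where x: "x = ((ca, cb), (s, e))" by (metis prod.exhaust)
    have n: "sqn N e \<le> real N * (v + \<delta>)" "\<bar>ip N (X ca ma s) e\<bar> \<le> real N * \<delta>" "\<bar>ip N (Z ca cb ma mb s) e\<bar> \<le> real N * \<delta>"
      using that unfolding E_def x by (auto simp: abs_if algebra_simps not_le split: if_splits)
    have a: "\<exists>k<K1. sqn N (\<lambda>i. ca (ma, k) i - \<alpha>1 * Y ca cb ma mb s e i) \<le> real N * r1"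
      by (rule residual_a[OF _ n]) (use that in \<open>auto simp: E_def x uncovered_a_def\<close>)
    have b: "\<exists>k<K2. sqn N (\<lambda>i. cb (mb, k) i - \<alpha>2 * Y ca cb ma mb s e i) \<le> real N * r2"
      by (rule residual_b[OF _ n(1,3)]) (use that in \<open>auto simp: E_def x uncovered_b_def\<close>)
    have ca: "\<not> (\<exists>m'<Ma. m' \<noteq> ma \<and> (\<exists>k<K1. sqn N (\<lambda>i. ca (m', k) i - \<alpha>1 * Y ca cb ma mb s e i) \<le> real N * r1))"
      using that by (auto simp: E_def x confused_a_def)
    have cb: "\<not> (\<exists>m'<Mb. m' \<noteq> mb \<and> (\<exists>k<K2. sqn N (\<lambda>i. cb (m', k) i - \<alpha>2 * Y ca cb ma mb s e i) \<le> real N * r2))"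
      using that by (auto simp: E_def x confused_b_def)
    have "deca ca (Y ca cb ma mb s e) = ma" unfolding deca_def using a bin_dec_eq[OF ma _ _ ca] by blast
    moreover have "decb cb (Y ca cb ma mb s e) = mb" unfolding decb_def using b bin_dec_eq[OF mb _ _ cb] by blast
    ultimately show ?thesis by (simp add: bad_def x)
  qed
  then have "{x \<in> space T. bad ma mb x} \<subseteq> {x \<in> space T. E x}" by blast
  moreover have "{x \<in> space T. E x} \<in> sets T" using E by (simp add: rare_def pred_def)
  ultimately have "emeasure T {x \<in> space T. bad ma mb x} \<le> emeasure T {x \<in> space T. E x}" by (rule emeasure_mono)
  also have "\<dots> \<le> ennreal (err_bound e0)" using E by (simp add: rare_def)
  finally show ?thesis .
qed

end

section \<open>Codes for the channel\<close>


lemma bin_dec_cong: "(\<And>i. i < N \<Longrightarrow> y i = y' i) \<Longrightarrow> bin_dec N M K r \<alpha> c y = bin_dec N M K r \<alpha> c y'"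
proof -
  assume "\<And>i. i < N \<Longrightarrow> y i = y' i"
  then have "sqn N (\<lambda>i. c (m, k) i - \<alpha> * y i) = sqn N (\<lambda>i. c (m, k) i - \<alpha> * y' i)" for m k
    by (intro ip_cong) auto
  then show ?thesis unfolding bin_dec_def by simp
qed

lemma emeasure_omega_state0:
  assumes Q: "Q > 0" and v: "v > 0" and N: "N \<ge> 1" and D: "D \<in> sets borel"
  shows "{\<omega> \<in> space (omega Q v N). fst \<omega> 0 \<in> D} \<in> sets (omega Q v N)"
    "emeasure (omega Q v N) {\<omega> \<in> space (omega Q v N). fst \<omega> 0 \<in> D} = emeasure (gauss Q) D"
proof -
  interpret S: prob_space "gaussN N Q" by (rule prob_space_PiM_gauss[OF Q])
  interpret E: prob_space "gaussN N v" by (rule prob_space_PiM_gauss[OF v])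
  interpret G: prob_space "gauss Q" by (rule prob_space_gauss[OF Q])
  interpret product_prob_space "\<lambda>_. gauss Q" "{..<N}" by unfold_locales
  have S: "{s \<in> space (gaussN N Q). s 0 \<in> D} \<in> sets (gaussN N Q)"
    using measurable_sets[OF measurable_component_singleton[of 0 "{..<N}" "\<lambda>_. gauss Q"], of D] N D
    by (simp add: vimage_def Int_def conj_commute)
  have eq: "{\<omega> \<in> space (omega Q v N). fst \<omega> 0 \<in> D}
     = {s \<in> space (gaussN N Q). s 0 \<in> D} \<times> space (gaussN N v)"
    by (auto simp: omega_def space_pair_measure)
  show "{\<omega> \<in> space (omega Q v N). fst \<omega> 0 \<in> D} \<in> sets (omega Q v N)"
    unfolding eq unfolding omega_def using S by (intro pair_measureI) auto
  show "emeasure (omega Q v N) {\<omega> \<in> space (omega Q v N). fst \<omega> 0 \<in> D} = emeasure (gauss Q) D"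
    unfolding eq unfolding omega_def
    using S N D by (subst E.emeasure_pair_measure_Times) (auto simp: E.emeasure_space_1 emeasure_PiM_Collect_single)
qed

abbreviation nofb_code ::
  "real \<Rightarrow> real \<Rightarrow> real \<Rightarrow> real \<Rightarrow> nat \<Rightarrow> nat \<Rightarrow> nat \<Rightarrow> real \<Rightarrow> (nat \<Rightarrow> nat \<Rightarrow> (nat \<Rightarrow> real) \<Rightarrow> real)
   \<Rightarrow> (nat \<Rightarrow> nat \<Rightarrow> nat \<Rightarrow> (nat \<Rightarrow> real) \<Rightarrow> real) \<Rightarrow> ((nat \<Rightarrow> real) \<Rightarrow> nat \<times> nat) \<Rightarrow> bool" where
  "nofb_code P1 P2 Q v N M1 M2 eps g1 g2 dec \<equiv>
     good_code P1 P2 Q v N M1 M2 eps (\<lambda>i w1 s y. g1 i w1 s) (\<lambda>i w1 w2 s y. g2 i w1 w2 s) dec"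

lemma good_codeI:
  fixes dec :: "(nat \<Rightarrow> real) \<Rightarrow> nat \<times> nat"
  assumes Q: "Q > 0" and v: "v > 0"
    and m1: "\<And>w1 w2 i. w1 \<in> {1..M1} \<Longrightarrow> w2 \<in> {1..M2} \<Longrightarrow> i < N \<Longrightarrow> (\<lambda>\<omega>. g1 i w1 (fst \<omega>)) \<in> borel_measurable (omega Q v N)"
    and m2: "\<And>w1 w2 i. w1 \<in> {1..M1} \<Longrightarrow> w2 \<in> {1..M2} \<Longrightarrow> i < N \<Longrightarrow> (\<lambda>\<omega>. g2 i w1 w2 (fst \<omega>)) \<in> borel_measurable (omega Q v N)"
    and err: "\<And>w1 w2. w1 \<in> {1..M1} \<Longrightarrow> w2 \<in> {1..M2} \<Longrightarrow>
       {\<omega> \<in> space (omega Q v N). dec (yseq (\<lambda>i w1 s y. g1 i w1 s) (\<lambda>i w1 w2 s y. g2 i w1 w2 s) w1 w2 (fst \<omega>) (snd \<omega>) N) \<noteq> (w1, w2)} \<in> sets (omega Q v N)"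
    and p1: "\<And>w1 w2. w1 \<in> {1..M1} \<Longrightarrow> w2 \<in> {1..M2} \<Longrightarrow> (\<integral>\<^sup>+ \<omega>. (\<Sum>i<N. ennreal ((g1 i w1 (fst \<omega>))\<^sup>2)) \<partial>omega Q v N) \<le> ennreal (real N * P1)"
    and p2: "\<And>w1 w2. w1 \<in> {1..M1} \<Longrightarrow> w2 \<in> {1..M2} \<Longrightarrow> (\<integral>\<^sup>+ \<omega>. (\<Sum>i<N. ennreal ((g2 i w1 w2 (fst \<omega>))\<^sup>2)) \<partial>omega Q v N) \<le> ennreal (real N * P2)"
    and P: "P1 \<ge> 0" "P2 \<ge> 0"
    and e: "(\<Sum>w1\<in>{1..M1}. \<Sum>w2\<in>{1..M2}. measure (omega Q v N)
       {\<omega> \<in> space (omega Q v N). dec (yseq (\<lambda>i w1 s y. g1 i w1 s) (\<lambda>i w1 w2 s y. g2 i w1 w2 s) w1 w2 (fst \<omega>) (snd \<omega>) N) \<noteq> (w1, w2)})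
       / (real M1 * real M2) \<le> eps"
  shows "nofb_code P1 P2 Q v N M1 M2 eps g1 g2 dec"
proof -
  have swap: "(\<Sum>i<N. \<Sum>w1\<in>{1..M1}. \<Sum>w2\<in>{1..M2}. \<integral>\<^sup>+ \<omega>. ennreal ((F i w1 w2 \<omega>)\<^sup>2) \<partial>omega Q v N) \<le> ennreal (real N * real M1 * real M2 * P)"
    if m: "\<And>w1 w2 i. w1 \<in> {1..M1} \<Longrightarrow> w2 \<in> {1..M2} \<Longrightarrow> i < N \<Longrightarrow> F i w1 w2 \<in> borel_measurable (omega Q v N)"
      and p: "\<And>w1 w2. w1 \<in> {1..M1} \<Longrightarrow> w2 \<in> {1..M2} \<Longrightarrow> (\<integral>\<^sup>+ \<omega>. (\<Sum>i<N. ennreal ((F i w1 w2 \<omega>)\<^sup>2)) \<partial>omega Q v N) \<le> ennreal (real N * P)"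
      and "P \<ge> 0" for F P
  proof -
    have "(\<Sum>i<N. \<Sum>w1\<in>{1..M1}. \<Sum>w2\<in>{1..M2}. \<integral>\<^sup>+ \<omega>. ennreal ((F i w1 w2 \<omega>)\<^sup>2) \<partial>omega Q v N)
       = (\<Sum>w1\<in>{1..M1}. \<Sum>w2\<in>{1..M2}. \<Sum>i<N. \<integral>\<^sup>+ \<omega>. ennreal ((F i w1 w2 \<omega>)\<^sup>2) \<partial>omega Q v N)"
      by (subst sum.swap, rule sum.cong[OF refl], rule sum.swap)
    also have "\<dots> = (\<Sum>w1\<in>{1..M1}. \<Sum>w2\<in>{1..M2}. \<integral>\<^sup>+ \<omega>. (\<Sum>i<N. ennreal ((F i w1 w2 \<omega>)\<^sup>2)) \<partial>omega Q v N)"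
    proof (intro sum.cong refl nn_integral_sum[symmetric])
      fix w1 w2 i assume "w1 \<in> {1..M1}" "w2 \<in> {1..M2}" "i \<in> {..<N}"
      then have [measurable]: "F i w1 w2 \<in> borel_measurable (omega Q v N)" using m by blast
      show "(\<lambda>\<omega>. ennreal ((F i w1 w2 \<omega>)\<^sup>2)) \<in> borel_measurable (omega Q v N)" by measurable
    qed
    also have "\<dots> \<le> (\<Sum>w1\<in>{1..M1}. \<Sum>w2\<in>{1..M2}. ennreal (real N * P))" by (intro sum_mono p)
    also have "\<dots> = ennreal (real M1 * (real M2 * (real N * P)))"
      using \<open>P \<ge> 0\<close> by (simp add: ennreal_of_nat_eq_real_of_nat ennreal_mult[symmetric])
    finally show ?thesis by (simp add: mult_ac)
  qed
  have s1: "(\<Sum>i<N. \<Sum>w1\<in>{1..M1}. \<Sum>w2\<in>{1..M2}. \<integral>\<^sup>+ \<omega>. ennreal ((g1 i w1 (fst \<omega>))\<^sup>2) \<partial>omega Q v N) \<le> ennreal (real N * real M1 * real M2 * P1)"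
    by (rule swap[where F="\<lambda>i w1 w2 \<omega>. g1 i w1 (fst \<omega>)"]) (blast intro: m1 p1 P)+
  have s2: "(\<Sum>i<N. \<Sum>w1\<in>{1..M1}. \<Sum>w2\<in>{1..M2}. \<integral>\<^sup>+ \<omega>. ennreal ((g2 i w1 w2 (fst \<omega>))\<^sup>2) \<partial>omega Q v N) \<le> ennreal (real N * real M1 * real M2 * P2)"
    by (rule swap[where F="\<lambda>i w1 w2 \<omega>. g2 i w1 w2 (fst \<omega>)"]) (blast intro: m2 p2 P)+
  show ?thesis
    unfolding good_code_def Let_def
    by (intro conjI ballI allI impI s1 s2 e m1 m2 err)
qed

context two_stage
begin

abbreviation "\<Omega> \<equiv> omega Q v N"

text \<open>The probabilistic method, applied to the error summed over all messages, so that one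
  pair of codebooks serves the average error. Strictness of \<open>small\<close> excludes that every
  pair exceeds the mean.\<close>

lemma exists_codebook:
  fixes \<eta> :: real
  assumes W: "finite W" "W \<noteq> {}" and idx: "\<And>w. w \<in> W \<Longrightarrow> a w < Ma \<and> b w < Mb"
    and e0: "e0 \<ge> 0"
    and state: "emeasure (gaussN N Q) {s \<in> space (gaussN N Q). \<not> (\<forall>i\<in>{..<N}. \<bar>s i\<bar> \<le> L0)} \<le> ennreal e0"
    and small: "err_bound e0 < \<eta>"
  obtains ca cb where "(\<Sum>w\<in>W. measure \<Omega> {\<omega> \<in> space \<Omega>. bad (a w) (b w) ((ca, cb), \<omega>)}) \<le> card W * \<eta>"
    "\<And>w. w \<in> W \<Longrightarrow> {\<omega> \<in> space \<Omega>. bad (a w) (b w) ((ca, cb), \<omega>)} \<in> sets \<Omega>"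
proof -
  interpret O: prob_space "\<Omega>" by (rule prob_O)
  interpret C: prob_space "Ca \<Otimes>\<^sub>M Cb" by (rule prob_Cab)
  define f where "f w c = emeasure \<Omega> {\<omega> \<in> space \<Omega>. bad (a w) (b w) (c, \<omega>)}" for w c
  have e_nonneg: "err_bound e0 \<ge> 0"
    unfolding err_bound_def using e0 nonneg_pq A B v \<delta> by (intro add_nonneg_nonneg) auto
  have E: "{x \<in> space T. bad (a w) (b w) x} \<in> sets ((Ca \<Otimes>\<^sub>M Cb) \<Otimes>\<^sub>M \<Omega>)" if "w \<in> W" for w
    using pred_bad[of "a w" "b w"] idx[OF that] by (simp add: pred_def T_def)
  have sec: "Pair c -` {x \<in> space T. bad (a w) (b w) x} = {\<omega> \<in> space \<Omega>. bad (a w) (b w) (c, \<omega>)}" if "c \<in> space (Ca \<Otimes>\<^sub>M Cb)" for c w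
    using that by (auto simp: T_def space_pair_measure)
  have fm: "f w \<in> borel_measurable (Ca \<Otimes>\<^sub>M Cb)" if "w \<in> W" for w
  proof -
    have "f w c = emeasure \<Omega> (Pair c -` {x \<in> space T. bad (a w) (b w) x})" if "c \<in> space (Ca \<Otimes>\<^sub>M Cb)" for c
      by (simp only: f_def sec[OF that])
    then show ?thesis using O.measurable_emeasure_Pair[OF E[OF that]] by (subst measurable_cong)
  qed
  have fi: "(\<integral>\<^sup>+ c. f w c \<partial>(Ca \<Otimes>\<^sub>M Cb)) \<le> ennreal (err_bound e0)" if "w \<in> W" for w
  proof -
    have "(\<integral>\<^sup>+ c. f w c \<partial>(Ca \<Otimes>\<^sub>M Cb)) = (\<integral>\<^sup>+ c. emeasure \<Omega> (Pair c -` {x \<in> space T. bad (a w) (b w) x}) \<partial>(Ca \<Otimes>\<^sub>M Cb))"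
      by (intro nn_integral_cong) (simp only: f_def sec)
    also have "\<dots> = emeasure T {x \<in> space T. bad (a w) (b w) x}"
      using O.emeasure_pair_measure_alt[OF E[OF that]] by (simp add: T_def)
    also have "\<dots> \<le> ennreal (err_bound e0)" using rare_bad[OF _ _ e0 state] idx[OF that] by blast
    finally show ?thesis .
  qed
  have "\<exists>c\<in>space (Ca \<Otimes>\<^sub>M Cb). (\<Sum>w\<in>W. f w c) \<le> ennreal (card W * \<eta>)"
  proof (rule ccontr)
    assume "\<not> ?thesis"
    then have "ennreal (card W * \<eta>) \<le> (\<Sum>w\<in>W. f w c)" if "c \<in> space (Ca \<Otimes>\<^sub>M Cb)" for c
      using that by (meson less_imp_le not_le)
    then have "(\<integral>\<^sup>+ c. ennreal (card W * \<eta>) \<partial>(Ca \<Otimes>\<^sub>M Cb)) \<le> (\<integral>\<^sup>+ c. (\<Sum>w\<in>W. f w c) \<partial>(Ca \<Otimes>\<^sub>M Cb))"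
      by (intro nn_integral_mono)
    also have "\<dots> = (\<Sum>w\<in>W. \<integral>\<^sup>+ c. f w c \<partial>(Ca \<Otimes>\<^sub>M Cb))" by (intro nn_integral_sum fm)
    also have "\<dots> \<le> (\<Sum>w\<in>W. ennreal (err_bound e0))" by (intro sum_mono fi)
    also have "\<dots> = ennreal (card W * err_bound e0)"
      using e_nonneg by (simp add: ennreal_mult ennreal_of_nat_eq_real_of_nat)
    finally have "ennreal (card W * \<eta>) \<le> ennreal (card W * err_bound e0)" by (simp add: C.emeasure_space_1)
    then have "card W * \<eta> \<le> card W * err_bound e0" using e_nonneg by (subst (asm) ennreal_le_iff) auto
    then show False using small W by (simp add: card_gt_0_iff)
  qed
  then obtain c where c: "c \<in> space (Ca \<Otimes>\<^sub>M Cb)" and le: "(\<Sum>w\<in>W. f w c) \<le> ennreal (card W * \<eta>)" by blast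
  have "ennreal (\<Sum>w\<in>W. measure \<Omega> {\<omega> \<in> space \<Omega>. bad (a w) (b w) (c, \<omega>)}) \<le> ennreal (card W * \<eta>)"
    using le by (simp add: f_def O.emeasure_eq_measure sum_ennreal)
  then have 1: "(\<Sum>w\<in>W. measure \<Omega> {\<omega> \<in> space \<Omega>. bad (a w) (b w) (c, \<omega>)}) \<le> card W * \<eta>"
    using e_nonneg small by (subst (asm) ennreal_le_iff) auto
  have "{\<omega> \<in> space \<Omega>. bad (a w) (b w) (c, \<omega>)} \<in> sets \<Omega>" if "w \<in> W" for w
    using sets_Pair1[OF E[OF that], of c] by (simp only: sec[OF c])
  then show ?thesis using that[of "fst c" "snd c"] 1 by simp
qed

text \<open>On the event that the first state letter exceeds \<open>\<tau>\<close> both encoders stay silent.  The power saved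
  there is what makes the boundary of the rate region achievable.\<close>
lemma good_code_exists:
  assumes M: "M1 \<ge> 1" "M2 \<ge> 1" "Ma \<ge> 1" and split: "M1 \<le> Ma * Kb" "Mb = Kb * M2"
    and e0: "e0 \<ge> 0"
    and state: "emeasure (gaussN N Q) {s \<in> space (gaussN N Q). \<not> (\<forall>i\<in>{..<N}. \<bar>s i\<bar> \<le> L0)} \<le> ennreal e0"
    and p: "p = measure (gauss Q) {\<tau><..}" and small: "err_bound e0 < eps - p"
    and c: "c1 \<ge> 0" "c2 \<ge> 0" "c1 + c2 = 1"
    and P1: "c1\<^sup>2 * (A + \<delta>) * (1 - p) \<le> P1"
    and P2: "(c2\<^sup>2 * (A + \<delta>) + (B + \<delta>) + 2 * c2 * \<delta>) * (1 - p) \<le> P2"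
  shows "\<exists>g1 g2 dec. nofb_code P1 P2 Q v N M1 M2 eps g1 g2 dec"
proof -
  interpret O: prob_space "\<Omega>" by (rule prob_O)
  interpret G: prob_space "gauss Q" by (rule prob_space_gauss[OF Q])
  \<comment> \<open>Messages start at 1, bins at 0. The remainder modulo \<open>Ma\<close> goes into
    the common word; the quotient is joined with \<open>w2\<close> as the leading digit of encoder
    2's index.\<close>
  define a where "a w1 = (w1 - 1) mod Ma" for w1 :: nat
  define b where "b w1 w2 = ((w1 - 1) div Ma) * M2 + (w2 - 1)" for w1 w2 :: nat
  define W where "W = {1..M1} \<times> {1..M2}"
  have W: "finite W" "W \<noteq> {}" "card W = M1 * M2" using M by (auto simp: W_def)
  have a: "a w1 < Ma" for w1 using M by (simp add: a_def)
  have b: "b w1 w2 < Mb" if "w1 \<in> {1..M1}" "w2 \<in> {1..M2}" for w1 w2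
  proof -
    have "w1 - 1 < Ma * Kb" using that split(1) by auto
    then have "(w1 - 1) div Ma < Kb" using M(3) by (simp add: less_mult_imp_div_less mult.commute)
    then have "Suc ((w1 - 1) div Ma) * M2 \<le> Kb * M2" by (intro mult_right_mono) auto
    moreover have "w2 - 1 < M2" using that(2) by auto
    ultimately show ?thesis unfolding b_def split(2) mult_Suc by linarith
  qed
  have ab: "a (fst w) < Ma \<and> b (fst w) (snd w) < Mb" if "w \<in> W" for w using a b that by (auto simp: W_def)
  obtain ca cb where total: "(\<Sum>w\<in>W. measure \<Omega> {\<omega> \<in> space \<Omega>. bad (a (fst w)) (b (fst w) (snd w)) ((ca, cb), \<omega>)}) \<le> card W * (eps - p)"
    and bad_sets: "\<And>w. w \<in> W \<Longrightarrow> {\<omega> \<in> space \<Omega>. bad (a (fst w)) (b (fst w) (snd w)) ((ca, cb), \<omega>)} \<in> sets \<Omega>"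
    using exists_codebook[where a="\<lambda>w. a (fst w)" and b="\<lambda>w. b (fst w) (snd w)", OF W(1,2) ab e0 state small] by blast
  let ?bad = "\<lambda>w1 w2. {\<omega> \<in> space \<Omega>. bad (a w1) (b w1 w2) ((ca, cb), \<omega>)}"
  \<comment> \<open>\<open>c1\<close> and \<open>c2\<close> are the encoders' shares of the
    amplitude of the common word; they add up to 1, so the channel receives exactly
    \<open>X\<close>.\<close>
  define g1 where "g1 i w1 s = (if s 0 \<le> \<tau> then c1 * X ca (a w1) s i else 0)" for i w1 s
  define g2 where "g2 i w1 w2 s = (if s 0 \<le> \<tau> then c2 * X ca (a w1) s i + Z ca cb (a w1) (b w1 w2) s i else 0)" for i w1 w2 s
  define dec where "dec y = (decb cb y div M2 * Ma + deca ca y + 1, decb cb y mod M2 + 1)" for y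
  have dec_ab: "dec y = (w1, w2)" if "deca ca y = a w1" "decb cb y = b w1 w2" "w1 \<in> {1..M1}" "w2 \<in> {1..M2}" for y w1 w2
  proof -
    have dm: "(d * M2 + x) div M2 = d" "(d * M2 + x) mod M2 = x" if "x < M2" for d x :: nat using that by simp_all
    have "w2 - 1 < M2" using that(4) by auto
    from dm[OF this] have 1: "b w1 w2 div M2 = (w1 - 1) div Ma" "b w1 w2 mod M2 = w2 - 1" unfolding b_def by blast+
    have "(w1 - 1) div Ma * Ma + (w1 - 1) mod Ma = w1 - 1" by (rule div_mult_mod_eq)
    then show ?thesis unfolding dec_def that(1,2) 1 using that(3,4) by (simp add: a_def)
  qed
  define ys where "ys w1 w2 \<omega> = yseq (\<lambda>i w1 s y. g1 i w1 s) (\<lambda>i w1 w2 s y. g2 i w1 w2 s) w1 w2 (fst \<omega>) (snd \<omega>) N" for w1 w2 \<omega>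
  let ?err = "\<lambda>w1 w2. {\<omega> \<in> space \<Omega>. dec (ys w1 w2 \<omega>) \<noteq> (w1, w2)}"
  have ys: "ys w1 w2 \<omega> i = g1 i w1 (fst \<omega>) + g2 i w1 w2 (fst \<omega>) + fst \<omega> i + snd \<omega> i" if "i < N" for w1 w2 \<omega> i
    unfolding ys_def yseq_eq_fseq using that by (simp add: fseq_at)
  have "Measurable.pred \<Omega> (\<lambda>\<omega>. fst \<omega> 0 \<in> {..\<tau>})"
    using emeasure_omega_state0(1)[OF Q v N, of "{..\<tau>}"] by (simp add: pred_def)
  then have S0[measurable]: "Measurable.pred \<Omega> (\<lambda>\<omega>. fst \<omega> 0 \<le> \<tau>)" by simp
  note O1 = vec_measurable_omega(1)[of Q v N]
  have Xm: "(\<lambda>\<omega>. X ca (a w1) (fst \<omega>) i) \<in> borel_measurable \<Omega>" if "i < N" for w1 i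
    using X_measurable[OF code_measurable_const a O1] that by (simp add: vec_measurable_def)
  have Zm: "(\<lambda>\<omega>. Z ca cb (a w1) (b w1 w2) (fst \<omega>) i) \<in> borel_measurable \<Omega>"
    if "i < N" "w1 \<in> {1..M1}" "w2 \<in> {1..M2}" for w1 w2 i
    using Z_measurable[OF code_measurable_const a code_measurable_const b[OF that(2,3)] O1] that(1) by (simp add: vec_measurable_def)
  have g1m: "(\<lambda>\<omega>. g1 i w1 (fst \<omega>)) \<in> borel_measurable \<Omega>" if "i < N" for w1 i
  proof -
    note [measurable] = Xm[OF that]
    show ?thesis unfolding g1_def by measurable
  qed
  have g2m: "(\<lambda>\<omega>. g2 i w1 w2 (fst \<omega>)) \<in> borel_measurable \<Omega>" if "i < N" "w1 \<in> {1..M1}" "w2 \<in> {1..M2}" for w1 w2 i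
  proof -
    note [measurable] = Xm[OF that(1)] Zm[OF that]
    show ?thesis unfolding g2_def by measurable
  qed
  have ysm: "vec_measurable \<Omega> N (ys w1 w2)" if w: "w1 \<in> {1..M1}" "w2 \<in> {1..M2}" for w1 w2
    unfolding vec_measurable_def
  proof (intro allI impI)
    fix i assume i: "i < N"
    note [measurable] = g1m[OF i] g2m[OF i w] noise_measurable[OF i]
    have "(\<lambda>\<omega>. g1 i w1 (fst \<omega>) + g2 i w1 w2 (fst \<omega>) + fst \<omega> i + snd \<omega> i) \<in> borel_measurable \<Omega>" by measurable
    then show "(\<lambda>\<omega>. ys w1 w2 \<omega> i) \<in> borel_measurable \<Omega>" using ys[OF i] by simp
  qed
  have err_sets: "?err w1 w2 \<in> sets \<Omega>"
    if w: "w1 \<in> {1..M1}" "w2 \<in> {1..M2}" for w1 w2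
  proof -
    have [measurable]: "(\<lambda>\<omega>. deca ca (ys w1 w2 \<omega>)) \<in> measurable \<Omega> (count_space UNIV)"
      "(\<lambda>\<omega>. decb cb (ys w1 w2 \<omega>)) \<in> measurable \<Omega> (count_space UNIV)"
      by (intro deca_measurable decb_measurable code_measurable_const ysm w)+
    \<comment> \<open>Quantifying over the two decoder values turns the error event into a countable
      union.\<close>
    have "Measurable.pred \<Omega> (\<lambda>\<omega>. \<exists>m n. deca ca (ys w1 w2 \<omega>) = m \<and> decb cb (ys w1 w2 \<omega>) = n
        \<and> (n div M2 * Ma + m + 1, n mod M2 + 1) \<noteq> (w1, w2))"
      by measurable
    then show ?thesis unfolding dec_def pred_def by simp
  qed
  let ?quiet = "{\<omega> \<in> space \<Omega>. fst \<omega> 0 \<in> {\<tau><..}}" and ?loud = "{\<omega> \<in> space \<Omega>. fst \<omega> 0 \<in> {..\<tau>}}"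
  have quiet: "?quiet \<in> sets \<Omega>"
      "measure \<Omega> ?quiet = p"
    using emeasure_omega_state0[OF Q v N, of "{\<tau><..}"] by (simp_all add: measure_def p)
  have err_le: "measure \<Omega> (?err w1 w2)
     \<le> p + measure \<Omega> (?bad w1 w2)"
    if w: "w1 \<in> {1..M1}" "w2 \<in> {1..M2}" for w1 w2
  proof -
    have bs: "?bad w1 w2 \<in> sets \<Omega>"
      using bad_sets[of "(w1, w2)"] w by (simp add: W_def)
    have good: "dec (ys w1 w2 \<omega>) = (w1, w2)" if "fst \<omega> 0 \<le> \<tau>" "\<not> bad (a w1) (b w1 w2) ((ca, cb), \<omega>)" for \<omega>
    proof -
      have eq: "ys w1 w2 \<omega> i = Y ca cb (a w1) (b w1 w2) (fst \<omega>) (snd \<omega>) i" if "i < N" for i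
      proof -
        have "c1 * x + c2 * x = x" for x using c(3) by (metis distrib_right mult_1)
        then show ?thesis using \<open>fst \<omega> 0 \<le> \<tau>\<close> by (simp add: ys[OF that] g1_def g2_def Y_def)
      qed
      have "deca ca (ys w1 w2 \<omega>) = deca ca (Y ca cb (a w1) (b w1 w2) (fst \<omega>) (snd \<omega>))"
        "decb cb (ys w1 w2 \<omega>) = decb cb (Y ca cb (a w1) (b w1 w2) (fst \<omega>) (snd \<omega>))"
        unfolding deca_def decb_def by (intro bin_dec_cong eq, assumption)+
      then show ?thesis using that(2) w by (intro dec_ab) (auto simp: bad_def Let_def)
    qed
    have "(?err w1 w2)
        \<subseteq> ?quiet \<union> (?bad w1 w2)"
    proof
      fix \<omega> assume "\<omega> \<in> (?err w1 w2)"
      then have \<omega>: "\<omega> \<in> space \<Omega>" "dec (ys w1 w2 \<omega>) \<noteq> (w1, w2)" by blast+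
      then have "\<tau> < fst \<omega> 0 \<or> bad (a w1) (b w1 w2) ((ca, cb), \<omega>)" using good[of \<omega>] not_le by blast
      then show "\<omega> \<in> ?quiet \<union> (?bad w1 w2)"
        unfolding Un_iff mem_Collect_eq greaterThan_iff using \<omega>(1) by blast
    qed
    then have "measure \<Omega> (?err w1 w2)
       \<le> measure \<Omega> (?quiet \<union> (?bad w1 w2))"
      by (intro O.finite_measure_mono sets.Un quiet bs)
    also have "\<dots> \<le> measure \<Omega> ?quiet + measure \<Omega> (?bad w1 w2)"
      by (intro measure_Un_le quiet bs)
    finally show ?thesis by (simp only: quiet(2))
  qed
  have p01: "0 \<le> p" "p \<le> 1" by (simp_all add: p)
  have loud: "?loud \<in> sets \<Omega>"
    "emeasure \<Omega> ?loud = ennreal (1 - p)"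
  proof -
    show "?loud \<in> sets \<Omega>"
      by (rule emeasure_omega_state0(1)[OF Q v N]) simp
    have "G.prob {..\<tau>} = 1 - p"
    proof -
      have "{..\<tau>} = space (gauss Q) - {\<tau><..}" by auto
      then show ?thesis unfolding p by (simp only: G.prob_compl sets_gauss borel_open open_greaterThan)
    qed
    then show "emeasure \<Omega> ?loud = ennreal (1 - p)"
      by (subst emeasure_omega_state0(2)[OF Q v N]) (simp_all add: G.emeasure_eq_measure)
  qed
  \<comment> \<open>The norm bounds hold surely, so silence with probability \<open>p\<close>
    reduces the bound on the mean power by the factor \<open>1 - p\<close>.\<close>
  have power: "(\<integral>\<^sup>+ \<omega>. (\<Sum>i<N. ennreal ((F i (fst \<omega>))\<^sup>2)) \<partial>\<Omega>) \<le> ennreal (real N * P)"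
    if F: "\<And>s. sqn N (\<lambda>i. F i s) \<le> (if s 0 \<le> \<tau> then real N * R else 0)" and R: "R * (1 - p) \<le> P" "R \<ge> 0" for F :: "nat \<Rightarrow> (nat \<Rightarrow> real) \<Rightarrow> real" and R P
  proof -
    have "(\<integral>\<^sup>+ \<omega>. (\<Sum>i<N. ennreal ((F i (fst \<omega>))\<^sup>2)) \<partial>\<Omega>)
       \<le> (\<integral>\<^sup>+ \<omega>. ennreal (real N * R) * indicator ?loud \<omega> \<partial>\<Omega>)"
    proof (rule nn_integral_mono)
      fix \<omega> assume \<omega>: "\<omega> \<in> space \<Omega>"
      have "(\<Sum>i<N. ennreal ((F i (fst \<omega>))\<^sup>2)) = ennreal (sqn N (\<lambda>i. F i (fst \<omega>)))"
        by (simp add: sum_ennreal ip_def power2_eq_square)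
      also have "\<dots> \<le> ennreal (if fst \<omega> 0 \<le> \<tau> then real N * R else 0)" by (rule ennreal_leI[OF F])
      also have "\<dots> = ennreal (real N * R) * indicator ?loud \<omega>"
        using \<omega> by simp
      finally show "(\<Sum>i<N. ennreal ((F i (fst \<omega>))\<^sup>2)) \<le> ennreal (real N * R) * indicator ?loud \<omega>" .
    qed
    also have "\<dots> = ennreal (real N * R) * ennreal (1 - p)"
      by (subst nn_integral_cmult_indicator[OF loud(1)]) (simp only: loud(2))
    also have "\<dots> = ennreal (real N * (R * (1 - p)))" using R p01 by (simp add: ennreal_mult[symmetric] mult.assoc)
    also have "\<dots> \<le> ennreal (real N * P)" using R by (intro ennreal_leI mult_left_mono) auto
    finally show ?thesis .
  qed
  have R1: "sqn N (\<lambda>i. g1 i w1 s) \<le> (if s 0 \<le> \<tau> then real N * (c1\<^sup>2 * (A + \<delta>)) else 0)" for w1 s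
  proof (cases "s 0 \<le> \<tau>")
    case True
    have "sqn N (\<lambda>i. g1 i w1 s) = c1\<^sup>2 * sqn N (X ca (a w1) s)"
      using True by (simp add: g1_def ip_def sum_distrib_left power2_eq_square mult_ac)
    also have "\<dots> \<le> c1\<^sup>2 * (real N * (A + \<delta>))" by (intro mult_left_mono X_bound) simp
    finally show ?thesis using True by (simp add: mult_ac)
  qed (simp add: g1_def ip_def)
  have R2: "sqn N (\<lambda>i. g2 i w1 w2 s) \<le> (if s 0 \<le> \<tau> then real N * (c2\<^sup>2 * (A + \<delta>) + (B + \<delta>) + 2 * c2 * \<delta>) else 0)" for w1 w2 s
  proof (cases "s 0 \<le> \<tau>")
    case True
    let ?x = "X ca (a w1) s" and ?z = "Z ca cb (a w1) (b w1 w2) s"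
    have "sqn N (\<lambda>i. g2 i w1 w2 s) = c2\<^sup>2 * sqn N ?x + sqn N ?z + 2 * c2 * ip N ?x ?z"
      unfolding ip_def sum_distrib_left sum.distrib[symmetric] g2_def
      using True by (intro sum.cong refl) (simp add: power2_eq_square algebra_simps)
    \<comment> \<open>Near orthogonality of the two words keeps the cross term at
      \<open>2 * c2 * \<delta>\<close> per letter.\<close>
    also have "\<dots> \<le> c2\<^sup>2 * (real N * (A + \<delta>)) + real N * (B + \<delta>) + 2 * c2 * (real N * \<delta>)"
      using XZ_bound[of ca "a w1" s cb "b w1 w2"] c by (intro add_mono mult_left_mono X_bound Z_bound) auto
    finally show ?thesis using True by (simp add: algebra_simps)
  qed (simp add: g2_def ip_def)
  have "nofb_code P1 P2 Q v N M1 M2 eps g1 g2 dec"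
  proof (rule good_codeI[OF Q v])
    show "(\<integral>\<^sup>+ \<omega>. (\<Sum>i<N. ennreal ((g1 i w1 (fst \<omega>))\<^sup>2)) \<partial>\<Omega>) \<le> ennreal (real N * P1)" for w1 w2
      by (rule power[of "\<lambda>i s. g1 i w1 s", OF R1 P1]) (use A \<delta> in simp)
    show "(\<integral>\<^sup>+ \<omega>. (\<Sum>i<N. ennreal ((g2 i w1 w2 (fst \<omega>))\<^sup>2)) \<partial>\<Omega>) \<le> ennreal (real N * P2)" for w1 w2
      by (rule power[of "\<lambda>i s. g2 i w1 w2 s", OF R2 P2]) (use A B \<delta> c in simp)
    have "0 \<le> c1\<^sup>2 * (A + \<delta>) * (1 - p)" using A \<delta> p01 by simp
    then show "P1 \<ge> 0" using P1 by linarith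
    have "0 \<le> (c2\<^sup>2 * (A + \<delta>) + (B + \<delta>) + 2 * c2 * \<delta>) * (1 - p)" using A B \<delta> p01 c by (intro mult_nonneg_nonneg) auto
    then show "P2 \<ge> 0" using P2 by linarith
    have "(\<Sum>w1\<in>{1..M1}. \<Sum>w2\<in>{1..M2}. measure \<Omega> (?err w1 w2))
       \<le> (\<Sum>w1\<in>{1..M1}. \<Sum>w2\<in>{1..M2}. p + measure \<Omega> (?bad w1 w2))"
      by (intro sum_mono err_le)
    also have "\<dots> = M1 * M2 * p + (\<Sum>w\<in>W. measure \<Omega> {\<omega> \<in> space \<Omega>. bad (a (fst w)) (b (fst w) (snd w)) ((ca, cb), \<omega>)})"
      unfolding W_def by (simp add: sum.distrib sum.cartesian_product' mult.assoc)
    also have "\<dots> \<le> M1 * M2 * p + M1 * M2 * (eps - p)" using total W(3) by simp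
    finally have "(\<Sum>w1\<in>{1..M1}. \<Sum>w2\<in>{1..M2}. measure \<Omega> (?err w1 w2)) \<le> eps * (real M1 * real M2)"
      by (simp add: algebra_simps)
    then show "(\<Sum>w1\<in>{1..M1}. \<Sum>w2\<in>{1..M2}. measure \<Omega>
       {\<omega> \<in> space \<Omega>. dec (yseq (\<lambda>i w1 s y. g1 i w1 s) (\<lambda>i w1 w2 s y. g2 i w1 w2 s) w1 w2 (fst \<omega>) (snd \<omega>) N) \<noteq> (w1, w2)})
       / (real M1 * real M2) \<le> eps"
      unfolding ys_def[symmetric] using M by (simp add: pos_divide_le_eq)
  qed (use g1m g2m err_sets in \<open>simp_all only: ys_def\<close>)
  then show ?thesis by blast
qed

end

section \<open>Achievability\<close>


text \<open>Supplies the silence event: of positive probability, so that power is saved, and small,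
  so that the error it adds is affordable.\<close>

lemma gauss_tail:
  assumes Q: "Q > 0" and e: "e > 0"
  obtains \<tau> where "0 < measure (gauss Q) {\<tau><..}" "measure (gauss Q) {\<tau><..} \<le> e"
proof -
  interpret prob_space "gauss Q" by (rule prob_space_gauss[OF Q])
  have "(\<lambda>n. prob {real n<..}) \<longlonglongrightarrow> prob (\<Inter>n. {real n<..})"
    by (rule finite_Lim_measure_decseq) (auto simp: decseq_def)
  moreover have "(\<Inter>n. {real n<..}) = {}"
  proof -
    have False if "\<And>n. real n < x" for x
      using reals_Archimedean2[of x] that by (meson less_asym)
    then show ?thesis by auto
  qed
  ultimately have "(\<lambda>n. prob {real n<..}) \<longlonglongrightarrow> 0" by simp
  then have "\<forall>\<^sub>F n in sequentially. prob {real n<..} < e" using e by (rule order_tendstoD)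
  then obtain n where n: "prob {real n<..} < e" by (auto dest: eventually_happens)
  have "prob {real n<..} \<noteq> 0"
  proof
    assume "prob {real n<..} = 0"
    then have "{real n<..} \<in> null_sets (gauss Q)" by (simp add: null_sets_def emeasure_eq_measure)
    then have "AE x in lborel. x \<in> {real n<..} \<longrightarrow> ennreal (normal_density 0 (sqrt Q) x) = 0"
      unfolding gauss_def by (subst (asm) null_sets_density_iff) auto
    \<comment> \<open>The density is positive everywhere, so a null tail would make this interval of
      length one null.\<close>
    then have "AE x in lborel. x \<notin> {real n<..<real n + 1}"
      by eventually_elim (use Q in \<open>auto simp: normal_density_pos less_imp_neq[THEN not_sym] not_le\<close>)
    then have "{real n<..<real n + 1} \<in> null_sets lborel" by (subst (asm) AE_iff_null_sets[symmetric]) auto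
    then show False by (simp add: null_sets_def)
  qed
  then show ?thesis using n that[of "real n"] by (simp add: zero_less_measure_iff less_imp_le)
qed

text \<open>The box may grow with \<open>N\<close> at any speed, because the side of the cube never
  enters the rates. A Chebyshev bound on the norm therefore suffices.\<close>

lemma state_box:
  fixes N :: nat
  assumes Q: "Q > 0" and e: "e > 0" and N: "N \<ge> 1"
  obtains L0 where "L0 > 0"
    "emeasure (gaussN N Q) {s \<in> space (gaussN N Q). \<not> (\<forall>i\<in>{..<N}. \<bar>s i\<bar> \<le> L0)} \<le> ennreal e"
proof -
  define t where "t = sqrt (2 * real N * Q\<^sup>2 / e)"
  have t: "t > 0" using Q e N by (simp add: t_def)
  let ?G = "gaussN N Q"
  have "{s \<in> space ?G. \<not> (\<forall>i\<in>{..<N}. \<bar>s i\<bar> \<le> sqrt (real N * Q + t))} \<subseteq> {s \<in> space ?G. \<bar>sqn N s - real N * Q\<bar> \<ge> t}"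
  proof safe
    fix s i assume "i < N" "\<not> \<bar>s i\<bar> \<le> sqrt (real N * Q + t)"
    then have "\<not> sqn N s \<le> real N * Q + t" using abs_le_sqrt_sqn by blast
    then show "t \<le> \<bar>sqn N s - real N * Q\<bar>" by linarith
  qed
  then have "emeasure ?G {s \<in> space ?G. \<not> (\<forall>i\<in>{..<N}. \<bar>s i\<bar> \<le> sqrt (real N * Q + t))}
      \<le> emeasure ?G {s \<in> space ?G. \<bar>sqn N s - real N * Q\<bar> \<ge> t}"
    by (rule emeasure_mono) measurable
  also have "\<dots> \<le> ennreal (2 * real N * Q\<^sup>2 / t\<^sup>2)" by (rule gauss_norm_concentration[OF Q t])
  also have "2 * real N * Q\<^sup>2 / t\<^sup>2 = e" using Q e N by (simp add: t_def)
  finally show ?thesis using that[of "sqrt (real N * Q + t)"] Q t by (simp add: add_nonneg_pos)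
qed

text \<open>The source of the rates. As \<open>\<delta>\<close> tends to 0, \<open>r1 / A\<close>
  tends to \<open>(B + v) / (A + B + v)\<close>, and the N-th power of its square root balances
  \<open>2 powr (N * R)\<close> messages at
  \<open>R = 1 / 2 * log 2 (1 + A / (B + v))\<close>.\<close>

lemma volume_ratio:
  assumes "V > 0" "r > 0"
  shows "ball_vol N r / accept_vol N V \<delta> = 2 * sqrt (r / V * exp (\<delta> / V)) ^ N"
proof -
  have "sqrt (r / V * exp (\<delta> / V)) ^ N = (r / V * exp (\<delta> / V)) powr (N / 2)"
    using assms by (simp add: powr_half_sqrt[symmetric] powr_powr powr_realpow[symmetric])
  also have "\<dots> = (r / V) powr (N / 2) * exp (\<delta> / V * (N / 2))"
    using assms by (subst powr_mult) (simp_all add: powr_def mult.commute)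
  also have "(r / V) powr (N / 2) = (2 * pi * r) powr (N / 2) / (2 * pi * V) powr (N / 2)"
    using assms by (simp add: powr_divide[symmetric])
  also have "exp (\<delta> / V * (N / 2)) = exp (N / 2) / exp (N * (V - \<delta>) / (2 * V))"
  proof -
    have "\<delta> / V * (N / 2) = N / 2 - N * (V - \<delta>) / (2 * V)" using assms by (simp add: field_simps)
    then show ?thesis by (simp only: exp_diff)
  qed
  finally show ?thesis by (simp add: ball_vol_def accept_vol_def)
qed

text \<open>About \<open>l / p\<close> words make all of them miss with probability at most
  \<open>exp (- l)\<close>. Rounding up costs one word, paid for by
  \<open>1 \<le> 1 / p\<close>.\<close>

lemma bin_size:
  fixes p q l :: real
  assumes "0 < p" "p \<le> 1" "l \<ge> 0" "q \<ge> 0"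
  obtains K :: nat where "exp (- (real K * p)) \<le> exp (- l)" "real K * q \<le> (l + 1) * (q / p)"
proof -
  define K where "K = nat \<lceil>l / p\<rceil>"
  have K: "l / p \<le> real K" "real K \<le> l / p + 1" using assms by (auto simp: K_def)
  have "l \<le> real K * p" using K(1) assms by (simp add: pos_divide_le_eq)
  moreover have "real K * q \<le> (l / p + 1 / p) * q"
    using K(2) assms by (intro mult_right_mono) (auto intro: order_trans simp: field_simps)
  ultimately show ?thesis using that[of K] by (simp add: add_divide_distrib[symmetric])
qed

text \<open>The upper bounds hold because \<open>p1\<close> and \<open>p2\<close> lie below
  probabilities, taken here at offset zero; \<open>bin_size\<close> relies on them.\<close>

lemma (in two_stage) p_range: "0 < p1" "p1 \<le> 1" "0 < p2" "p2 \<le> 1"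
proof -
  interpret U: prob_space "ucube N L" by (rule prob_space_ucube[OF L])
  show "0 < p1" "0 < p2" using L A B by (auto simp: p1_def p2_def accept_vol_def)
  have "ennreal p1 \<le> 1"
    unfolding p1_def
    by (rule order_trans[OF offset_accept_prob(2)[where a="\<lambda>_. 0" and g="\<lambda>_. 0" and C=0] U.emeasure_le_1])
      (use sqrt_L L0 in \<open>auto simp: ip_def\<close>)
  then show "p1 \<le> 1" by simp
  have "0 \<le> sqrt (real N * (A + \<delta>))" using A \<delta> by simp
  then have sB: "sqrt (real N * (B + \<delta>)) \<le> L" using sqrt_L(2) L0 by linarith
  have "ennreal p2 \<le> 1"
    unfolding p2_def
    by (rule order_trans[OF offset_accept_prob(2)[where a="\<lambda>_. 0" and g="\<lambda>_. 0" and C="A + \<delta>"] U.emeasure_le_1])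
      (use sB A \<delta> in \<open>auto simp: ip_def\<close>)
  then show "p2 \<le> 1" by simp
qed

section \<open>Block lengths at which every error term is small\<close>

lemma eventually_const_over_n: "e > 0 \<Longrightarrow> \<forall>\<^sub>F N in sequentially. c / real N < (e::real)"
proof -
  assume "e > 0"
  have "(\<lambda>N. c / real N) \<longlonglongrightarrow> 0" by (rule lim_const_over_n)
  then show ?thesis using \<open>e > 0\<close> by (rule order_tendstoD)
qed

lemma eventually_geometric: "e > 0 \<Longrightarrow> 0 \<le> x \<Longrightarrow> x < 1 \<Longrightarrow> \<forall>\<^sub>F N in sequentially. c * x ^ N < (e::real)"
proof -
  assume *: "e > 0" "0 \<le> x" "x < 1"
  have "(\<lambda>N. c * x ^ N) \<longlonglongrightarrow> c * 0" using * by (intro tendsto_mult tendsto_const LIMSEQ_realpow_zero)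
  then show ?thesis using *(1) by (intro order_tendstoD) simp
qed

lemma eventually_good_code:
  fixes A B v Q \<delta> \<eta> p :: real
  assumes pos: "A > 0" "B > 0" "v > 0" "Q > 0" "\<delta> > 0" and \<eta>: "0 < \<eta>" "\<eta> \<le> 1"
    and t1: "2 powr Ra * sqrt ((A * (B + v) / (A + (B + v)) + 9 * \<delta>) / A * exp (\<delta> / A)) < 1"
    and t2: "2 powr Rs * sqrt ((B * (0 + v) / (B + (0 + v)) + 9 * \<delta>) / B * exp (\<delta> / B)) < 1"
    and p: "p = measure (gauss Q) {\<tau><..}"
    and c: "c1 \<ge> 0" "c2 \<ge> 0" "c1 + c2 = 1"
    and P1: "c1\<^sup>2 * (A + \<delta>) * (1 - p) \<le> P1"
    and P2: "(c2\<^sup>2 * (A + \<delta>) + (B + \<delta>) + 2 * c2 * \<delta>) * (1 - p) \<le> P2"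
  shows "\<forall>\<^sub>F N in sequentially. \<forall>M1 M2 Ma Kb. M1 \<ge> 1 \<longrightarrow> M2 \<ge> 1 \<longrightarrow> Ma \<ge> 1 \<longrightarrow> M1 \<le> Ma * Kb \<longrightarrow>
     real Ma \<le> 2 * 2 powr (real N * Ra) \<longrightarrow> real (Kb * M2) \<le> 6 * 2 powr (real N * Rs) \<longrightarrow>
     (\<exists>g1 g2 dec. nofb_code P1 P2 Q v N M1 M2 (\<eta> + p) g1 g2 dec)"
proof -
  define \<theta>1 where "\<theta>1 = sqrt ((A * (B + v) / (A + (B + v)) + 9 * \<delta>) / A * exp (\<delta> / A))"
  define \<theta>2 where "\<theta>2 = sqrt ((B * (0 + v) / (B + (0 + v)) + 9 * \<delta>) / B * exp (\<delta> / B))"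
  have \<theta>: "\<theta>1 \<ge> 0" "\<theta>2 \<ge> 0" unfolding \<theta>1_def \<theta>2_def using pos by simp_all
  \<comment> \<open>The tolerance is divided equally among the eight terms of
    \<open>err_bound\<close>; this \<open>l\<close> gives each covering failure its eighth.\<close>
  define l where "l = ln (8 / \<eta>)"
  have l: "l \<ge> 0" "exp (- l) = \<eta> / 8" using \<eta> by (simp_all add: l_def exp_minus)
  \<comment> \<open>The factors 4 and 12 are the 2 of \<open>volume_ratio\<close> times the factors
    2 and 6 in the message counts.\<close>
  have ev: "\<forall>\<^sub>F N in sequentially. N \<ge> 1 \<and> 2 * A\<^sup>2 / \<delta>\<^sup>2 / real N < 1 / 2 \<and> (2 * B\<^sup>2 + (A + \<delta>) * B) / \<delta>\<^sup>2 / real N < 1 / 2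
     \<and> 2 * v\<^sup>2 / \<delta>\<^sup>2 / real N < \<eta> / 8 \<and> (A + \<delta>) * v / \<delta>\<^sup>2 / real N < \<eta> / 8 \<and> (B + \<delta>) * v / \<delta>\<^sup>2 / real N < \<eta> / 8
     \<and> 4 * (l + 1) * (2 powr Ra * \<theta>1) ^ N < \<eta> / 8 \<and> 12 * (l + 1) * (2 powr Rs * \<theta>2) ^ N < \<eta> / 8"
    using \<eta> t1 t2 \<theta> unfolding \<theta>1_def[symmetric] \<theta>2_def[symmetric]
    by (intro eventually_conj eventually_ge_at_top eventually_const_over_n eventually_geometric) auto
  then show ?thesis
  proof eventually_elim
    case (elim N)
    then have N: "N \<ge> 1" and big1: "2 * A\<^sup>2 / \<delta>\<^sup>2 / real N < 1 / 2" and big2: "(2 * B\<^sup>2 + (A + \<delta>) * B) / \<delta>\<^sup>2 / real N < 1 / 2"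
      and n1: "2 * v\<^sup>2 / \<delta>\<^sup>2 / real N < \<eta> / 8" and n2: "(A + \<delta>) * v / \<delta>\<^sup>2 / real N < \<eta> / 8" and n3: "(B + \<delta>) * v / \<delta>\<^sup>2 / real N < \<eta> / 8"
      and g1: "4 * (l + 1) * (2 powr Ra * \<theta>1) ^ N < \<eta> / 8" and g2: "12 * (l + 1) * (2 powr Rs * \<theta>2) ^ N < \<eta> / 8" by blast+
    have swap: "x / (real N * \<delta>\<^sup>2) = x / \<delta>\<^sup>2 / real N" "real N * x / (real N * \<delta>)\<^sup>2 = x / \<delta>\<^sup>2 / real N" for x
      using N pos by (simp_all add: power_mult_distrib power2_eq_square)
    obtain L0 where L0: "L0 > 0"
      "emeasure (gaussN N Q) {s \<in> space (gaussN N Q). \<not> (\<forall>i\<in>{..<N}. \<bar>s i\<bar> \<le> L0)} \<le> ennreal (\<eta> / 8)"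
      using state_box[OF pos(4) _ N, of "\<eta> / 8"] \<eta> by auto
    have loc: "two_stage N A B v Q \<delta> L0"
      using pos N L0 big1 big2 unfolding swap(1)[symmetric] by unfold_locales auto
    show ?case
    proof (intro allI impI)
      fix M1 M2 Ma Kb :: nat
      assume M: "M1 \<ge> 1" "M2 \<ge> 1" "Ma \<ge> 1" "M1 \<le> Ma * Kb"
        and Ma: "real Ma \<le> 2 * 2 powr (real N * Ra)" and Mb: "real (Kb * M2) \<le> 6 * 2 powr (real N * Rs)"
      \<comment> \<open>The word probabilities do not depend on the bin sizes, so they are read off
        with empty bins; the sizes are then chosen from them and the locale is entered
        again.\<close>
      interpret S0: two_stage N 0 0 Ma "Kb * M2" A B v Q \<delta> L0 by (rule loc)
      have ratio1: "S0.q1 / S0.p1 = 2 * \<theta>1 ^ N" and ratio2: "S0.q2 / S0.p2 = 2 * \<theta>2 ^ N"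
        using volume_ratio[OF pos(1) S0.r_pos(1), of N \<delta>] volume_ratio[OF pos(2) S0.r_pos(2), of N \<delta>] S0.L
        by (simp_all add: S0.q1_def S0.p1_def S0.q2_def S0.p2_def S0.r1_def S0.r2_def \<theta>1_def \<theta>2_def)
      obtain K1 where K1: "exp (- (real K1 * S0.p1)) \<le> exp (- l)" "real K1 * S0.q1 \<le> (l + 1) * (S0.q1 / S0.p1)"
        using bin_size[OF S0.p_range(1,2) l(1) S0.nonneg_pq(3)] by blast
      obtain K2 where K2: "exp (- (real K2 * S0.p2)) \<le> exp (- l)" "real K2 * S0.q2 \<le> (l + 1) * (S0.q2 / S0.p2)"
        using bin_size[OF S0.p_range(3,4) l(1) S0.nonneg_pq(4)] by blast
      interpret S: two_stage N K1 K2 Ma "Kb * M2" A B v Q \<delta> L0 by (rule loc)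
      have pw: "2 powr (real N * R) * \<theta> ^ N = (2 powr R * \<theta>) ^ N" for R \<theta> :: real
        by (simp add: power_mult_distrib powr_realpow[symmetric] powr_powr mult.commute)
      have b1: "real Ma * real K1 * S0.q1 < \<eta> / 8"
      proof -
        have "real Ma * (real K1 * S0.q1) \<le> (2 * 2 powr (real N * Ra)) * ((l + 1) * (2 * \<theta>1 ^ N))"
          by (rule mult_mono[OF Ma K1(2)[unfolded ratio1]]) (use S0.nonneg_pq in auto)
        also have "\<dots> = 4 * (l + 1) * (2 powr Ra * \<theta>1) ^ N" unfolding pw[symmetric] by simp
        finally show ?thesis using g1 by (simp add: mult.assoc)
      qed
      have b2: "real (Kb * M2) * real K2 * S0.q2 < \<eta> / 8"
      proof -
        have "real (Kb * M2) * (real K2 * S0.q2) \<le> (6 * 2 powr (real N * Rs)) * ((l + 1) * (2 * \<theta>2 ^ N))"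
          by (rule mult_mono[OF Mb K2(2)[unfolded ratio2]]) (use S0.nonneg_pq in auto)
        also have "\<dots> = 12 * (l + 1) * (2 powr Rs * \<theta>2) ^ N" unfolding pw[symmetric] by simp
        finally show ?thesis using g2 by (simp add: mult.assoc)
      qed
      have n1': "2 * real N * v\<^sup>2 / (real N * \<delta>)\<^sup>2 < \<eta> / 8"
        using n1 swap(2)[of "2 * v\<^sup>2"] by (simp add: mult_ac)
      have n2': "real N * (A + \<delta>) * v / (real N * \<delta>)\<^sup>2 < \<eta> / 8" "real N * (B + \<delta>) * v / (real N * \<delta>)\<^sup>2 < \<eta> / 8"
        using n2 n3 swap(2)[of "(A + \<delta>) * v"] swap(2)[of "(B + \<delta>) * v"] by (simp_all add: mult.assoc)
      have "S.err_bound (\<eta> / 8) < \<eta> + p - p"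
        unfolding S.err_bound_def using K1(1) K2(1) b1 b2 n1' n2' l(2) by linarith
      then show "\<exists>g1 g2 dec. nofb_code P1 P2 Q v N M1 M2 (\<eta> + p) g1 g2 dec"
        using S.good_code_exists[OF M refl _ L0(2) p _ c P1 P2, of "\<eta> + p"] \<eta> by simp
    qed
  qed
qed

section \<open>Splitting rates and powers\<close>

lemma good_code_mono: "good_code P1 P2 Q v N M1 M2 eps f1 f2 dec \<Longrightarrow> eps \<le> eps' \<Longrightarrow> good_code P1 P2 Q v N M1 M2 eps' f1 f2 dec"
  unfolding good_code_def Let_def by (blast intro: order_trans)

text \<open>The quotient contributes at most \<open>2 * 2 powr (N * (R1 - Ra))\<close>, and rounding
  it up contributes 1, which matters when \<open>Ra\<close> exceeds \<open>R1\<close>. Hence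
  \<open>Rs\<close> must dominate both exponents, and the factor is 4 + 2.\<close>

lemma split_message_count:
  fixes R1 R2 Ra Rs :: real
  assumes R: "R1 \<ge> 0" "R2 \<ge> 0" "Ra \<ge> 0" and Rs: "R2 \<le> Rs" "R1 + R2 - Ra \<le> Rs"
  shows "msgs N R1 \<le> msgs N Ra * (msgs N R1 div msgs N Ra + 1)"
    "real ((msgs N R1 div msgs N Ra + 1) * msgs N R2) \<le> 6 * 2 powr (real N * Rs)"
proof -
  have "msgs N R1 = msgs N Ra * (msgs N R1 div msgs N Ra) + msgs N R1 mod msgs N Ra" by simp
  also have "\<dots> \<le> msgs N Ra * (msgs N R1 div msgs N Ra) + msgs N Ra"
    using msgs_bounds(3)[OF R(3), of N] by (intro add_left_mono less_imp_le mod_less_divisor) simp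
  finally show "msgs N R1 \<le> msgs N Ra * (msgs N R1 div msgs N Ra + 1)" by simp
  have "real (msgs N R1 div msgs N Ra) \<le> real (msgs N R1) / real (msgs N Ra)" by (rule of_nat_div_le_of_nat)
  also have "\<dots> \<le> (2 * 2 powr (real N * R1)) / 2 powr (real N * Ra)"
    using msgs_bounds[OF R(1), of N] msgs_bounds[OF R(3), of N] by (intro frac_le) auto
  also have "\<dots> = 2 * 2 powr (real N * (R1 - Ra))" by (simp add: powr_diff right_diff_distrib)
  finally have 1: "real (msgs N R1 div msgs N Ra) + 1 \<le> 2 * 2 powr (real N * (R1 - Ra)) + 1" by simp
  have "real ((msgs N R1 div msgs N Ra + 1) * msgs N R2) = (real (msgs N R1 div msgs N Ra) + 1) * real (msgs N R2)"
    by (simp add: algebra_simps)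
  also have "\<dots> \<le> (2 * 2 powr (real N * (R1 - Ra)) + 1) * (2 * 2 powr (real N * R2))"
    using msgs_bounds[OF R(2), of N] by (intro mult_mono 1) auto
  also have "\<dots> = 4 * 2 powr (real N * (R1 + R2 - Ra)) + 2 * 2 powr (real N * R2)"
    by (simp add: algebra_simps powr_add[symmetric])
  also have "\<dots> \<le> 4 * 2 powr (real N * Rs) + 2 * 2 powr (real N * Rs)"
    using Rs by (intro add_mono mult_left_mono powr_mono) auto
  finally show "real ((msgs N R1 div msgs N Ra + 1) * msgs N R2) \<le> 6 * 2 powr (real N * Rs)" by simp
qed

text \<open>Any power gain makes both rate constraints strict; at \<open>\<rho> = 1\<close>, where the first one degenerates,
  part of the gain is traded for a correlation \<open>1 / \<kappa> < 1\<close>.\<close>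
lemma strict_rates:
  fixes P1 P2 v \<kappa> \<rho> R1 R2 :: real
  assumes P: "P1 > 0" "P2 > 0" and v: "v > 0" and \<kappa>: "\<kappa> > 1" and \<rho>: "\<rho> \<in> {0..1}"
    and 1: "R2 \<le> 1 / 2 * log 2 (1 + P2 * (1 - \<rho>\<^sup>2) / v)"
    and 2: "R1 + R2 \<le> 1 / 2 * log 2 (1 + (P1 + P2 + 2 * sqrt (P1 * P2) * \<rho>) / v)"
  obtains \<rho>' where "0 \<le> \<rho>'" "\<rho>' < 1" "R2 < 1 / 2 * log 2 (1 + \<kappa> * P2 * (1 - \<rho>'\<^sup>2) / v)"
    "R1 + R2 < 1 / 2 * log 2 (1 + \<kappa> * (P1 + P2 + 2 * sqrt (P1 * P2) * \<rho>') / v)"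
proof -
  have lt: "1 / 2 * log 2 (1 + x / v) < 1 / 2 * log 2 (1 + y / v)" if "0 \<le> x" "x < y" for x y
    using that v by (simp add: divide_strict_right_mono add_pos_nonneg)
  have g: "sqrt (P1 * P2) > 0" using P by simp
  show ?thesis
  proof (cases "\<rho> = 1")
    case False
    then have r: "0 \<le> \<rho>" "\<rho> < 1" using \<rho> by auto
    then have r2: "\<rho>\<^sup>2 < 1" by (simp add: power_less_one_iff abs_square_less_1)
    have a: "0 \<le> P2 * (1 - \<rho>\<^sup>2)" "P2 * (1 - \<rho>\<^sup>2) < \<kappa> * P2 * (1 - \<rho>\<^sup>2)"
      using P r2 \<kappa> by auto
    have b: "0 \<le> P1 + P2 + 2 * sqrt (P1 * P2) * \<rho>" "P1 + P2 + 2 * sqrt (P1 * P2) * \<rho> < \<kappa> * (P1 + P2 + 2 * sqrt (P1 * P2) * \<rho>)"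
    proof -
      have "P1 + P2 + 2 * sqrt (P1 * P2) * \<rho> > 0" using P r g by (intro add_pos_nonneg) auto
      then show "0 \<le> P1 + P2 + 2 * sqrt (P1 * P2) * \<rho>" "P1 + P2 + 2 * sqrt (P1 * P2) * \<rho> < \<kappa> * (P1 + P2 + 2 * sqrt (P1 * P2) * \<rho>)"
        using \<kappa> by simp_all
    qed
    show ?thesis using that[OF r le_less_trans[OF 1 lt[OF a]] le_less_trans[OF 2 lt[OF b]]] .
  next
    case True
    \<comment> \<open>With correlation \<open>1 / \<kappa>\<close> the gain exactly restores the
      cross term, while \<open>P1 + P2\<close> still grows by the factor
      \<open>\<kappa>\<close>.\<close>
    have k: "0 \<le> 1 / \<kappa>" "1 / \<kappa> < 1" using \<kappa> by auto
    then have k2: "(1 / \<kappa>)\<^sup>2 < 1" by (simp add: abs_square_less_1)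
    have a: "0 \<le> P2 * (1 - \<rho>\<^sup>2)" "P2 * (1 - \<rho>\<^sup>2) < \<kappa> * P2 * (1 - (1 / \<kappa>)\<^sup>2)"
      using True P \<kappa> k2 by auto
    have b: "0 \<le> P1 + P2 + 2 * sqrt (P1 * P2) * \<rho>" "P1 + P2 + 2 * sqrt (P1 * P2) * \<rho> < \<kappa> * (P1 + P2 + 2 * sqrt (P1 * P2) * (1 / \<kappa>))"
    proof -
      show "0 \<le> P1 + P2 + 2 * sqrt (P1 * P2) * \<rho>" using True P g by simp
      have "\<kappa> * (P1 + P2 + 2 * sqrt (P1 * P2) * (1 / \<kappa>)) = \<kappa> * (P1 + P2) + 2 * sqrt (P1 * P2)"
        using \<kappa> by (simp add: distrib_left)
      moreover have "P1 + P2 < \<kappa> * (P1 + P2)" using P \<kappa> by simp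
      ultimately show "P1 + P2 + 2 * sqrt (P1 * P2) * \<rho> < \<kappa> * (P1 + P2 + 2 * sqrt (P1 * P2) * (1 / \<kappa>))" using True by simp
    qed
    show ?thesis using that[OF k le_less_trans[OF 1 lt[OF a]] le_less_trans[OF 2 lt[OF b]]] .
  qed
qed

text \<open>The value at slack 0 of the growth factors bounded in
  \<open>eventually_good_code\<close>; the zeros keep that shape so that it matches a limit.\<close>

lemma rate_below_capacity:
  fixes a n R :: real
  assumes "a > 0" "n > 0" "R < 1 / 2 * log 2 ((a + n) / n)"
  shows "2 powr R * sqrt ((a * n / (a + n) + 9 * 0) / a * exp (0 / a)) < 1"
proof -
  have q: "(a + n) / n > 0" using assms by simp
  have "2 powr R < 2 powr (1 / 2 * log 2 ((a + n) / n))" using assms(3) by simp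
  also have "\<dots> = (2 powr log 2 ((a + n) / n)) powr (1 / 2)" by (simp add: powr_powr mult.commute)
  also have "\<dots> = sqrt ((a + n) / n)" using q by (simp add: powr_half_sqrt)
  finally have "2 powr R * sqrt (n / (a + n)) < sqrt ((a + n) / n) * sqrt (n / (a + n))"
    using assms by (intro mult_strict_right_mono) auto
  also have "\<dots> = 1" using assms by (simp add: real_sqrt_mult[symmetric])
  finally show ?thesis using assms by simp
qed

lemma achievability:
  assumes P: "P1 > 0" "P2 > 0" and Q: "Q > 0" and v: "v > 0" and r: "r \<in> region P1 P2 v"
  shows "achievable_nofb P1 P2 Q v r"
proof -
  obtain R1 R2 \<rho> where r12: "r = (R1, R2)" and \<rho>: "\<rho> \<in> {0..1}" and R: "R1 \<ge> 0" "R2 \<ge> 0"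
    and rate1: "R2 \<le> 1 / 2 * log 2 (1 + P2 * (1 - \<rho>\<^sup>2) / v)"
    and rate2: "R1 + R2 \<le> 1 / 2 * log 2 (1 + (P1 + P2 + 2 * sqrt (P1 * P2) * \<rho>) / v)"
    using r unfolding region_def by auto
  have "\<exists>N0. \<forall>N\<ge>N0. \<exists>g1 g2 dec. nofb_code P1 P2 Q v N (msgs N R1) (msgs N R2) eps g1 g2 dec"
    if eps: "eps > 0" for eps :: real
  proof -
    \<comment> \<open>Capped at 1 so that the silence probability \<open>p \<le> e / 2\<close> stays
      below 1.\<close>
    define e where "e = min eps 1"
    have e: "e > 0" "e \<le> 1" "e \<le> eps" using eps by (auto simp: e_def)
    obtain \<tau> where \<tau>: "0 < measure (gauss Q) {\<tau><..}" "measure (gauss Q) {\<tau><..} \<le> e / 2"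
      using gauss_tail[OF Q, of "e / 2"] e by auto
    define p where "p = measure (gauss Q) {\<tau><..}"
    have p: "0 < p" "p \<le> e / 2" "p < 1" using \<tau> e by (auto simp: p_def)
    \<comment> \<open>The power allowed while transmitting is scaled by \<open>\<kappa>\<close>; on
      average it is scaled by \<open>\<kappa> * (1 - p) = 1 - p\<^sup>2\<close>.\<close>
    define \<kappa> where "\<kappa> = 1 + p"
    have \<kappa>: "\<kappa> > 1" "\<kappa> * (1 - p) < 1" using p by (auto simp: \<kappa>_def algebra_simps)
    obtain \<rho>' where \<rho>': "0 \<le> \<rho>'" "\<rho>' < 1" and s1: "R2 < 1 / 2 * log 2 (1 + \<kappa> * P2 * (1 - \<rho>'\<^sup>2) / v)"
      and s2: "R1 + R2 < 1 / 2 * log 2 (1 + \<kappa> * (P1 + P2 + 2 * sqrt (P1 * P2) * \<rho>') / v)"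
      using strict_rates[OF P v \<kappa>(1) \<rho> rate1 rate2] .
    \<comment> \<open>Encoder 1 puts all its amplitude \<open>a\<close> into the common word, and
      encoder 2 the part \<open>b\<close>. They add coherently to power \<open>A\<close>; the rest
      of encoder 2's power is \<open>B\<close>.\<close>
    define a where "a = sqrt (\<kappa> * P1)"
    define b where "b = \<rho>' * sqrt (\<kappa> * P2)"
    define A where "A = (a + b)\<^sup>2"
    define B where "B = \<kappa> * P2 * (1 - \<rho>'\<^sup>2)"
    have a: "a > 0" using P \<kappa> by (simp add: a_def)
    have b: "b \<ge> 0" using P \<kappa> \<rho>' by (simp add: b_def)
    have "\<rho>'\<^sup>2 < 1" using \<rho>' by (simp add: abs_square_less_1)
    then have B: "B > 0" using P \<kappa> by (simp add: B_def)
    have A: "A > 0" using a b by (simp add: A_def add_pos_nonneg less_imp_neq[THEN not_sym])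
    define c1 where "c1 = a / (a + b)"
    define c2 where "c2 = b / (a + b)"
    have c: "c1 \<ge> 0" "c2 \<ge> 0" "c1 + c2 = 1" using a b by (auto simp: c1_def c2_def add_divide_distrib[symmetric])
    have ab: "a + b \<noteq> 0" using a b by linarith
    have c1A: "c1\<^sup>2 * A = \<kappa> * P1"
    proof -
      have "c1\<^sup>2 * A = a\<^sup>2" using ab by (simp add: c1_def A_def power_divide)
      then show ?thesis using P \<kappa> by (simp add: a_def)
    qed
    have c2A: "c2\<^sup>2 * A + B = \<kappa> * P2"
    proof -
      have "c2\<^sup>2 * A = b\<^sup>2" using ab by (simp add: c2_def A_def power_divide)
      also have "\<dots> = \<rho>'\<^sup>2 * (\<kappa> * P2)" using P \<kappa> by (simp add: b_def power_mult_distrib)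
      finally show ?thesis by (simp add: B_def algebra_simps)
    qed
    have AB: "A + B = \<kappa> * (P1 + P2 + 2 * sqrt (P1 * P2) * \<rho>')"
    proof -
      have "a * b = \<rho>' * (\<kappa> * sqrt (P1 * P2))" using P \<kappa> by (simp add: a_def b_def real_sqrt_mult)
      then have "A = \<kappa> * P1 + \<rho>'\<^sup>2 * (\<kappa> * P2) + 2 * (\<rho>' * (\<kappa> * sqrt (P1 * P2)))"
        using P \<kappa> by (simp add: A_def power2_sum a_def b_def power_mult_distrib)
      then show ?thesis by (simp add: B_def algebra_simps)
    qed
    \<comment> \<open>The common code meets encoder 2's word as additional noise; encoder 2's code
      meets only the channel noise. The two limits add up to the logarithm of the sum rate.\<close>
    define CA where "CA = 1 / 2 * log 2 ((A + (B + v)) / (B + v))"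
    define CB where "CB = 1 / 2 * log 2 ((B + (0 + v)) / (0 + v))"
    have CA0: "CA > 0" using A B v by (simp add: CA_def)
    have sCB: "R2 < CB" using s1 v by (simp add: CB_def B_def[symmetric] add_divide_distrib add.commute)
    have sCAB: "R1 + R2 < CA + CB"
    proof -
      have "CA + CB = 1 / 2 * log 2 ((A + (B + v)) / (B + v) * ((B + v) / v))"
      proof -
        have "log 2 (x * y) = log 2 x + log 2 y" if "x > 0" "y > 0" for x y :: real
          using that by (simp add: log_mult)
        from this[of "(A + (B + v)) / (B + v)" "(B + v) / v"] show ?thesis using A B v by (simp only: CA_def CB_def add_0 distrib_left divide_pos_pos add_pos_pos)
      qed
      also have "(A + (B + v)) / (B + v) * ((B + v) / v) = 1 + (A + B) / v"
      proof -
        have "(A + (B + v)) / (B + v) * ((B + v) / v) = (A + (B + v)) / v" using B v by simp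
        then show ?thesis using v by (simp add: add_divide_distrib)
      qed
      finally show ?thesis using s2 by (simp add: AB)
    qed
    \<comment> \<open>The common word must carry more than \<open>R1 + R2 - CB\<close>, so that the
      remaining rate falls strictly below \<open>CB\<close>.\<close>
    obtain Ra where Ra: "max 0 (R1 + R2 - CB) < Ra" "Ra < CA"
      using dense[of "max 0 (R1 + R2 - CB)" CA] CA0 sCAB by auto
    define Rs where "Rs = max R2 (R1 + R2 - Ra)"
    have Rs: "Rs < CB" using Ra sCB by (auto simp: Rs_def)
    let ?f1 = "\<lambda>\<delta>. 2 powr Ra * sqrt ((A * (B + v) / (A + (B + v)) + 9 * \<delta>) / A * exp (\<delta> / A))"
    let ?f2 = "\<lambda>\<delta>. 2 powr Rs * sqrt ((B * (0 + v) / (B + (0 + v)) + 9 * \<delta>) / B * exp (\<delta> / B))"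
    let ?h1 = "\<lambda>\<delta>. c1\<^sup>2 * (A + \<delta>) * (1 - p)"
    let ?h2 = "\<lambda>\<delta>. (c2\<^sup>2 * (A + \<delta>) + (B + \<delta>) + 2 * c2 * \<delta>) * (1 - p)"
    \<comment> \<open>All four conditions are strict at slack 0, hence by continuity they survive
      for some positive \<open>\<delta>\<close>.\<close>
    have "\<forall>\<^sub>F \<delta> in at_right 0. ?f1 \<delta> < 1"
    proof (rule order_tendstoD(2))
      show "(?f1 \<longlongrightarrow> ?f1 0) (at_right 0)" using A by (intro tendsto_intros) auto
      show "?f1 0 < 1" using rate_below_capacity[OF A _ Ra(2)[unfolded CA_def]] B v by simp
    qed
    moreover have "\<forall>\<^sub>F \<delta> in at_right 0. ?f2 \<delta> < 1"
    proof (rule order_tendstoD(2))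
      show "(?f2 \<longlongrightarrow> ?f2 0) (at_right 0)" using B by (intro tendsto_intros) auto
      show "?f2 0 < 1" using rate_below_capacity[OF B _ Rs[unfolded CB_def]] v by simp
    qed
    moreover have "\<forall>\<^sub>F \<delta> in at_right 0. ?h1 \<delta> < P1"
    proof (rule order_tendstoD(2))
      show "(?h1 \<longlongrightarrow> ?h1 0) (at_right 0)" by (intro tendsto_intros)
      have "?h1 0 = (c1\<^sup>2 * A) * (1 - p)" by simp
      then show "?h1 0 < P1" using mult_strict_right_mono[OF \<kappa>(2) P(1)] unfolding c1A by (simp only: mult_ac mult_1)
    qed
    moreover have "\<forall>\<^sub>F \<delta> in at_right 0. ?h2 \<delta> < P2"
    proof (rule order_tendstoD(2))
      show "(?h2 \<longlongrightarrow> ?h2 0) (at_right 0)" by (intro tendsto_intros)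
      have "?h2 0 = (c2\<^sup>2 * A + B) * (1 - p)" by simp
      then show "?h2 0 < P2" using mult_strict_right_mono[OF \<kappa>(2) P(2)] unfolding c2A by (simp only: mult_ac mult_1)
    qed
    moreover have "\<forall>\<^sub>F \<delta> in at_right 0. (0::real) < \<delta>" by (rule eventually_at_right_less)
    ultimately have "\<forall>\<^sub>F \<delta> in at_right 0. ?f1 \<delta> < 1 \<and> ?f2 \<delta> < 1 \<and> ?h1 \<delta> < P1 \<and> ?h2 \<delta> < P2 \<and> 0 < \<delta>"
      by eventually_elim blast
    then obtain \<delta> where \<delta>: "?f1 \<delta> < 1" "?f2 \<delta> < 1" "?h1 \<delta> < P1" "?h2 \<delta> < P2" "0 < \<delta>"
      by (auto dest!: eventually_happens'[OF trivial_limit_at_right_real])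
    \<comment> \<open>The part \<open>p\<close> of the tolerated error is spent on silence; the rest
      is left to the codes.\<close>
    have \<eta>: "0 < e - p" "e - p \<le> 1" using p e by auto
    from eventually_good_code[OF A B v Q \<delta>(5) \<eta> \<delta>(1,2) p_def c less_imp_le[OF \<delta>(3)] less_imp_le[OF \<delta>(4)]]
    obtain N0 where N0: "\<And>N M1 M2 Ma Kb. N \<ge> N0 \<Longrightarrow> M1 \<ge> 1 \<Longrightarrow> M2 \<ge> 1 \<Longrightarrow> Ma \<ge> 1 \<Longrightarrow> M1 \<le> Ma * Kb \<Longrightarrow>
      real Ma \<le> 2 * 2 powr (real N * Ra) \<Longrightarrow> real (Kb * M2) \<le> 6 * 2 powr (real N * Rs) \<Longrightarrow>
      \<exists>g1 g2 dec. nofb_code P1 P2 Q v N M1 M2 (e - p + p) g1 g2 dec"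
      unfolding eventually_sequentially by blast
    have Ra0: "Ra \<ge> 0" using Ra(1) by simp
    have RsR: "R2 \<le> Rs" "R1 + R2 - Ra \<le> Rs" by (auto simp: Rs_def)
    show ?thesis
    proof (intro exI[of _ N0] allI impI)
      fix N assume "N \<ge> N0"
      from N0[OF this msgs_bounds(3)[OF R(1)] msgs_bounds(3)[OF R(2)] msgs_bounds(3)[OF Ra0]
          split_message_count(1)[OF R Ra0 RsR] msgs_bounds(2)[OF Ra0] split_message_count(2)[OF R Ra0 RsR]]
      show "\<exists>g1 g2 dec. nofb_code P1 P2 Q v N (msgs N R1) (msgs N R2) eps g1 g2 dec"
        using good_code_mono[OF _ e(3)] by (simp only: diff_add_cancel) blast
    qed
  qed
  then show ?thesis unfolding achievable_nofb_def r12 fst_conv snd_conv using R by blast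
qed

lemma achievable_fb_of_nofb: "achievable_nofb P1 P2 Q v r \<Longrightarrow> achievable_fb P1 P2 Q v r"
  unfolding achievable_nofb_def achievable_fb_def by meson

theorem theorem9:
  fixes P1 P2 Q \<sigma>sq :: real
  assumes "P1 > 0" and "P2 > 0" and "Q > 0" and "\<sigma>sq > 0"
  shows "capacity_fb P1 P2 Q \<sigma>sq = capacity_nofb P1 P2 Q \<sigma>sq
         \<and> capacity_nofb P1 P2 Q \<sigma>sq = region P1 P2 \<sigma>sq"
  \<comment> \<open>The inclusions form a circle: region into no feedback, no feedback into
    feedback, feedback into region.\<close>
  using converse[OF assms] achievability[OF assms] achievable_fb_of_nofb
  unfolding capacity_fb_def capacity_nofb_def by blast

end
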